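(* Let $d\in\mathbb{N}_{\geq 2}$ and $C>0$, and let $\mathscr{C}=B_{d-1}(C)$. Then, for all $m\in\mathbb{N}$ and with implied constants independent of $m$, $$m^{-\frac{d+1}{3d-1}}\cdot[\ln(2m)]^{-\frac{(d+1)(5d-3)}{(3d-1)(2d-2)}}\;\lesssim\;\inf_{A\in\mathcal{A}_m(\Lambda,L^2)}\;\sup_{h\in H_{\mathscr{C}}}\;\mathbb{E}_{(X_i)_{i=1}^m\overset{iid}{\sim}\boldsymbol{\lambda}}\Big\|A\bigl((X_i,h(X_i))_{i=1}^m\bigr)-h\Big\|_{L^2}^2\;\lesssim\; m^{-\frac{d+1}{3d-1}}\cdot[\ln(2m)]^{\frac{5d-3}{3d-1}} .$$
   Context: For $k\in\mathbb{N}$ and $C>0$, $B_k(C)$ is the (Barron) class of all functions $f:[0,1]^k\to[0,1]$ for which there exist a measurable $F:\mathbb{R}^k\to\mathbb{C}$ and some $c\in[-C,C]$ with $f(x)=c+\int_{\mathbb{R}^k}(e^{i\langle x,\xi\rangle}-1)F(\xi)\,d\xi$ for all $x\in[0,1]^k$ and $\int_{\mathbb{R}^k}|\xi|\,|F(\xi)|\,d\xi\leq C$. $\boldsymbol{\lambda}$ is the uniform (Lebesgue) probability measure on $[0,1]^d$ and $L^2=L^2(\boldsymbol{\lambda})$. $\Lambda:=[0,1]^d\times\{0,1\}$, and $\mathcal{A}_m(\Lambda,L^2)$ is the set of all measurable maps $\Lambda^m\to L^2([0,1]^d)$ (estimators). For $b:[0,1]^{d-1}\to[0,1]$, the horizon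 function $h_b:[0,1]^d\to\{0,1\}$ is $h_b(x)=1$ if $b(x_1,\dots,x_{d-1})\leq x_d$ and $h_b(x)=0$ otherwise; $H_{\mathscr{C}}:=\{h_b:b\in\mathscr{C}\}$. *)

theory Defs
  imports "HOL-Analysis.Analysis"
begin

abbreviation unit_cube :: "'a::euclidean_space set" where
  "unit_cube \<equiv> cbox 0 One"

definition cube_measure :: "'a::euclidean_space measure" where
  "cube_measure = restrict_space lborel unit_cube"

(* Functions with domain the unit cube are extensional, hence PiE. The Bochner integral below
   is always a genuine integral: the integrand is bounded by norm xi * norm (F xi) up to the
   factor norm x. *)
definition barron_class :: "real \<Rightarrow> ('a::euclidean_space \<Rightarrow> real) set" where
  "barron_class C = {f \<in> unit_cube \<rightarrow>\<^sub>E {0..1}.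
     \<exists>F :: 'a \<Rightarrow> complex. \<exists>c \<in> {-C..C}. F \<in> borel_measurable borel \<and>
       (\<forall>x \<in> unit_cube. complex_of_real (f x) = complex_of_real c +
          (LINT \<xi>|lborel. (exp (\<i> * complex_of_real (x \<bullet> \<xi>)) - 1) * F \<xi>)) \<and>
       (\<integral>\<^sup>+ \<xi>. ennreal (norm \<xi> * norm (F \<xi>)) \<partial>lborel) \<le> ennreal C}"

(* R^d is realised as R^(d-1) x R; the last coordinate is the second component. *)
definition horizon :: "('a::euclidean_space \<Rightarrow> real) \<Rightarrow> 'a \<times> real \<Rightarrow> real" where
  "horizon b = (\<lambda>x \<in> unit_cube. if b (fst x) \<le> snd x then 1 else 0)"

definition horizon_class :: "('a::euclidean_space \<Rightarrow> real) set \<Rightarrow> ('a \<times> real \<Rightarrow> real) set" where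
  "horizon_class B = horizon ` B"

definition L2_functions :: "'a measure \<Rightarrow> ('a \<Rightarrow> real) set" where
  "L2_functions M = {f \<in> borel_measurable M. integrable M (\<lambda>x. (f x)\<^sup>2)}"

definition L2_norm :: "'a measure \<Rightarrow> ('a \<Rightarrow> real) \<Rightarrow> real" where
  "L2_norm M f = sqrt (LINT x|M. (f x)\<^sup>2)"

definition L2_open :: "'a measure \<Rightarrow> ('a \<Rightarrow> real) set \<Rightarrow> bool" where
  "L2_open M U \<longleftrightarrow> U \<subseteq> L2_functions M \<and>
     (\<forall>f \<in> U. \<exists>e>0. \<forall>g \<in> L2_functions M. L2_norm M (\<lambda>x. g x - f x) < e \<longrightarrow> g \<in> U)"

(* Elements of L^2 are given by representatives. Sets that are open for the L^2 seminorm are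
   closed under almost-everywhere equality, so this sigma-algebra is exactly the preimage of the
   Borel sigma-algebra of the quotient space L^2(M). *)
definition L2_borel :: "'a measure \<Rightarrow> ('a \<Rightarrow> real) measure" where
  "L2_borel M = sigma (L2_functions M) {U. L2_open M U}"

definition labelled_space :: "('a::euclidean_space \<times> real) measure" where
  "labelled_space = restrict_space borel (unit_cube \<times> {0, 1})"

definition estimators ::
    "nat \<Rightarrow> ((nat \<Rightarrow> 'a \<times> real) \<Rightarrow> 'a::euclidean_space \<Rightarrow> real) set" where
  "estimators m = measurable (PiM {1..m} (\<lambda>_. labelled_space)) (L2_borel cube_measure)"

definition expected_sq_error :: "nat \<Rightarrow> ((nat \<Rightarrow> 'a \<times> real) \<Rightarrow> 'a::euclidean_space \<Rightarrow> real) \<Rightarrow>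
    ('a \<Rightarrow> real) \<Rightarrow> ennreal" where
  "expected_sq_error m A h =
     (\<integral>\<^sup>+ X. ennreal ((L2_norm cube_measure
                 (\<lambda>y. A (\<lambda>i \<in> {1..m}. (X i, h (X i))) y - h y))\<^sup>2)
        \<partial>PiM {1..m} (\<lambda>_. cube_measure))"

definition minimax_error :: "('a::euclidean_space \<Rightarrow> real) set \<Rightarrow> nat \<Rightarrow> ennreal" where
  "minimax_error H m = (INF A \<in> estimators m. SUP h \<in> H. expected_sq_error m A h)"

end

(* Lower bound: put a bump of height h into each cell of a grid with N = L^k cells, k = d - 1.
   The Fourier transform of any 0/1-combination of the bumps is a trigonometric polynomial times a
   fast decaying factor, and orthogonality of integer frequencies bounds its Barron norm by a
   constant times h L sqrt N. So the whole hypercube of combinations lies in the Barron class for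
   h of order N^(-1/2 - 1/k). A sample reveals whether the bump of a given cell is present only if
   it falls into a set of measure h/N, and Assouad's argument gives an error of order h when
   m h/N is bounded.

   Upper bound: a Barron function is a mixture of the waves (exp(i<x,xi>) - 1)/|xi|. Waves from
   the same dyadic cube of relative side 1/M differ by O(1/M) on the unit cube, so stratified
   sampling of about M^k log m waves has L^2 error O(M^(-1 - k/2)). Rounding the weights gives a
   net whose logarithmic size is of order M^k (log m)^2, and empirical risk minimisation over the
   net has risk of the order of the approximation error plus log(size)/m. The latter is a union
   bound over the exponential moments of 1_D' - 1_D, where D and D' are the sets on which a given
   and the best net element mislabel, and exp(1_D' - 1_D) <= 1 + 2 1_D' - 1_D/2. *)

theory Submission
  imports Defs "HOL-Probability.Probability"
begin

section \<open>Compactly supported splines by Fourier inversion\<close>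

text \<open>Both bounds balance the same quantities. Bumps on L^k cells have height L^(-1 - k/2),
  the net errs by M^(-1 - k/2), and weighing either against M^k / m gives L and M of order
  m^(2/(3k+2)), hence m^(-(k+2)/(3k+2)) with k + 2 = d + 1 and 3k + 2 = 3d - 1. The upper logarithm
  stems from the net: (ln m)^2 in its log-size replaces m by m/(ln m)^2, and 2(k+2) <= 5k+2. In the
  lower bound, adding the Barron norms of single bumps would cost N instead of sqrt N and lose the
  rate, so the sum has to be treated as a whole. In the upper bound, the squared L^2 distance of two
  indicator functions is the measure of the set where they differ, at most the L^1 distance of the
  boundaries. A boundary is therefore approximated in mean, not uniformly, and a second moment
  controls the sampling. Labels are free of noise, which gives log(size)/m instead of its square
  root. Only |\<xi>| F is integrable, F itself need not be so near the origin. Hence the division of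
  the waves by |\<xi>| and the separate treatment of low frequencies.\<close>

definition sin_quot :: "real \<Rightarrow> real \<Rightarrow> real" where
  "sin_quot a t = sin (t * a) / (t * a)"

text \<open>\<open>sin_quot a\<close> is sinc(ta), except that division by zero makes it 0 instead
  of 1 at t = 0. Identities with characteristic functions therefore hold for t \<noteq> 0, that is,
  almost everywhere.\<close>

lemma sin_quot_measurable [measurable]: "sin_quot a \<in> borel_measurable borel"
  unfolding sin_quot_def by measurable

lemma abs_sin_quot_le_1: "\<bar>sin_quot a t\<bar> \<le> 1"
proof (cases "t * a = 0")
  case False
  have "\<bar>sin (t * a)\<bar> \<le> \<bar>t * a\<bar>" by (rule abs_sin_x_le_abs_x)
  with False show ?thesis unfolding sin_quot_def abs_divide
    by (simp add: divide_le_eq_1)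
qed (auto simp: sin_quot_def)

text \<open>Adding the bound 1 and the bound 1/(ta)^2 gives one majorant that is integrable on the
  whole line.\<close>

lemma sin_quot_sq_le:
  assumes "a > 0" shows "(sin_quot a t)\<^sup>2 \<le> (1 + 1 / a\<^sup>2) * inverse (1 + t\<^sup>2)"
proof -
  have 1: "(sin_quot a t)\<^sup>2 \<le> 1"
    using abs_sin_quot_le_1[of a t] by (simp add: abs_square_le_1)
  have "(sin_quot a t)\<^sup>2 * t\<^sup>2 = (if t = 0 then 0 else (sin (t * a))\<^sup>2 / a\<^sup>2)"
    unfolding sin_quot_def by (auto simp: power_divide power_mult_distrib)
  also have "\<dots> \<le> 1 / a\<^sup>2"
    using abs_sin_le_one[of "t * a"] assms by (auto simp: divide_right_mono abs_square_le_1)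
  finally have "(sin_quot a t)\<^sup>2 * (1 + t\<^sup>2) \<le> 1 + 1 / a\<^sup>2" using 1 by (simp add: algebra_simps)
  moreover have "1 + t\<^sup>2 > 0" by (simp add: add_pos_nonneg)
  ultimately show ?thesis by (simp add: field_simps)
qed

lemma integrable_inverse_1_plus_sq: "integrable lborel (\<lambda>t::real. inverse (1 + t\<^sup>2))"
  using integrable_inverse_1_plus_square by (simp add: set_integrable_def)

lemma integrable_sin_quot_sq:
  assumes "a > 0" shows "integrable lborel (\<lambda>t. (sin_quot a t)\<^sup>2)"
proof (rule Bochner_Integration.integrable_bound)
  show "integrable lborel (\<lambda>t. (1 + 1 / a\<^sup>2) * inverse (1 + t\<^sup>2))"
    using integrable_inverse_1_plus_sq by simp
  show "AE t in lborel. norm ((sin_quot a t)\<^sup>2) \<le> norm ((1 + 1 / a\<^sup>2) * inverse (1 + t\<^sup>2))"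
    using sin_quot_sq_le[OF assms] by (intro always_eventually allI) (simp add: add_nonneg_nonneg)
qed simp

lemma sin_quot_sq_weighted_le:
  assumes "a > 0" shows "t\<^sup>2 * (sin_quot a t)\<^sup>2 \<le> 1 / a\<^sup>2"
proof -
  have "t\<^sup>2 * (sin_quot a t)\<^sup>2 = (if t = 0 then 0 else (sin (t * a))\<^sup>2 / a\<^sup>2)"
    unfolding sin_quot_def by (auto simp: power_divide power_mult_distrib)
  also have "\<dots> \<le> 1 / a\<^sup>2"
    using abs_sin_le_one[of "t * a"] assms by (auto simp: divide_right_mono abs_square_le_1)
  finally show ?thesis .
qed

section \<open>Characteristic function of the uniform law and Fourier inversion\<close>

definition uniform_law :: "real \<Rightarrow> real measure" where
  "uniform_law a = density lborel (\<lambda>x. ennreal (indicator {-a..a} x / (2 * a)))"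

lemma sets_uniform_law [simp, measurable_cong]: "sets (uniform_law a) = sets borel"
  and space_uniform_law [simp]: "space (uniform_law a) = UNIV"
  by (simp_all add: uniform_law_def)

lemma emeasure_uniform_law:
  assumes "A \<in> sets borel" "a > 0"
  shows "emeasure (uniform_law a) A = ennreal (1 / (2 * a)) * emeasure lborel (A \<inter> {-a..a})"
proof -
  have "emeasure (uniform_law a) A
      = (\<integral>\<^sup>+ x. ennreal (indicator {-a..a} x / (2 * a)) * indicator A x \<partial>lborel)"
    unfolding uniform_law_def using assms by (subst emeasure_density) auto
  also have "\<dots> = (\<integral>\<^sup>+ x. ennreal (1 / (2 * a)) * indicator (A \<inter> {-a..a}) x \<partial>lborel)"
    by (intro nn_integral_cong) (auto split: split_indicator)
  finally show ?thesis using assms by (simp add: nn_integral_cmult)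
qed

lemma prob_space_uniform_law: "a > 0 \<Longrightarrow> prob_space (uniform_law a)"
  by (rule prob_spaceI) (simp add: emeasure_uniform_law ennreal_mult[symmetric])

lemma real_distribution_uniform_law: "a > 0 \<Longrightarrow> real_distribution (uniform_law a)"
  by (simp add: real_distribution_def prob_space_uniform_law real_distribution_axioms_def)

lemma uniform_law_singleton: "a > 0 \<Longrightarrow> emeasure (uniform_law a) {y} = 0"
proof -
  assume a: "a > 0"
  have "emeasure lborel ({y} \<inter> {-a..a}) \<le> emeasure lborel {y}"
    by (rule emeasure_mono) auto
  then show ?thesis using a by (simp add: emeasure_uniform_law)
qed

lemma char_uniform_law:
  assumes "a > 0" "t \<noteq> 0"
  shows "char (uniform_law a) t = sin_quot a t"
proof -
  have "char (uniform_law a) t = (CLINT x|lborel. (indicator {-a..a} x / (2 * a)) *\<^sub>R iexp (t * x))"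
    unfolding char_def uniform_law_def using assms
    by (subst integral_density) (auto simp: less_imp_le)
  also have "\<dots> = (1 / (2 * a)) *\<^sub>R (CLINT x|lborel. indicator {-a..a} x *\<^sub>R iexp (t * x))"
    by (subst integral_scaleR_right[symmetric]) (simp add: mult.commute)
  also have "(CLINT x|lborel. indicator {-a..a} x *\<^sub>R iexp (t * x))
      = iexp (t * a) / (\<i> * t) - iexp (t * (-a)) / (\<i> * t)"
  proof -
    have "((\<lambda>x. iexp (t * x) / (\<i> * t)) has_vector_derivative iexp (t * x)) (at x within {-a..a})" for x
      using assms by (auto intro!: derivative_eq_intros simp: has_vector_derivative_complex_iff Re_exp Im_exp
          Re_divide Im_divide power2_eq_square field_simps)
    then show ?thesis
      using assms by (intro integral_FTC_Icc[where F = "\<lambda>x. iexp (t * x) / (\<i> * t)"])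
        (auto intro!: continuous_intros)
  qed
  also have "(1 / (2 * a)) *\<^sub>R (iexp (t * a) / (\<i> * t) - iexp (t * (-a)) / (\<i> * t)) = sin_quot a t"
    using assms by (simp add: sin_quot_def complex_eq_iff Re_divide Im_divide Re_exp Im_exp power2_eq_square field_simps)
  finally show ?thesis .
qed

text \<open>For an interval of length 1 centred at -y, the kernel of Levy's inversion formula is
  exp(ity) times sinc(t/2). Multiplying \<open>char M\<close> by this sinc thus smooths the law by a
  unit interval. Absence of atoms takes care of the endpoints, and integrability turns the limit of
  truncated integrals into a full integral.\<close>

lemma (in real_distribution) smoothed_inversion:
  assumes atoms: "\<And>y. emeasure M {y} = 0"
    and int: "integrable lborel (\<lambda>t. of_real (sin_quot (1/2) t) * char M t)"
  shows "(CLINT t|lborel. iexp (t * y) * (of_real (sin_quot (1/2) t) * char M t))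
    = 2 * pi * measure M {-y - 1/2 <.. -y + 1/2}"
proof -
  let ?a = "-y - 1/2" and ?b = "-y + 1/2"
  let ?g = "\<lambda>t. iexp (t * y) * (of_real (sin_quot (1/2) t) * char M t)"
  have kern: "(iexp (-(t * ?a)) - iexp (-(t * ?b))) / (\<i> * t) = iexp (t * y) * of_real (sin_quot (1/2) t)" for t
  proof (cases "t = 0")
    case False
    have 1: "iexp (-(t * ?a)) = iexp (t * y) * iexp (t / 2)" "iexp (-(t * ?b)) = iexp (t * y) * iexp (- t / 2)"
      unfolding exp_add[symmetric] by (simp_all add: algebra_simps)
    have 2: "(iexp (t / 2) - iexp (- t / 2)) / (\<i> * t) = of_real (sin_quot (1/2) t)"
      using False by (simp add: sin_quot_def complex_eq_iff Re_divide Im_divide Re_exp Im_exp power2_eq_square field_simps)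
    show ?thesis unfolding 1 right_diff_distrib[symmetric] times_divide_eq_right[symmetric] 2 ..
  qed (simp add: sin_quot_def)
  have [measurable]: "?g \<in> borel_measurable lborel" by measurable
  have intg: "integrable lborel ?g"
    by (rule Bochner_Integration.integrable_bound[OF int]) (auto simp: norm_mult)
  have "(\<lambda>n. 1 / (2 * pi) * (CLBINT t=-real n..real n. ?g t)) \<longlonglongrightarrow> measure M {?a<..?b}"
    using Levy_Inversion[of ?a ?b] atoms
    by (simp add: kern[simplified] measure_def mult.assoc)
  moreover have "(\<lambda>n. CLBINT t=-real n..real n. ?g t) \<longlonglongrightarrow> (CLINT t|lborel. ?g t)"
  proof -
    have "(\<lambda>n. CLINT t|lborel. indicator {-real n<..<real n} t *\<^sub>R ?g t) \<longlonglongrightarrow> (CLINT t|lborel. ?g t)"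
    proof (rule integral_dominated_convergence[where w = "\<lambda>t. norm (?g t)"])
      show "AE t in lborel. (\<lambda>n. indicator {-real n<..<real n} t *\<^sub>R ?g t) \<longlonglongrightarrow> ?g t"
      proof (intro always_eventually allI)
        fix t :: real
        obtain N where "\<bar>t\<bar> < real N" using reals_Archimedean2 by blast
        then have "\<bar>t\<bar> < real n" if "n \<ge> N" for n using that by linarith
        then have "t \<in> {-real n<..<real n}" if "n \<ge> N" for n
          using that by (metis abs_less_iff greaterThanLessThan_iff minus_less_iff)
        then have "\<forall>n\<ge>N. indicator {-real n<..<real n} t *\<^sub>R ?g t = ?g t" by simp
        then have "\<forall>\<^sub>F n in sequentially. indicator {-real n<..<real n} t *\<^sub>R ?g t = ?g t"
          unfolding eventually_sequentially by blast
        then show "(\<lambda>n. indicator {-real n<..<real n} t *\<^sub>R ?g t) \<longlonglongrightarrow> ?g t"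
          by (rule tendsto_eventually)
      qed
    qed (use intg in \<open>auto split: split_indicator\<close>)
    then show ?thesis
      by (simp add: interval_lebesgue_integral_def set_lebesgue_integral_def)
  qed
  then have "(\<lambda>n. 1 / (2 * pi) * (CLBINT t=-real n..real n. ?g t)) \<longlonglongrightarrow> 1 / (2 * pi) * (CLINT t|lborel. ?g t)"
    by (intro tendsto_intros)
  ultimately have "1 / (2 * pi) * (CLINT t|lborel. ?g t) = measure M {?a<..?b}"
    by (rule LIMSEQ_unique[rotated])
  then show ?thesis by (simp add: field_simps)
qed

section \<open>The sum of two independent uniform variables\<close>

definition tent_law :: "real \<Rightarrow> real measure" where
  "tent_law a = distr (uniform_law a \<Otimes>\<^sub>M uniform_law a) borel (\<lambda>(x, y). x + y)"

lemma sets_tent_law [simp, measurable_cong]: "sets (tent_law a) = sets borel"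
  and space_tent_law [simp]: "space (tent_law a) = UNIV"
  by (simp_all add: tent_law_def)

context
  fixes a :: real
  assumes a: "a > 0"
begin

interpretation U: prob_space "uniform_law a" using a by (rule prob_space_uniform_law)
interpretation UU: pair_prob_space "uniform_law a" "uniform_law a" ..

lemma real_distribution_tent_law: "real_distribution (tent_law a)"
  unfolding tent_law_def real_distribution_def real_distribution_axioms_def
  by (auto intro!: UU.prob_space_distr)

lemma emeasure_tent_law:
  assumes "A \<in> sets borel"
  shows "emeasure (tent_law a) A = (\<integral>\<^sup>+ x. emeasure (uniform_law a) {y. x + y \<in> A} \<partial>uniform_law a)"
proof -
  have "emeasure (tent_law a) A = emeasure (uniform_law a \<Otimes>\<^sub>M uniform_law a) {p. fst p + snd p \<in> A}"
    unfolding tent_law_def using assms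
    by (subst emeasure_distr) (auto simp: space_pair_measure case_prod_unfold vimage_def)
  also have "\<dots> = (\<integral>\<^sup>+ x. emeasure (uniform_law a) (Pair x -` {p. fst p + snd p \<in> A}) \<partial>uniform_law a)"
  proof (rule U.emeasure_pair_measure_alt)
    have "{p \<in> space (uniform_law a \<Otimes>\<^sub>M uniform_law a). fst p + snd p \<in> A} \<in> sets (uniform_law a \<Otimes>\<^sub>M uniform_law a)"
      using assms by measurable
    then show "{p. fst p + snd p \<in> A} \<in> sets (uniform_law a \<Otimes>\<^sub>M uniform_law a)"
      by (simp add: space_pair_measure)
  qed
  finally show ?thesis by (simp add: vimage_def)
qed

lemma tent_law_singleton: "emeasure (tent_law a) {z} = 0"
proof -
  have "{y. x + y = z} = {z - x}" for x by auto
  then show ?thesis using a by (simp add: emeasure_tent_law uniform_law_singleton)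
qed

lemma tent_law_support: "emeasure (tent_law a) (- {-2*a..2*a}) = 0"
proof -
  have out: "emeasure (uniform_law a) {y. x + y \<notin> {-2*a..2*a}} = 0" if "x \<in> {-a..a}" for x
  proof -
    have "{y. x + y \<notin> {-2*a..2*a}} \<inter> {-a..a} = {}" using that by auto
    moreover have "{y. x + y \<notin> {-2*a..2*a}} \<in> sets borel" by measurable
    ultimately show ?thesis using a by (simp add: emeasure_uniform_law)
  qed
  have "AE x in uniform_law a. x \<in> {-a..a}"
    unfolding uniform_law_def using a
    by (subst AE_density) (auto split: split_indicator)
  then have "(\<integral>\<^sup>+ x. emeasure (uniform_law a) {y. x + y \<in> - {-2*a..2*a}} \<partial>uniform_law a)
      = (\<integral>\<^sup>+ x. 0 \<partial>uniform_law a)"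
    by (intro nn_integral_cong_AE, elim eventually_mono) (simp only: Compl_iff out)
  then show ?thesis by (simp add: emeasure_tent_law)
qed

lemma char_tent_law: "char (tent_law a) t = char (uniform_law a) t * char (uniform_law a) t"
proof -
  have "char (tent_law a) t = (CLINT p|uniform_law a \<Otimes>\<^sub>M uniform_law a. iexp (t * fst p) * iexp (t * snd p))"
    unfolding char_def tent_law_def
    by (subst integral_distr) (auto simp: case_prod_unfold exp_add[symmetric] algebra_simps)
  also have "\<dots> = (CLINT x|uniform_law a. CLINT y|uniform_law a. iexp (t * x) * iexp (t * y))"
    by (subst UU.integral_fst'[symmetric])
      (auto intro!: UU.integrable_const_bound[where B=1] simp: norm_mult)
  finally show ?thesis by (simp add: char_def)
qed

end

text \<open>The bump is a quadratic spline: an interval of length \<open>1\<close> smoothed by a tent of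
  half-width \<open>1/5\<close>. Its transform is \<open>sinc\<close> times a factor \<open>\<psi>\<close> that decays to second
  order, so the first moment converges; the separate \<open>sinc\<close> factor is what makes integer
  frequencies orthogonal.\<close>

lemma spline_bump:
  "\<exists>(B :: real \<Rightarrow> real) \<psi> :: real \<Rightarrow> real. \<psi> \<in> borel_measurable borel \<and>
    integrable lborel (\<lambda>t. (\<psi> t)\<^sup>2) \<and> integrable lborel (\<lambda>t. t\<^sup>2 * (\<psi> t)\<^sup>2) \<and>
    integrable lborel (\<lambda>t. sin_quot (1/2) t * \<psi> t) \<and>
    (\<forall>y. (CLINT t|lborel. iexp (t * y) * of_real (sin_quot (1/2) t * \<psi> t)) = complex_of_real (B y)) \<and>
    (\<forall>y. 0 \<le> B y \<and> B y \<le> 1) \<and> (\<forall>y. \<bar>y\<bar> \<le> 1/4 \<longrightarrow> B y = 1) \<and> (\<forall>y. \<bar>y\<bar> \<ge> 3/4 \<longrightarrow> B y = 0)"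
proof -
  \<comment> \<open>Two uniform variables on [-1/10, 1/10] sum to a law on [-1/5, 1/5]. A unit
    interval smoothed by it is 1 up to 3/10 >= 1/4 and 0 from 7/10 <= 3/4 on.\<close>
  let ?M = "tent_law (1/10)"
  interpret M: real_distribution ?M by (rule real_distribution_tent_law) simp
  \<comment> \<open>The square of the sinc is the characteristic function of the tent; the factor 2
    pi of the inversion formula is absorbed here.\<close>
  define \<psi> where "\<psi> t = (sin_quot (1/10) t)\<^sup>2 / (2 * pi)" for t
  define B where "B y = measure ?M {-y - 1/2 <.. -y + 1/2}" for y
  have mchi [measurable]: "\<psi> \<in> borel_measurable borel" unfolding \<psi>_def by measurable
  have sq1: "(sin_quot (1/10) t)\<^sup>2 \<le> 1" for t
    using abs_sin_quot_le_1[of "1/10" t] by (simp add: abs_square_le_1)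
  have charM: "char ?M t = of_real (2 * pi * \<psi> t)" if "t \<noteq> 0" for t
    using that by (simp add: char_tent_law char_uniform_law \<psi>_def power2_eq_square)
  have chi_le: "\<bar>\<psi> t\<bar> \<le> (sin_quot (1/10) t)\<^sup>2" for t
    using pi_gt3 unfolding \<psi>_def by (simp add: divide_le_eq mult_le_cancel_left1 zero_le_power2)
  have chi_le1: "\<bar>\<psi> t\<bar> \<le> 1" for t using chi_le[of t] sq1[of t] by linarith
  have int1: "integrable lborel (\<lambda>t. (sin_quot (1/10) t)\<^sup>2)" by (rule integrable_sin_quot_sq) simp
  have i1: "integrable lborel (\<lambda>t. (\<psi> t)\<^sup>2)"
  proof (rule Bochner_Integration.integrable_bound[OF int1])
    show "AE t in lborel. norm ((\<psi> t)\<^sup>2) \<le> norm ((sin_quot (1/10) t)\<^sup>2)"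
    proof (intro always_eventually allI)
      fix t
      have "(\<psi> t)\<^sup>2 \<le> \<bar>\<psi> t\<bar> * 1" using mult_left_mono[OF chi_le1[of t] abs_ge_zero[of "\<psi> t"]]
        by (simp add: power2_eq_square abs_mult[symmetric])
      then show "norm ((\<psi> t)\<^sup>2) \<le> norm ((sin_quot (1/10) t)\<^sup>2)" using chi_le[of t] by simp
    qed
  qed simp
  have i2: "integrable lborel (\<lambda>t. t\<^sup>2 * (\<psi> t)\<^sup>2)"
  proof (rule Bochner_Integration.integrable_bound)
    show "integrable lborel (\<lambda>t. 100 * (sin_quot (1/10) t)\<^sup>2)" using int1 by simp
    show "AE t in lborel. norm (t\<^sup>2 * (\<psi> t)\<^sup>2) \<le> norm (100 * (sin_quot (1/10) t)\<^sup>2)"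
    proof (intro always_eventually allI)
      fix t
      have "(\<psi> t)\<^sup>2 \<le> ((sin_quot (1/10) t)\<^sup>2)\<^sup>2"
        using chi_le[of t] power_mono[of "\<bar>\<psi> t\<bar>" "(sin_quot (1/10) t)\<^sup>2" 2] by simp
      then have "t\<^sup>2 * (\<psi> t)\<^sup>2 \<le> (t\<^sup>2 * (sin_quot (1/10) t)\<^sup>2) * (sin_quot (1/10) t)\<^sup>2"
        using mult_left_mono[of "(\<psi> t)\<^sup>2" "((sin_quot (1/10) t)\<^sup>2)\<^sup>2" "t\<^sup>2"]
        by (simp add: power2_eq_square algebra_simps)
      also have "\<dots> \<le> 100 * (sin_quot (1/10) t)\<^sup>2"
        using sin_quot_sq_weighted_le[of "1/10" t] by (intro mult_right_mono) (auto simp: power2_eq_square)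
      finally show "norm (t\<^sup>2 * (\<psi> t)\<^sup>2) \<le> norm (100 * (sin_quot (1/10) t)\<^sup>2)" by simp
    qed
  qed simp
  have i3: "integrable lborel (\<lambda>t. sin_quot (1/2) t * \<psi> t)"
  proof (rule Bochner_Integration.integrable_bound[OF int1])
    show "AE t in lborel. norm (sin_quot (1/2) t * \<psi> t) \<le> norm ((sin_quot (1/10) t)\<^sup>2)"
    proof (intro always_eventually allI)
      fix t
      have "\<bar>sin_quot (1/2) t\<bar> * \<bar>\<psi> t\<bar> \<le> 1 * (sin_quot (1/10) t)\<^sup>2"
        using abs_sin_quot_le_1 chi_le by (intro mult_mono) auto
      then show "norm (sin_quot (1/2) t * \<psi> t) \<le> norm ((sin_quot (1/10) t)\<^sup>2)" by (simp add: abs_mult)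
    qed
  qed simp
  have ae: "AE t in lborel. of_real (sin_quot (1/2) t) * char ?M t = of_real (2 * pi) * of_real (sin_quot (1/2) t * \<psi> t)"
    using AE_lborel_singleton[of 0] by eventually_elim (simp add: charM)
  have intc: "integrable lborel (\<lambda>t. complex_of_real (2 * pi) * of_real (sin_quot (1/2) t * \<psi> t))"
    using i3 by (intro integrable_mult_right integrable_of_real)
  have int2: "integrable lborel (\<lambda>t. of_real (sin_quot (1/2) t) * char ?M t)"
    using intc by (subst integrable_cong_AE[OF _ _ ae]) auto
  have inv: "(CLINT t|lborel. iexp (t * y) * of_real (sin_quot (1/2) t * \<psi> t)) = complex_of_real (B y)" for y
  proof -
    have "of_real (2 * pi * B y) = (CLINT t|lborel. iexp (t * y) * (of_real (sin_quot (1/2) t) * char ?M t))"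
      unfolding B_def by (rule M.smoothed_inversion[symmetric, OF _ int2]) (simp add: tent_law_singleton)
    also have "\<dots> = (CLINT t|lborel. of_real (2 * pi) * (iexp (t * y) * of_real (sin_quot (1/2) t * \<psi> t)))"
      using ae by (intro integral_cong_AE) (auto elim!: eventually_mono simp: algebra_simps)
    finally show ?thesis by simp
  qed
  have null: "M.prob A = 0" if "A \<subseteq> - {-(1/5)..1/5}" for A
  proof -
    have "emeasure ?M A \<le> emeasure ?M (- {-2*(1/10)..2*(1/10)})"
      using that by (intro emeasure_mono) auto
    then show ?thesis using tent_law_support[of "1/10"] by (simp add: measure_def)
  qed
  have "B y = 1" if "\<bar>y\<bar> \<le> 1/4" for y
  proof -
    have "M.prob (space ?M - {-y - 1/2 <.. -y + 1/2}) = 0"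
      using that by (intro null) auto
    then show ?thesis unfolding B_def by (subst (asm) M.prob_compl) auto
  qed
  moreover have "B y = 0" if "\<bar>y\<bar> \<ge> 3/4" for y
    unfolding B_def using that by (intro null) (auto simp: abs_if split: if_splits)
  moreover have "0 \<le> B y \<and> B y \<le> 1" for y by (auto simp: B_def)
  ultimately show ?thesis
    using mchi i1 i2 i3 inv by (intro exI[of _ B] exI[of _ \<psi>] conjI allI impI) auto
qed

text \<open>Smoothed inversion of the uniform law on [-1/2, 1/2] measures the overlap of two unit
  intervals at distance |y|, which is at most a point when |y| >= 1. Under the weight sinc^2,
  exponentials whose frequencies differ by at least 1 are therefore orthogonal.\<close>

lemma sin_quot_sq_orthogonal:
  assumes "\<bar>y\<bar> \<ge> 1"
  shows "(CLINT t|lborel. iexp (t * y) * of_real ((sin_quot (1/2) t)\<^sup>2)) = 0"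
proof -
  let ?M = "uniform_law (1/2)"
  interpret M: real_distribution ?M by (rule real_distribution_uniform_law) simp
  have ae: "AE t in lborel. of_real (sin_quot (1/2) t) * char ?M t = of_real ((sin_quot (1/2) t)\<^sup>2)"
    using AE_lborel_singleton[of 0] by eventually_elim (simp add: char_uniform_law power2_eq_square)
  have i: "integrable lborel (\<lambda>t. complex_of_real ((sin_quot (1/2) t)\<^sup>2))"
    by (intro integrable_of_real integrable_sin_quot_sq) simp
  have int2: "integrable lborel (\<lambda>t. of_real (sin_quot (1/2) t) * char ?M t)"
    using i by (subst integrable_cong_AE[OF _ _ ae]) auto
  have "(CLINT t|lborel. iexp (t * y) * of_real ((sin_quot (1/2) t)\<^sup>2))
      = (CLINT t|lborel. iexp (t * y) * (of_real (sin_quot (1/2) t) * char ?M t))"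
    using ae by (intro integral_cong_AE) (auto elim!: eventually_mono)
  also have "\<dots> = 2 * pi * M.prob {-y - 1/2 <.. -y + 1/2}"
    by (rule M.smoothed_inversion[OF _ int2]) (simp add: uniform_law_singleton)
  also have "M.prob {-y - 1/2 <.. -y + 1/2} = 0"
  proof -
    have "{-y - 1/2 <.. -y + 1/2} \<inter> {-(1/2)..1/2} \<subseteq> {-(1/2)}" using assms by auto
    then have "emeasure lborel ({-y - 1/2 <.. -y + 1/2} \<inter> {-(1/2)..1/2::real}) \<le> emeasure lborel {-(1/2)::real}"
      by (intro emeasure_mono) auto
    then show ?thesis by (simp add: measure_def emeasure_uniform_law)
  qed
  finally show ?thesis by simp
qed

section \<open>Sums of bumps in the Barron class\<close>

text \<open>Lebesgue measure is the image of the product measure over the coordinates, so a product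
  of one-variable factors integrates factor by factor. This carries the spline from the line to any
  dimension.\<close>

lemma
  fixes f :: "'a::euclidean_space \<Rightarrow> real \<Rightarrow> 'b::{real_normed_field, banach, second_countable_topology}"
  assumes f: "\<And>b. b \<in> Basis \<Longrightarrow> integrable lborel (f b)"
  shows integrable_lborel_prod: "integrable lborel (\<lambda>x. \<Prod>b\<in>Basis. f b (x \<bullet> b))"
    and integral_lborel_prod: "(LINT x|lborel. (\<Prod>b\<in>Basis. f b (x \<bullet> b))) = (\<Prod>b\<in>Basis. LINT t|lborel. f b t)"
proof -
  interpret product_sigma_finite "\<lambda>_::'a. lborel :: real measure" ..
  have comp: "(\<Sum>b\<in>Basis. g b *\<^sub>R b) \<bullet> b = g b" if "b \<in> Basis" for g :: "'a \<Rightarrow> real" and b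
    using that by simp
  have [measurable]: "f b \<in> borel_measurable borel" if "b \<in> Basis" for b
    using f[OF that] by auto
  have m: "(\<lambda>x::'a. \<Prod>b\<in>Basis. f b (x \<bullet> b)) \<in> borel_measurable borel"
    by measurable
  have eq: "lborel = distr (\<Pi>\<^sub>M b\<in>Basis. lborel) borel (\<lambda>g. \<Sum>b\<in>Basis. g b *\<^sub>R (b::'a))"
    by (rule lborel_eq)
  have T: "(\<lambda>g. \<Sum>b\<in>Basis. g b *\<^sub>R (b::'a)) \<in> measurable (\<Pi>\<^sub>M b\<in>Basis. lborel) borel"
    by measurable
  have "integrable (\<Pi>\<^sub>M b\<in>Basis. lborel) (\<lambda>g. \<Prod>b\<in>Basis. f b (g b))"
    by (rule product_integrable_prod) (auto intro: f)
  then show "integrable lborel (\<lambda>x. \<Prod>b\<in>Basis. f b (x \<bullet> b))"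
    by (subst eq, subst integrable_distr_eq[OF T m]) (simp add: comp)
  show "(LINT x|lborel. (\<Prod>b\<in>Basis. f b (x \<bullet> b))) = (\<Prod>b\<in>Basis. LINT t|lborel. f b t)"
    by (subst eq, subst integral_distr[OF T m])
      (simp add: comp product_integral_prod[OF finite_Basis f])
qed

section \<open>Dilations and a criterion for membership in the Barron class\<close>

lemma lborel_eq_scale:
  assumes "c > 0"
  shows "lborel = density (distr lborel borel (\<lambda>x::'a::euclidean_space. c *\<^sub>R x)) (\<lambda>_. ennreal (c ^ DIM('a)))"
  using lborel_affine[of c "0::'a"] assms by simp

lemma lborel_integral_scale:
  fixes f :: "'a::euclidean_space \<Rightarrow> 'b::{banach, second_countable_topology}"
  assumes "c > 0" and [measurable]: "f \<in> borel_measurable borel"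
  shows "(LINT x|lborel. f x) = c ^ DIM('a) *\<^sub>R (LINT x|lborel. f (c *\<^sub>R x))"
  using assms by (subst lborel_eq_scale[of c], simp, subst integral_density) (auto simp: integral_distr)

lemma lborel_nn_integral_scale:
  fixes g :: "'a::euclidean_space \<Rightarrow> ennreal"
  assumes "c > 0" and [measurable]: "g \<in> borel_measurable borel"
  shows "(\<integral>\<^sup>+ x. g x \<partial>lborel) = ennreal (c ^ DIM('a)) * (\<integral>\<^sup>+ x. g (c *\<^sub>R x) \<partial>lborel)"
  using assms by (subst lborel_eq_scale[of c], simp, subst nn_integral_density)
    (auto simp: nn_integral_distr nn_integral_cmult)

text \<open>As f vanishes at 0, so does the integral of \<open>G\<close>, and the subtracted 1 in
  the Barron representation costs nothing. The substitution \<xi> = c \<eta> preserves the mass of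
  \<open>G\<close> and multiplies its first moment by \<open>c\<close>.\<close>

lemma barron_classI_scaled:
  fixes G :: "'a::euclidean_space \<Rightarrow> complex" and f :: "'a \<Rightarrow> real"
  assumes f: "f \<in> unit_cube \<rightarrow>\<^sub>E {0..1}" and "c > 0" "C > 0"
    and G: "integrable lborel G"
    and repr: "\<And>x. x \<in> unit_cube \<Longrightarrow> of_real (f x) = (LINT \<eta>|lborel. iexp (c * (x \<bullet> \<eta>)) * G \<eta>)"
    and f0: "f 0 = 0"
    and bound: "ennreal c * (\<integral>\<^sup>+ \<eta>. ennreal (norm \<eta> * norm (G \<eta>)) \<partial>lborel) \<le> ennreal C"
  shows "f \<in> barron_class C"
proof -
  let ?k = "DIM('a)"
  have [measurable]: "G \<in> borel_measurable borel" using G by auto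
  define F where "F \<xi> = G (\<xi> /\<^sub>R c) /\<^sub>R c ^ ?k" for \<xi>
  have Fm [measurable]: "F \<in> borel_measurable borel" unfolding F_def by measurable
  have Fc: "F (c *\<^sub>R \<eta>) = G \<eta> /\<^sub>R c ^ ?k" for \<eta> using \<open>c > 0\<close> by (simp add: F_def)
  have "0 \<in> (unit_cube :: 'a set)" by (simp add: mem_box)
  then have G0: "(LINT \<eta>|lborel. G \<eta>) = 0" using repr[of 0] f0 by simp
  have "of_real (f x) = of_real 0 + (LINT \<xi>|lborel. (exp (\<i> * of_real (x \<bullet> \<xi>)) - 1) * F \<xi>)"
    if x: "x \<in> unit_cube" for x
  proof -
    have i: "integrable lborel (\<lambda>\<eta>. iexp (c * (x \<bullet> \<eta>)) * G \<eta>)"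
      by (rule Bochner_Integration.integrable_bound[OF G]) (auto simp: norm_mult)
    have "(LINT \<xi>|lborel. (exp (\<i> * of_real (x \<bullet> \<xi>)) - 1) * F \<xi>)
        = c ^ ?k *\<^sub>R (LINT \<eta>|lborel. (iexp (x \<bullet> (c *\<^sub>R \<eta>)) - 1) * F (c *\<^sub>R \<eta>))"
      by (rule lborel_integral_scale[OF \<open>c > 0\<close>]) measurable
    also have "\<dots> = (LINT \<eta>|lborel. c ^ ?k *\<^sub>R ((iexp (x \<bullet> (c *\<^sub>R \<eta>)) - 1) * F (c *\<^sub>R \<eta>)))"
      by (rule integral_scaleR_right[symmetric])
    also have "\<dots> = (LINT \<eta>|lborel. iexp (c * (x \<bullet> \<eta>)) * G \<eta> - G \<eta>)"
      using \<open>c > 0\<close> by (intro Bochner_Integration.integral_cong) (auto simp: Fc algebra_simps)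
    also have "\<dots> = of_real (f x)"
      using repr[OF x] G0 by (subst Bochner_Integration.integral_diff[OF i G]) simp
    finally show ?thesis by simp
  qed
  moreover have "(\<integral>\<^sup>+ \<xi>. ennreal (norm \<xi> * norm (F \<xi>)) \<partial>lborel) \<le> ennreal C"
  proof -
    have "(\<integral>\<^sup>+ \<xi>. ennreal (norm \<xi> * norm (F \<xi>)) \<partial>lborel)
        = ennreal (c ^ ?k) * (\<integral>\<^sup>+ \<eta>. ennreal (norm (c *\<^sub>R \<eta>) * norm (F (c *\<^sub>R \<eta>))) \<partial>lborel)"
      by (rule lborel_nn_integral_scale[OF \<open>c > 0\<close>]) measurable
    also have "\<dots> = (\<integral>\<^sup>+ \<eta>. ennreal c * ennreal (norm \<eta> * norm (G \<eta>)) \<partial>lborel)"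
      using \<open>c > 0\<close> by (subst nn_integral_cmult[symmetric], measurable)
        (intro nn_integral_cong, simp add: Fc ennreal_mult'[symmetric] field_simps)
    also have "\<dots> = ennreal c * (\<integral>\<^sup>+ \<eta>. ennreal (norm \<eta> * norm (G \<eta>)) \<partial>lborel)"
      by (rule nn_integral_cmult) measurable
    finally show ?thesis using bound by simp
  qed
  ultimately show ?thesis
    unfolding barron_class_def using f \<open>C > 0\<close> Fm
    by (auto intro!: exI[of _ F] bexI[of _ 0])
qed

section \<open>Bumps on a grid of cells\<close>

definition grid_index :: "nat \<Rightarrow> ('a::euclidean_space \<Rightarrow> nat) set" where
  "grid_index L = Basis \<rightarrow>\<^sub>E {..<L}"

lemma finite_grid_index [simp]: "finite (grid_index L)"
  unfolding grid_index_def by (intro finite_PiE) auto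

lemma card_grid_index: "card (grid_index L :: ('a::euclidean_space \<Rightarrow> nat) set) = L ^ DIM('a)"
  by (simp add: grid_index_def card_PiE)

lemma grid_index_eqI: "n \<in> grid_index L \<Longrightarrow> n' \<in> grid_index L \<Longrightarrow> (\<And>b. b \<in> Basis \<Longrightarrow> n b = n' b) \<Longrightarrow> n = n'"
  unfolding grid_index_def by (rule PiE_ext)

text \<open>The argument y = 2(Lx - n) - 1 maps the side [n/L, (n+1)/L] of a cell onto [-1, 1]. A
  bump vanishing for |y| >= 3/4 stays inside its cell, and |y| <= 1/4 is the middle quarter of the
  side.\<close>

definition grid_bump :: "(real \<Rightarrow> real) \<Rightarrow> nat \<Rightarrow> ('a::euclidean_space \<Rightarrow> nat) \<Rightarrow> 'a \<Rightarrow> real" where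
  "grid_bump B L n x = (\<Prod>b\<in>Basis. B (2 * (real L * (x \<bullet> b) - real (n b)) - 1))"

definition plateau :: "(real \<Rightarrow> real) \<Rightarrow> bool" where
  "plateau B \<longleftrightarrow> (\<forall>y. 0 \<le> B y \<and> B y \<le> 1) \<and> (\<forall>y. \<bar>y\<bar> \<le> 1/4 \<longrightarrow> B y = 1) \<and> (\<forall>y. \<bar>y\<bar> \<ge> 3/4 \<longrightarrow> B y = 0)"

context
  fixes B :: "real \<Rightarrow> real"
  assumes plateau: "plateau B"
begin

lemma grid_bump_nonneg: "0 \<le> grid_bump B L n x"
  and grid_bump_le_1: "grid_bump B L n x \<le> 1"
  using plateau unfolding grid_bump_def plateau_def by (auto intro!: prod_nonneg prod_le_1)

text \<open>In this half-open form the floor of L x recovers the index, so bumps of different cells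
  never overlap.\<close>

lemma grid_bump_support:
  assumes "grid_bump B L n x \<noteq> 0" "b \<in> Basis"
  shows "real (n b) \<le> real L * (x \<bullet> b) \<and> real L * (x \<bullet> b) < real (n b) + 1"
proof -
  have "B (2 * (L * (x \<bullet> b) - n b) - 1) \<noteq> 0"
    using assms unfolding grid_bump_def by (auto simp: prod_zero_iff)
  then have "\<bar>2 * (L * (x \<bullet> b) - n b) - 1\<bar> < 3/4" using plateau unfolding plateau_def by (meson not_le)
  then show ?thesis unfolding abs_less_iff by (auto simp: algebra_simps)
qed

lemma grid_bump_disjoint:
  assumes "n \<in> grid_index L" "n' \<in> grid_index L" "grid_bump B L n x \<noteq> 0" "grid_bump B L n' x \<noteq> 0"
  shows "n = n'"
proof (rule grid_index_eqI[OF assms(1,2)])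
  fix b :: 'a assume "b \<in> Basis"
  then have "\<lfloor>L * (x \<bullet> b)\<rfloor> = int (n b)" "\<lfloor>L * (x \<bullet> b)\<rfloor> = int (n' b)"
    using assms grid_bump_support by (auto simp: floor_eq_iff)
  then show "n b = n' b" by simp
qed

lemma sum_grid_bump_le_1:
  assumes S: "S \<subseteq> grid_index L"
  shows "(\<Sum>n\<in>S. grid_bump B L n x) \<le> 1"
proof (cases "\<exists>n\<in>S. grid_bump B L n x \<noteq> 0")
  case True
  then obtain n where n: "n \<in> S" "grid_bump B L n x \<noteq> 0" by blast
  have "finite S" by (rule finite_subset[OF S]) simp
  then have "(\<Sum>n\<in>S. grid_bump B L n x) = (\<Sum>n\<in>{n}. grid_bump B L n x)"
    using n S by (intro sum.mono_neutral_right) (auto dest: grid_bump_disjoint[of _ L n])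
  then show ?thesis using grid_bump_le_1 by simp
qed simp

lemma grid_bump_eq_1:
  assumes "\<And>b. b \<in> Basis \<Longrightarrow> \<bar>2 * (real L * (x \<bullet> b) - real (n b)) - 1\<bar> \<le> 1/4"
  shows "grid_bump B L n x = 1"
  using assms plateau unfolding grid_bump_def plateau_def by simp

end

text \<open>The first moment is an integral of |\<eta>| |\<psi> ... \<psi>| times |P s ... s|, with
  \<open>P\<close> the trigonometric sum over \<open>S\<close>. The first factor has a fixed L^2
  norm; the squared norm of the second equals \<open>card S * W\<close> by orthogonality, whatever
  the shape of \<open>S\<close>. Cauchy-Schwarz, used as a weighted arithmetic-geometric inequality,
  gives sqrt N uniformly over all subsets.\<close>

lemma spline_sums_in_barron_class:
  fixes C :: real
  assumes "C > 0"
  obtains \<kappa> :: real and B :: "real \<Rightarrow> real"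
  where "\<kappa> > 0"
    and "plateau B"
    and "\<And>L S h. L \<ge> 1 \<Longrightarrow> S \<subseteq> grid_index L \<Longrightarrow> 0 \<le> h \<Longrightarrow> h \<le> 1 \<Longrightarrow>
      h * real L * sqrt (real L ^ DIM('a)) \<le> \<kappa> \<Longrightarrow>
      (\<lambda>x \<in> unit_cube. h * (\<Sum>n\<in>S. grid_bump B L n x))
        \<in> (barron_class C :: ('a::euclidean_space \<Rightarrow> real) set)"
proof -
  obtain B \<psi> :: "real \<Rightarrow> real" where psi [measurable]: "\<psi> \<in> borel_measurable borel"
    and psi2: "integrable lborel (\<lambda>t. (\<psi> t)\<^sup>2)" "integrable lborel (\<lambda>t. t\<^sup>2 * (\<psi> t)\<^sup>2)"
    and spsi: "integrable lborel (\<lambda>t. sin_quot (1/2) t * \<psi> t)"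
    and inv: "\<forall>y. (CLINT t|lborel. iexp (t * y) * of_real (sin_quot (1/2) t * \<psi> t)) = complex_of_real (B y)"
    and B': "\<forall>y. 0 \<le> B y \<and> B y \<le> 1" "\<forall>y. \<bar>y\<bar> \<le> 1/4 \<longrightarrow> B y = 1" "\<forall>y. \<bar>y\<bar> \<ge> 3/4 \<longrightarrow> B y = 0"
    using spline_bump by (elim exE conjE)
  have B: "\<And>y. 0 \<le> B y" "\<And>y. B y \<le> 1" "\<And>y. \<bar>y\<bar> \<le> 1/4 \<Longrightarrow> B y = 1" "\<And>y. \<bar>y\<bar> \<ge> 3/4 \<Longrightarrow> B y = 0"
    using B' by blast+
  have plB: "plateau B" using B' by (simp add: plateau_def)
  let ?k = "DIM('a)"
  define s where "s = sin_quot (1/2)"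
  have [measurable]: "s \<in> borel_measurable borel" by (simp add: s_def)
  have s2: "integrable lborel (\<lambda>t. (s t)\<^sup>2)" unfolding s_def by (rule integrable_sin_quot_sq) simp
  define W where "W = (LINT t|lborel. (s t)\<^sup>2) ^ ?k"
  have W: "W \<ge> 0" unfolding W_def by simp
  define Psi2 where "Psi2 \<eta> = (\<Prod>b\<in>Basis. (\<psi> (\<eta> \<bullet> b))\<^sup>2)" for \<eta> :: 'a
  have PsiI: "integrable lborel (\<lambda>\<eta>. (norm \<eta>)\<^sup>2 * Psi2 \<eta>)"
  proof -
    have "integrable lborel (\<lambda>\<eta>. (\<eta> \<bullet> b)\<^sup>2 * Psi2 \<eta>)" if b: "b \<in> Basis" for b
    proof -
      \<comment> \<open>One summand of |\<eta>|^2 keeps the integrand a product: only the factor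
        belonging to \<open>b\<close> is changed.\<close>
      have "integrable lborel (\<lambda>\<eta>::'a. \<Prod>c\<in>Basis. (if c = b then (\<lambda>t. t\<^sup>2 * (\<psi> t)\<^sup>2) else (\<lambda>t. (\<psi> t)\<^sup>2)) (\<eta> \<bullet> c))"
        using psi2 by (intro integrable_lborel_prod) auto
      moreover have "(\<Prod>c\<in>Basis. (if c = b then (\<lambda>t. t\<^sup>2 * (\<psi> t)\<^sup>2) else (\<lambda>t. (\<psi> t)\<^sup>2)) (\<eta> \<bullet> c)) = (\<eta> \<bullet> b)\<^sup>2 * Psi2 \<eta>"
        for \<eta> :: 'a unfolding Psi2_def using b by (simp add: prod.remove[of _ b] mult.assoc)
      ultimately show ?thesis by simp
    qed
    then have "integrable lborel (\<lambda>\<eta>. \<Sum>b\<in>Basis. (\<eta> \<bullet> b)\<^sup>2 * Psi2 \<eta>)" by (intro Bochner_Integration.integrable_sum)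
    moreover have "(norm \<eta>)\<^sup>2 = (\<Sum>b\<in>Basis. (\<eta> \<bullet> b)\<^sup>2)" for \<eta> :: 'a
      unfolding power2_norm_eq_inner by (subst euclidean_inner) (simp add: power2_eq_square)
    ultimately show ?thesis by (simp add: sum_distrib_right)
  qed
  define A where "A = (LINT \<eta>|lborel. (norm \<eta>)\<^sup>2 * Psi2 (\<eta>::'a))"
  have A: "A \<ge> 0" unfolding A_def Psi2_def by (intro integral_nonneg_AE always_eventually) (simp add: prod_nonneg)
  \<comment> \<open>\<open>A\<close> and \<open>W\<close> are the integrals behind the two squared
    norms; the summand 1 keeps the denominator positive.\<close>
  define \<kappa> where "\<kappa> = C / (A + W + 1)"
  show ?thesis
  proof (rule that[of \<kappa> B])
    show "\<kappa> > 0" unfolding \<kappa>_def using A W \<open>C > 0\<close> by simp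
    fix L :: nat and S :: "('a \<Rightarrow> nat) set" and h :: real
    assume L: "L \<ge> 1" and S: "S \<subseteq> grid_index L" and h: "0 \<le> h" "h \<le> 1"
      and hk: "h * real L * sqrt (real L ^ ?k) \<le> \<kappa>"
    have finS [simp]: "finite S" by (rule finite_subset[OF S]) simp
    \<comment> \<open>A bump is \<open>B\<close> at 2L x - (2n + 1): the factor 2L is the dilation
      and the shift 2n + 1 becomes the phase \<open>e n\<close>.\<close>
    define c where "c = 2 * real L"
    have c: "c > 0" using L by (simp add: c_def)
    define e where "e n \<eta> = (\<Prod>b\<in>Basis. iexp (- (\<eta> \<bullet> b) * (2 * n b + 1)))" for n :: "'a \<Rightarrow> nat" and \<eta> :: 'a
    define \<Phi> where "\<Phi> \<eta> = (\<Prod>b\<in>Basis. s (\<eta> \<bullet> b) * \<psi> (\<eta> \<bullet> b))" for \<eta> :: 'a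
    define P where "P \<eta> = (\<Sum>n\<in>S. e n \<eta>)" for \<eta>
    define G where "G \<eta> = of_real h * (P \<eta> * of_real (\<Phi> \<eta>))" for \<eta>
    define bump where "bump n x = (\<Prod>b\<in>Basis. B (2 * (L * (x \<bullet> b) - n b) - 1))" for n :: "'a \<Rightarrow> nat" and x :: 'a
    have [measurable]: "e n \<in> borel_measurable borel" for n unfolding e_def by measurable
    have norm_e: "norm (e n \<eta>) = 1" for n \<eta>
      unfolding e_def by (simp add: prod_norm[symmetric])
    have intPhi: "integrable lborel \<Phi>"
      unfolding \<Phi>_def using spsi by (intro integrable_lborel_prod) (simp add: s_def)
    then have [measurable]: "\<Phi> \<in> borel_measurable borel" by auto
    have eiPhi: "integrable lborel (\<lambda>\<eta>. u \<eta> * of_real (\<Phi> \<eta>))" if [measurable]: "u \<in> borel_measurable borel" and "\<And>\<eta>. norm (u \<eta>) \<le> 1"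
      for u :: "'a \<Rightarrow> complex"
      using that by (intro Bochner_Integration.integrable_bound[OF integrable_of_real[OF intPhi, where 'a = complex]])
        (auto simp: norm_mult intro!: mult_left_le_one_le)
    have bump_int: "of_real (bump n x) = (LINT \<eta>|lborel. iexp (c * (x \<bullet> \<eta>)) * e n \<eta> * of_real (\<Phi> \<eta>))" for n x
    proof -
      let ?y = "\<lambda>b. 2 * (L * (x \<bullet> b) - n b) - 1"
      have "of_real (bump n x) = (\<Prod>b\<in>Basis. CLINT t|lborel. iexp (t * ?y b) * of_real (s t * \<psi> t))"
        unfolding bump_def s_def inv[rule_format] by simp
      also have "\<dots> = (LINT \<eta>|lborel. (\<Prod>b\<in>Basis. iexp ((\<eta> \<bullet> b) * ?y b) * of_real (s (\<eta> \<bullet> b) * \<psi> (\<eta> \<bullet> b))))"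
      proof (rule integral_lborel_prod[symmetric])
        show "integrable lborel (\<lambda>t. iexp (t * ?y b) * of_real (s t * \<psi> t))" for b
          by (rule Bochner_Integration.integrable_bound[OF integrable_of_real[OF spsi, where 'a = complex]])
            (auto simp: norm_mult s_def)
      qed
      also have "\<dots> = (LINT \<eta>|lborel. iexp (c * (x \<bullet> \<eta>)) * e n \<eta> * of_real (\<Phi> \<eta>))"
      proof (rule Bochner_Integration.integral_cong[OF refl])
        fix \<eta> :: 'a
        have "iexp (c * (x \<bullet> \<eta>)) = (\<Prod>b\<in>Basis. iexp ((\<eta> \<bullet> b) * (c * (x \<bullet> b))))"
          by (subst euclidean_inner) (simp add: exp_sum[symmetric] sum_distrib_left mult_ac)
        then have "iexp (c * (x \<bullet> \<eta>)) * e n \<eta> = (\<Prod>b\<in>Basis. iexp ((\<eta> \<bullet> b) * (c * (x \<bullet> b))) * iexp (- (\<eta> \<bullet> b) * (2 * n b + 1)))"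
          by (simp add: e_def prod.distrib)
        also have "\<dots> = (\<Prod>b\<in>Basis. iexp ((\<eta> \<bullet> b) * ?y b))"
          unfolding exp_add[symmetric] c_def by (intro prod.cong refl arg_cong[where f = exp]) (simp add: algebra_simps)
        finally show "(\<Prod>b\<in>Basis. iexp ((\<eta> \<bullet> b) * ?y b) * of_real (s (\<eta> \<bullet> b) * \<psi> (\<eta> \<bullet> b))) = iexp (c * (x \<bullet> \<eta>)) * e n \<eta> * of_real (\<Phi> \<eta>)"
          by (simp add: \<Phi>_def prod.distrib)
      qed
      finally show ?thesis .
    qed
    have intPPhi: "integrable lborel (\<lambda>\<eta>. P \<eta> * of_real (\<Phi> \<eta>))"
      unfolding P_def sum_distrib_right by (intro Bochner_Integration.integrable_sum eiPhi) (auto simp: norm_e)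
    have intG: "integrable lborel G" unfolding G_def using intPPhi by (intro integrable_mult_right)
    have repr: "of_real (h * (\<Sum>n\<in>S. bump n x)) = (LINT \<eta>|lborel. iexp (c * (x \<bullet> \<eta>)) * G \<eta>)" for x
    proof -
      have "(LINT \<eta>|lborel. iexp (c * (x \<bullet> \<eta>)) * G \<eta>)
          = (LINT \<eta>|lborel. of_real h * (\<Sum>n\<in>S. iexp (c * (x \<bullet> \<eta>)) * e n \<eta> * of_real (\<Phi> \<eta>)))"
        unfolding G_def P_def by (simp add: sum_distrib_left sum_distrib_right mult_ac)
      also have "\<dots> = of_real h * (\<Sum>n\<in>S. LINT \<eta>|lborel. iexp (c * (x \<bullet> \<eta>)) * e n \<eta> * of_real (\<Phi> \<eta>))"
        by (subst integral_mult_right_zero, subst Bochner_Integration.integral_sum)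
          (auto intro!: eiPhi simp: norm_mult norm_e)
      finally show ?thesis by (simp only: bump_int of_real_mult of_real_sum)
    qed
    have bump_eq: "bump = grid_bump B L" by (simp add: fun_eq_iff bump_def grid_bump_def)
    have bump_nn: "0 \<le> bump n x" and sum_le: "(\<Sum>n\<in>S. bump n x) \<le> 1" for n x
      unfolding bump_eq using grid_bump_nonneg sum_grid_bump_le_1 S plB by blast+
    define f where "f = (\<lambda>x \<in> unit_cube. h * (\<Sum>n\<in>S. bump n x))"
    have "f \<in> barron_class C"
    proof (rule barron_classI_scaled[OF _ c \<open>C > 0\<close> intG])
      show "f \<in> unit_cube \<rightarrow>\<^sub>E {0..1}"
        unfolding f_def using h sum_le bump_nn by (auto intro!: mult_nonneg_nonneg sum_nonneg mult_le_one)
      show "complex_of_real (f x) = (LINT \<eta>|lborel. iexp (c * (x \<bullet> \<eta>)) * G \<eta>)" if "x \<in> unit_cube" for x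
        using that repr[of x] by (simp add: f_def)
      have "0 \<in> (unit_cube :: 'a set)" by (simp add: mem_box)
      \<comment> \<open>The origin is a corner of the grid: the argument is -2n - 1, outside the
        support of \<open>B\<close>.\<close>
      have "B (2 * (L * (0 \<bullet> b) - n b) - 1) = 0" for n :: "'a \<Rightarrow> nat" and b :: 'a by (rule B(4)) simp
      then have "bump n 0 = 0" for n unfolding bump_def by (auto intro!: prod_zero nonempty_Basis simp: ex_in_conv)
      then show "f 0 = 0" using \<open>0 \<in> unit_cube\<close> by (simp add: f_def)
      define N where "N = real L ^ ?k"
      have N: "N > 0" using L by (simp add: N_def)
      define Q where "Q \<eta> = (norm (P \<eta>))\<^sup>2 * (\<Prod>b\<in>Basis. (s (\<eta> \<bullet> b))\<^sup>2)" for \<eta>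
      have Q: "integrable lborel Q" "(LINT \<eta>|lborel. Q \<eta>) = card S * W"
      proof -
        let ?q = "\<lambda>n n' t. iexp (t * (2 * (real (n' :: nat) - real n))) * of_real ((s t)\<^sup>2)"
        have iq: "integrable lborel (?q n n')" for n n'
          by (rule Bochner_Integration.integrable_bound[OF integrable_of_real[OF s2, where 'a = complex]])
            (auto simp: norm_mult)
        have Qeq: "of_real (Q \<eta>) = (\<Sum>n\<in>S. \<Sum>n'\<in>S. \<Prod>b\<in>Basis. ?q (n b) (n' b) (\<eta> \<bullet> b))" for \<eta>
        proof -
          have cn: "cnj (e n' \<eta>) = (\<Prod>b\<in>Basis. iexp ((\<eta> \<bullet> b) * (2 * n' b + 1)))" for n'
            unfolding e_def by (simp add: exp_cnj algebra_simps)
          have ee: "e n \<eta> * cnj (e n' \<eta>) = (\<Prod>b\<in>Basis. iexp ((\<eta> \<bullet> b) * (2 * (real (n' b) - real (n b)))))" for n n'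
            unfolding cn unfolding e_def prod.distrib[symmetric] exp_add[symmetric]
            by (intro prod.cong refl arg_cong[where f = exp]) (simp add: algebra_simps)
          have "of_real ((norm (P \<eta>))\<^sup>2) = P \<eta> * cnj (P \<eta>)" by (rule complex_norm_square)
          also have "\<dots> = (\<Sum>n\<in>S. \<Sum>n'\<in>S. e n \<eta> * cnj (e n' \<eta>))"
            unfolding P_def by (simp add: sum_product)
          finally show ?thesis
            unfolding Q_def ee by (simp add: sum_distrib_right prod.distrib)
        qed
        have iQ: "integrable lborel (\<lambda>\<eta>::'a. \<Prod>b\<in>Basis. ?q (n b) (n' b) (\<eta> \<bullet> b))" for n n'
          by (intro integrable_lborel_prod iq)
        have I: "integrable lborel (\<lambda>\<eta>. complex_of_real (Q \<eta>))"
          unfolding Qeq by (intro Bochner_Integration.integrable_sum iQ)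
        then show "integrable lborel Q" using integrable_Re[OF I] by simp
        have qq: "(LINT \<eta>|lborel. (\<Prod>b\<in>Basis. ?q (n b) (n' b) (\<eta> \<bullet> b))) = (if n = n' then complex_of_real W else 0)"
          if "n \<in> S" "n' \<in> S" for n n'
        proof -
          have "(LINT \<eta>|lborel. (\<Prod>b\<in>Basis. ?q (n b) (n' b) (\<eta> \<bullet> b))) = (\<Prod>b\<in>(Basis :: 'a set). LINT t|lborel. ?q (n b) (n' b) t)"
            by (rule integral_lborel_prod[OF iq])
          also have "\<dots> = (if n = n' then complex_of_real W else 0)"
          proof (cases "n = n'")
            case False
            \<comment> \<open>Distinct indices differ by an integer in some coordinate. The
              frequencies there differ by at least 2, and this single factor annihilates the whole
              product.\<close>
            have "n \<in> grid_index L" "n' \<in> grid_index L" using that S by auto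
            then obtain b where b: "b \<in> Basis" "n b \<noteq> n' b" using False grid_index_eqI by blast
            then have "n b + 1 \<le> n' b \<or> n' b + 1 \<le> n b" by linarith
            then have "real (n b + 1) \<le> real (n' b) \<or> real (n' b + 1) \<le> real (n b)"
              by (simp only: of_nat_le_iff)
            then have "\<bar>2 * (real (n' b) - real (n b))\<bar> \<ge> 1" by (elim disjE) simp_all
            then have "(LINT t|lborel. ?q (n b) (n' b) t) = 0" unfolding s_def by (rule sin_quot_sq_orthogonal)
            then show ?thesis using False b by (auto intro!: prod_zero)
          next
            case True
            have "(LINT t|lborel. ?q i i t) = complex_of_real (LINT t|lborel. (s t)\<^sup>2)" for i
              unfolding integral_complex_of_real[symmetric] by simp
            then show ?thesis using True by (simp add: W_def)
          qed
          finally show ?thesis .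
        qed
        have "of_real (LINT \<eta>|lborel. Q \<eta>) = (LINT \<eta>|lborel. complex_of_real (Q \<eta>))" by simp
        also have "\<dots> = (\<Sum>n\<in>S. \<Sum>n'\<in>S. LINT \<eta>|lborel. (\<Prod>b\<in>Basis. ?q (n b) (n' b) (\<eta> \<bullet> b)))"
          unfolding Qeq by (subst Bochner_Integration.integral_sum, intro Bochner_Integration.integrable_sum iQ,
            subst Bochner_Integration.integral_sum, rule iQ) simp
        also have "\<dots> = (\<Sum>n\<in>S. \<Sum>n'\<in>S. if n = n' then complex_of_real W else 0)"
          by (intro sum.cong refl qq)
        also have "\<dots> = of_real (card S * W)" by simp
        finally show "(LINT \<eta>|lborel. Q \<eta>) = card S * W" by (simp only: of_real_eq_iff)
      qed
      have cardS: "real (card S) \<le> N"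
        using card_mono[OF finite_grid_index S] unfolding card_grid_index N_def by (metis of_nat_le_iff of_nat_power)
      \<comment> \<open>This is the majorant from 2uv <= sqrt N u^2 + v^2 / sqrt N. The weights are
        chosen so that, with the integral of \<open>Q\<close> at most N W, both terms are of order
        sqrt N.\<close>
      define R where "R \<eta> = sqrt N * ((norm \<eta>)\<^sup>2 * Psi2 \<eta>) + 1 / sqrt N * Q \<eta>" for \<eta>
      have R: "integrable lborel R" "(LINT \<eta>|lborel. R \<eta>) \<le> sqrt N * (A + W)"
      proof -
        show "integrable lborel R" unfolding R_def using PsiI Q(1)
          by (intro Bochner_Integration.integrable_add integrable_mult_right)
        have "(LINT \<eta>|lborel. R \<eta>) = sqrt N * A + 1 / sqrt N * (card S * W)"
          unfolding R_def A_def Q(2)[symmetric] using PsiI Q(1)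
          by (subst Bochner_Integration.integral_add) auto
        also have "\<dots> \<le> sqrt N * A + 1 / sqrt N * (N * W)"
          using cardS W N by (intro add_left_mono mult_left_mono mult_right_mono) auto
        also have "1 / sqrt N * (N * W) = sqrt N * W" using N by (simp add: field_simps real_sqrt_mult[symmetric] power2_eq_square[symmetric])
        finally show "(LINT \<eta>|lborel. R \<eta>) \<le> sqrt N * (A + W)" by (simp add: algebra_simps)
      qed
      have pw: "norm \<eta> * norm (G \<eta>) \<le> h / 2 * R \<eta>" for \<eta>
      proof -
        define u where "u = norm \<eta> * (\<Prod>b\<in>Basis. \<bar>\<psi> (\<eta> \<bullet> b)\<bar>)"
        define v where "v = norm (P \<eta>) * (\<Prod>b\<in>Basis. \<bar>s (\<eta> \<bullet> b)\<bar>)"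
        have "norm \<eta> * norm (G \<eta>) = h * (u * v)"
          unfolding G_def \<Phi>_def u_def v_def using h by (simp add: norm_mult prod_norm[symmetric] prod.distrib mult_ac)
        moreover have "2 * (u * v) \<le> R \<eta>"
        proof -
          have "u\<^sup>2 = (norm \<eta>)\<^sup>2 * Psi2 \<eta>" "v\<^sup>2 = Q \<eta>"
            unfolding u_def v_def Psi2_def Q_def by (simp_all add: power_mult_distrib prod_power_distrib)
          moreover have "0 \<le> (sqrt (sqrt N) * u - v / sqrt (sqrt N))\<^sup>2" by simp
          then have "2 * (u * v) \<le> sqrt N * u\<^sup>2 + 1 / sqrt N * v\<^sup>2"
            using N by (simp add: power2_diff power_mult_distrib power_divide)
          ultimately show ?thesis unfolding R_def by simp
        qed
        ultimately show ?thesis using h mult_left_mono[of "2 * (u * v)" "R \<eta>" "h / 2"] by simp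
      qed
      have "(\<integral>\<^sup>+ \<eta>. ennreal (norm \<eta> * norm (G \<eta>)) \<partial>lborel) \<le> (\<integral>\<^sup>+ \<eta>. ennreal (h / 2 * R \<eta>) \<partial>lborel)"
        by (intro nn_integral_mono ennreal_leI pw)
      also have "\<dots> = ennreal (LINT \<eta>|lborel. h / 2 * R \<eta>)"
      proof (rule nn_integral_eq_integral)
        show "AE \<eta> in lborel. 0 \<le> h / 2 * R \<eta>"
          by (intro always_eventually allI order_trans[OF _ pw]) simp
      qed (use R in simp)
      also have "(LINT \<eta>|lborel. h / 2 * R \<eta>) \<le> h / 2 * (sqrt N * (A + W))"
        using R h by (simp add: mult_left_mono)
      finally have "(\<integral>\<^sup>+ \<eta>. ennreal (norm \<eta> * norm (G \<eta>)) \<partial>lborel) \<le> ennreal (h / 2 * (sqrt N * (A + W)))"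
        by (simp add: ennreal_leI)
      then have "ennreal c * (\<integral>\<^sup>+ \<eta>. ennreal (norm \<eta> * norm (G \<eta>)) \<partial>lborel) \<le> ennreal c * ennreal (h / 2 * (sqrt N * (A + W)))"
        by (intro mult_left_mono) auto
      also have "\<dots> = ennreal ((h * real L * sqrt N) * (A + W))"
        using c by (simp add: ennreal_mult'[symmetric] c_def algebra_simps)
      also have "\<dots> \<le> ennreal C"
      proof (rule ennreal_leI)
        have "(h * real L * sqrt N) * (A + W) \<le> \<kappa> * (A + W)" using hk A W unfolding N_def by (intro mult_right_mono) auto
        also have "\<dots> \<le> \<kappa> * (A + W + 1)" using \<open>\<kappa> > 0\<close> by simp
        also have "\<dots> = C" unfolding \<kappa>_def using A W by simp
        finally show "(h * real L * sqrt N) * (A + W) \<le> C" .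
      qed
      finally show "ennreal c * (\<integral>\<^sup>+ \<eta>. ennreal (norm \<eta> * norm (G \<eta>)) \<partial>lborel) \<le> ennreal C" .
    qed
    then show "(\<lambda>x \<in> unit_cube. h * (\<Sum>n\<in>S. grid_bump B L n x)) \<in> barron_class C"
      by (simp add: f_def bump_eq)
  qed (rule plB)
qed

section \<open>Horizon functions and the measurable structure of \<open>L\<^sup>2\<close>\<close>

lemma mem_unit_cube: "x \<in> unit_cube \<longleftrightarrow> (\<forall>b\<in>Basis. 0 \<le> x \<bullet> b \<and> x \<bullet> b \<le> 1)"
  by (simp add: mem_box)

lemma mem_unit_cube_prod: "x \<in> (unit_cube :: ('a::euclidean_space \<times> real) set) \<longleftrightarrow> fst x \<in> unit_cube \<and> 0 \<le> snd x \<and> snd x \<le> 1"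
  unfolding mem_unit_cube by (cases x) (auto simp: Basis_prod_def)

lemma space_cube_measure [simp]: "space cube_measure = unit_cube"
  by (simp add: cube_measure_def space_restrict_space)

lemma sets_cube_measure [measurable_cong]: "sets cube_measure = sets (restrict_space borel unit_cube)"
  unfolding cube_measure_def by (rule sets_restrict_space_cong) simp

lemma emeasure_cube_measure: "A \<subseteq> unit_cube \<Longrightarrow> emeasure cube_measure A = emeasure lborel A"
  unfolding cube_measure_def by (subst emeasure_restrict_space) auto

lemma emeasure_unit_cube: "emeasure lborel (unit_cube :: 'a::euclidean_space set) = 1"
  by (subst emeasure_lborel_cbox) (auto simp: inner_diff_left)

interpretation cube: prob_space "cube_measure :: 'a::euclidean_space measure"
  by (rule prob_spaceI) (simp add: emeasure_cube_measure emeasure_unit_cube)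

lemma in_sets_cube_measure: "A \<in> sets borel \<Longrightarrow> A \<subseteq> unit_cube \<Longrightarrow> A \<in> sets cube_measure"
  unfolding sets_cube_measure by (subst sets_restrict_space_iff) auto

lemma integral_cube_indicator:
  assumes "A \<in> sets borel" "A \<subseteq> unit_cube"
  shows "(LINT x|cube_measure. indicator A x * (c::real)) = measure lborel A * c"
  using in_sets_cube_measure[OF assms] assms by (simp add: measure_def emeasure_cube_measure Int_absorb2)

lemma horizon_measurable:
  assumes b [measurable]: "b \<in> borel_measurable (restrict_space borel unit_cube)"
  shows "horizon b \<in> borel_measurable cube_measure"
proof -
  have fst_m: "fst \<in> borel_measurable (borel :: ('a \<times> real) measure)"
    and snd_m: "snd \<in> borel_measurable (borel :: ('a \<times> real) measure)"
    by (rule borel_measurable_continuous_onI, intro continuous_intros)+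
  have [measurable]: "fst \<in> measurable (restrict_space borel (unit_cube :: ('a \<times> real) set)) (restrict_space borel unit_cube)"
    by (rule measurable_restrict_space2) 
      (auto simp: space_restrict_space mem_unit_cube_prod intro: measurable_restrict_space1 fst_m)
  have [measurable]: "snd \<in> borel_measurable (restrict_space borel (unit_cube :: ('a \<times> real) set))"
    by (rule measurable_restrict_space1[OF snd_m])
  have "(\<lambda>x. if b (fst x) \<le> snd x then 1 else 0 :: real) \<in> borel_measurable (restrict_space borel unit_cube)"
    by measurable
  then have "horizon b \<in> borel_measurable (restrict_space borel unit_cube)"
    by (rule measurable_cong[THEN iffD1, rotated]) (simp add: horizon_def space_restrict_space)
  then show ?thesis by (simp add: sets_cube_measure cong: measurable_cong_sets)
qed

lemma horizon_01: "x \<in> unit_cube \<Longrightarrow> horizon b x \<in> {0, 1}"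
  by (simp add: horizon_def)

text \<open>Membership in the class supplies measurability through the representation: an integral
  depending on a parameter is measurable in it.\<close>

lemma barron_class_measurable:
  assumes "f \<in> barron_class C"
  shows "f \<in> borel_measurable (restrict_space borel unit_cube)"
proof -
  obtain F c where [measurable]: "F \<in> borel_measurable borel" and
    rep: "\<And>x. x \<in> unit_cube \<Longrightarrow> complex_of_real (f x) = complex_of_real c +
          (LINT \<xi>|lborel. (exp (\<i> * complex_of_real (x \<bullet> \<xi>)) - 1) * F \<xi>)"
    using assms unfolding barron_class_def by blast
  have "(\<lambda>x. Re (complex_of_real c + (LINT \<xi>|lborel. (exp (\<i> * complex_of_real (x \<bullet> \<xi>)) - 1) * F \<xi>))) \<in> borel_measurable borel"
    by measurable
  then have "(\<lambda>x. Re (complex_of_real c + (LINT \<xi>|lborel. (exp (\<i> * complex_of_real (x \<bullet> \<xi>)) - 1) * F \<xi>)))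
      \<in> borel_measurable (restrict_space borel unit_cube)"
    by (rule measurable_restrict_space1)
  then show ?thesis
    by (rule measurable_cong[THEN iffD1, rotated]) (simp add: rep[symmetric] space_restrict_space)
qed

section \<open>The L^2 seminorm and its Borel sigma-algebra\<close>

lemma L2_functions_lincomb:
  assumes "f \<in> L2_functions M" "g \<in> L2_functions M"
  shows "(\<lambda>x. f x + c * g x) \<in> L2_functions M"
proof -
  have [measurable]: "f \<in> borel_measurable M" "g \<in> borel_measurable M"
    and i: "integrable M (\<lambda>x. (f x)\<^sup>2)" "integrable M (\<lambda>x. (g x)\<^sup>2)"
    using assms by (auto simp: L2_functions_def)
  have "integrable M (\<lambda>x. 2 * (f x)\<^sup>2 + 2 * c\<^sup>2 * (g x)\<^sup>2)" using i by auto
  then have "integrable M (\<lambda>x. (f x + c * g x)\<^sup>2)"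
  proof (rule Bochner_Integration.integrable_bound)
    have "(f x + c * g x)\<^sup>2 \<le> 2 * (f x)\<^sup>2 + 2 * c\<^sup>2 * (g x)\<^sup>2" for x
      using zero_le_power2[of "f x - c * g x"] by (simp add: power2_sum power2_diff power_mult_distrib)
    then show "AE x in M. norm ((f x + c * g x)\<^sup>2) \<le> norm (2 * (f x)\<^sup>2 + 2 * c\<^sup>2 * (g x)\<^sup>2)"
      by (simp add: add_nonneg_nonneg)
  qed measurable
  then show ?thesis by (simp add: L2_functions_def)
qed

lemma L2_functions_diff:
  "f \<in> L2_functions M \<Longrightarrow> g \<in> L2_functions M \<Longrightarrow> (\<lambda>x. f x - g x) \<in> L2_functions M"
  using L2_functions_lincomb[of f M g "-1"] by simp

text \<open>For \<alpha> and \<beta> strictly above the two norms, integrate (f + g)^2 <= (1 +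
  \<beta>/\<alpha>) f^2 + (1 + \<alpha>/\<beta>) g^2. Strictness makes both positive, so norms equal
  to 0 need no separate case, and \<alpha> and \<beta> then tend to the norms.\<close>

lemma L2_norm_triangle:
  assumes f: "f \<in> L2_functions M" and g: "g \<in> L2_functions M"
  shows "L2_norm M (\<lambda>x. f x + g x) \<le> L2_norm M f + L2_norm M g"
proof -
  have i: "integrable M (\<lambda>x. (f x)\<^sup>2)" "integrable M (\<lambda>x. (g x)\<^sup>2)" "integrable M (\<lambda>x. (f x + g x)\<^sup>2)"
    using f g L2_functions_lincomb[OF f g, of 1] by (auto simp: L2_functions_def)
  have key: "L2_norm M (\<lambda>x. f x + g x) \<le> \<alpha> + \<beta>" if a: "L2_norm M f < \<alpha>" and b: "L2_norm M g < \<beta>" for \<alpha> \<beta>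
  proof -
    have nn: "0 \<le> L2_norm M f" "0 \<le> L2_norm M g" by (simp_all add: L2_norm_def)
    with that have pos: "\<alpha> > 0" "\<beta> > 0" by linarith+
    have sq: "(LINT x|M. (f x)\<^sup>2) \<le> \<alpha>\<^sup>2" "(LINT x|M. (g x)\<^sup>2) \<le> \<beta>\<^sup>2"
      using that nn unfolding L2_norm_def by (meson less_imp_le sqrt_le_D)+
    have "(LINT x|M. (f x + g x)\<^sup>2) \<le> (LINT x|M. (1 + \<beta>/\<alpha>) * (f x)\<^sup>2 + (1 + \<alpha>/\<beta>) * (g x)\<^sup>2)"
    proof (rule integral_mono)
      fix x
      have "(1 + \<beta>/\<alpha>) * (f x)\<^sup>2 + (1 + \<alpha>/\<beta>) * (g x)\<^sup>2 - (f x + g x)\<^sup>2 = (\<beta> * f x - \<alpha> * g x)\<^sup>2 / (\<alpha> * \<beta>)"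
        using pos by (simp add: field_simps power2_eq_square)
      also have "\<dots> \<ge> 0" using pos by simp
      finally show "(f x + g x)\<^sup>2 \<le> (1 + \<beta>/\<alpha>) * (f x)\<^sup>2 + (1 + \<alpha>/\<beta>) * (g x)\<^sup>2" by simp
    qed (use i in auto)
    also have "\<dots> = (1 + \<beta>/\<alpha>) * (LINT x|M. (f x)\<^sup>2) + (1 + \<alpha>/\<beta>) * (LINT x|M. (g x)\<^sup>2)"
      using i by simp
    also have "\<dots> \<le> (1 + \<beta>/\<alpha>) * \<alpha>\<^sup>2 + (1 + \<alpha>/\<beta>) * \<beta>\<^sup>2"
      using sq pos by (intro add_mono mult_left_mono) auto
    also have "\<dots> = (\<alpha> + \<beta>)\<^sup>2" using pos by (simp add: field_simps power2_eq_square)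
    finally show ?thesis unfolding L2_norm_def using pos by (intro real_le_lsqrt) auto
  qed
  show ?thesis
  proof (rule field_le_epsilon)
    fix e :: real assume "e > 0"
    then show "L2_norm M (\<lambda>x. f x + g x) \<le> L2_norm M f + L2_norm M g + e"
      using key[of "L2_norm M f + e/2" "L2_norm M g + e/2"] by simp
  qed
qed

lemma space_L2_borel [simp]: "space (L2_borel M) = L2_functions M"
  unfolding L2_borel_def by (rule space_measure_of) (auto simp: L2_open_def)

text \<open>Balls around \<open>h\<close> are open by the triangle inequality, so the distance to a
  fixed function is measurable for the sigma-algebra generated by the open sets.\<close>

lemma L2_distance_measurable:
  assumes h: "h \<in> L2_functions M"
  shows "(\<lambda>g. L2_norm M (\<lambda>x. g x - h x)) \<in> borel_measurable (L2_borel M)"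
proof (rule borel_measurableI_less)
  fix r :: real
  let ?U = "{g \<in> space (L2_borel M). L2_norm M (\<lambda>x. g x - h x) < r}"
  have "L2_open M ?U"
    unfolding L2_open_def
  proof (intro conjI ballI)
    fix f assume f: "f \<in> ?U"
    let ?e = "r - L2_norm M (\<lambda>x. f x - h x)"
    have "g \<in> ?U" if g: "g \<in> L2_functions M" "L2_norm M (\<lambda>x. g x - f x) < ?e" for g
    proof -
      have "L2_norm M (\<lambda>x. (g x - f x) + (f x - h x)) \<le> L2_norm M (\<lambda>x. g x - f x) + L2_norm M (\<lambda>x. f x - h x)"
        using f g h by (intro L2_norm_triangle L2_functions_diff) auto
      then show ?thesis using g by simp
    qed
    then show "\<exists>e>0. \<forall>g\<in>L2_functions M. L2_norm M (\<lambda>x. g x - f x) < e \<longrightarrow> g \<in> ?U"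
      using f by (intro exI[of _ ?e]) auto
  qed auto
  then show "?U \<in> sets (L2_borel M)"
    unfolding L2_borel_def by (subst sets_measure_of) (auto simp: L2_open_def space_measure_of_conv)
qed

section \<open>Labelled samples and measurability of the loss\<close>

definition labelled_sample :: "nat \<Rightarrow> ('a \<times> real \<Rightarrow> real) \<Rightarrow> (nat \<Rightarrow> 'a \<times> real) \<Rightarrow> nat \<Rightarrow> ('a::euclidean_space \<times> real) \<times> real" where
  "labelled_sample m h X = (\<lambda>i \<in> {1..m}. (X i, h (X i)))"

lemma estimator_in_L2: "A \<in> estimators m \<Longrightarrow> X \<in> space (PiM {1..m} (\<lambda>_. labelled_space)) \<Longrightarrow> A X \<in> L2_functions cube_measure"
  using measurable_space[of A "PiM {1..m} (\<lambda>_. labelled_space)" "L2_borel cube_measure" X]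
  by (simp add: estimators_def)

lemma L2_functions_01:
  fixes h :: "'a::euclidean_space \<Rightarrow> real"
  assumes h [measurable]: "h \<in> borel_measurable cube_measure" and h01: "\<And>x. x \<in> unit_cube \<Longrightarrow> h x \<in> {0, 1}"
  shows "h \<in> L2_functions cube_measure"
proof -
  have "(h x)\<^sup>2 \<le> 1" if "x \<in> unit_cube" for x using h01[OF that] by auto
  then have "AE x in cube_measure. norm ((h x)\<^sup>2) \<le> 1" by (intro AE_I2) simp
  then have "integrable cube_measure (\<lambda>x. (h x)\<^sup>2)" by (rule cube.integrable_const_bound) measurable
  then show ?thesis by (simp add: L2_functions_def)
qed

lemma labelled_sample_measurable:
  assumes h: "h \<in> borel_measurable cube_measure" and h01: "\<And>x. x \<in> unit_cube \<Longrightarrow> h x \<in> {0, 1}"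
  shows "labelled_sample m h \<in> measurable (PiM {1..m} (\<lambda>_. cube_measure)) (PiM {1..m} (\<lambda>_. labelled_space))"
proof -
  have h': "h \<in> borel_measurable (restrict_space borel unit_cube)"
    using h by (simp add: sets_cube_measure cong: measurable_cong_sets)
  have id: "(\<lambda>x. x) \<in> borel_measurable (restrict_space borel (unit_cube :: ('a \<times> real) set))"
    by (rule measurable_restrict_space1) simp
  have "(\<lambda>x. (x, h x)) \<in> measurable (restrict_space borel unit_cube) (borel \<Otimes>\<^sub>M borel)"
    by (rule measurable_Pair[OF id h'])
  then have "(\<lambda>x. (x, h x)) \<in> measurable (restrict_space borel unit_cube) labelled_space"
    unfolding labelled_space_def borel_prod using h01
    by (intro measurable_restrict_space2) (auto simp: space_restrict_space)
  then have m: "(\<lambda>x. (x, h x)) \<in> measurable cube_measure labelled_space"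
    by (simp add: sets_cube_measure cong: measurable_cong_sets)
  show ?thesis
    unfolding labelled_sample_def
  proof (rule measurable_restrict)
    fix i assume "i \<in> {1..m}"
    then have "(\<lambda>X. X i) \<in> measurable (PiM {1..m} (\<lambda>_. cube_measure :: ('a \<times> real) measure)) cube_measure"
      by (rule measurable_component_singleton)
    then show "(\<lambda>X. (X i, h (X i))) \<in> measurable (PiM {1..m} (\<lambda>_. cube_measure)) labelled_space"
      by (rule measurable_compose[OF _ m])
  qed
qed

text \<open>Measurability of the loss is what allows expectation and the sum over finitely many
  hypotheses to be interchanged.\<close>

lemma sq_error_measurable:
  assumes A: "A \<in> estimators m"
    and h: "h \<in> borel_measurable cube_measure" and h01: "\<And>x. x \<in> unit_cube \<Longrightarrow> h x \<in> {0, 1}"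
  shows "(\<lambda>X. L2_norm cube_measure (\<lambda>y. A (labelled_sample m h X) y - h y))
    \<in> borel_measurable (PiM {1..m} (\<lambda>_. cube_measure))"
proof -
  have "h \<in> L2_functions cube_measure" by (rule L2_functions_01[OF h h01])
  note d = L2_distance_measurable[OF this]
  have "(\<lambda>X. A (labelled_sample m h X)) \<in> measurable (PiM {1..m} (\<lambda>_. cube_measure)) (L2_borel cube_measure)"
    by (rule measurable_compose[OF labelled_sample_measurable[OF h h01] A[unfolded estimators_def]])
  then show ?thesis by (rule measurable_compose[OF _ d])
qed

section \<open>The lower bound\<close>

text \<open>Subsets are the corners of a hypercube, and this pairs them along the edges in direction
  \<open>n\<close>; Assouad's argument compares the two ends of an edge.\<close>

lemma sum_Pow_split:
  fixes f :: "'a set \<Rightarrow> 'b::comm_monoid_add"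
  assumes "finite G" "n \<in> G"
  shows "(\<Sum>S\<in>Pow G. f S) = (\<Sum>S\<in>Pow (G - {n}). f S + f (insert n S))"
proof -
  have "Pow G = Pow (G - {n}) \<union> insert n ` Pow (G - {n})"
    using Pow_insert[of n "G - {n}"] assms by (simp add: insert_absorb)
  then have "(\<Sum>S\<in>Pow G. f S) = (\<Sum>S\<in>Pow (G - {n}). f S) + (\<Sum>S\<in>insert n ` Pow (G - {n}). f S)"
    using assms by (simp only:, subst sum.union_disjoint) auto
  also have "(\<Sum>S\<in>insert n ` Pow (G - {n}). f S) = (\<Sum>S\<in>Pow (G - {n}). f (insert n S))"
    by (subst sum.reindex) (auto simp: inj_on_def)
  finally show ?thesis by (simp add: sum.distrib)
qed

text \<open>By independence the sample misses \<open>U\<close> with probability at least (1 - u)^m,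
  and Bernoulli's inequality gives 1 - m u >= 1/2.\<close>

lemma nn_integral_avoid:
  fixes U :: "'b::euclidean_space set"
  assumes U: "U \<in> sets cube_measure" and u: "measure cube_measure U \<le> u" "u \<le> 1" "real m * u \<le> 1/2"
  shows "ennreal (1/2) \<le> (\<integral>\<^sup>+ X. (\<Prod>i\<in>{1..m}. indicator (unit_cube - U) (X i)) \<partial>PiM {1..m} (\<lambda>_. cube_measure))"
proof -
  interpret product_sigma_finite "\<lambda>_::nat. cube_measure :: 'b measure" ..
  have [measurable]: "unit_cube - U \<in> sets cube_measure"
    using U sets.compl_sets[OF U] by simp
  have "1/2 \<le> 1 + real m * (- u)" using u by simp
  also have "\<dots> \<le> (1 - u) ^ m" using Bernoulli_inequality[of "-u" m] u by simp
  also have "\<dots> \<le> measure cube_measure (unit_cube - U) ^ m"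
    using u cube.prob_compl[OF U] by (intro power_mono) auto
  finally have "ennreal (1/2) \<le> ennreal (measure cube_measure (unit_cube - U) ^ m)"
    by (rule ennreal_leI)
  also have "\<dots> = ennreal (measure cube_measure (unit_cube - U)) ^ m"
    by (rule ennreal_power[symmetric]) simp
  also have "\<dots> = (\<Prod>i\<in>{1..m}. \<integral>\<^sup>+ x. indicator (unit_cube - U) x \<partial>cube_measure)"
    by (simp add: cube.emeasure_eq_measure)
  also have "\<dots> = (\<integral>\<^sup>+ X. (\<Prod>i\<in>{1..m}. indicator (unit_cube - U) (X i)) \<partial>PiM {1..m} (\<lambda>_. cube_measure))"
    by (rule product_nn_integral_prod[symmetric]) auto
  finally show ?thesis .
qed

text \<open>Half-open in the last coordinate because a horizon function is already 1 on its
  boundary: a boundary of height \<open>h\<close> gives label 0 exactly at heights below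
  \<open>h\<close>.\<close>

definition grid_box :: "nat \<Rightarrow> real \<Rightarrow> ('a::euclidean_space \<Rightarrow> nat) \<Rightarrow> real \<Rightarrow> real \<Rightarrow> ('a \<times> real) set" where
  "grid_box L h n \<alpha> \<beta> = cbox (\<Sum>b\<in>Basis. ((real (n b) + \<alpha>) / L) *\<^sub>R b) (\<Sum>b\<in>Basis. ((real (n b) + \<beta>) / L) *\<^sub>R b) \<times> {0..<h}"

lemma mem_grid_box:
  assumes "L \<ge> 1"
  shows "x \<in> grid_box L h n \<alpha> \<beta> \<longleftrightarrow>
    (\<forall>b\<in>Basis. real (n b) + \<alpha> \<le> L * (fst x \<bullet> b) \<and> L * (fst x \<bullet> b) \<le> real (n b) + \<beta>) \<and> 0 \<le> snd x \<and> snd x < h"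
  using assms unfolding grid_box_def
  by (cases x) (auto simp: mem_box field_simps)

lemma grid_box_sets: "grid_box L h n \<alpha> \<beta> \<in> sets borel"
  unfolding grid_box_def borel_prod[symmetric] by measurable

lemma measure_grid_box:
  assumes "L \<ge> 1" "\<alpha> \<le> \<beta>" "0 \<le> h"
  shows "measure lborel (grid_box L h n \<alpha> \<beta> :: ('a::euclidean_space \<times> real) set) = ((\<beta> - \<alpha>) / L) ^ DIM('a) * h"
proof -
  let ?p = "\<Sum>b\<in>(Basis::'a set). ((real (n b) + \<alpha>) / L) *\<^sub>R b" and ?q = "\<Sum>b\<in>(Basis::'a set). ((real (n b) + \<beta>) / L) *\<^sub>R b"
  have "emeasure lborel (cbox ?p ?q) = ennreal (\<Prod>b\<in>Basis. (?q - ?p) \<bullet> b)"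
    using assms by (intro emeasure_lborel_cbox) (auto simp: divide_right_mono)
  also have "(\<Prod>b\<in>Basis. (?q - ?p) \<bullet> b) = ((\<beta> - \<alpha>) / L) ^ DIM('a)"
    by (simp add: inner_diff_left diff_divide_distrib[symmetric])
  finally have "emeasure (lborel \<Otimes>\<^sub>M lborel) (grid_box L h n \<alpha> \<beta>) = ennreal (((\<beta> - \<alpha>) / L) ^ DIM('a)) * ennreal h"
    unfolding grid_box_def using assms by (subst lborel.emeasure_pair_measure_Times) auto
  then show ?thesis
    using assms by (simp add: lborel_prod measure_def ennreal_mult'[symmetric])
qed

text \<open>The supremum over hypotheses is at least the average over all 2^N sets of cells. The
  sets \<open>S\<close> and \<open>insert n S\<close> produce the same labels unless a sample point
  lies in the column \<open>U n\<close>. With probability at least 1/2 the estimator thus gives one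
  answer to two truths that differ by 1 on all of \<open>R n\<close>.\<close>

lemma assouad_bound:
  fixes \<C> :: "('a::euclidean_space \<Rightarrow> real) set" and L m :: nat and h :: real and B :: "real \<Rightarrow> real"
  defines "bd S \<equiv> (\<lambda>x \<in> unit_cube. h * (\<Sum>n\<in>S. grid_bump B L n x))"
  assumes B: "plateau B" and L: "L \<ge> 1" and h: "0 < h" "h \<le> 1"
    and cls: "\<And>S. S \<subseteq> grid_index L \<Longrightarrow> bd S \<in> \<C>"
    and meas: "\<And>S. S \<subseteq> grid_index L \<Longrightarrow> bd S \<in> borel_measurable (restrict_space borel unit_cube)"
    and m: "real m * (h / real L ^ DIM('a)) \<le> 1/2"
  shows "ennreal (h / (8 * 4 ^ DIM('a))) \<le> minimax_error (horizon_class \<C>) m"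
  unfolding minimax_error_def
proof (rule INF_greatest)
  fix A :: "(nat \<Rightarrow> ('a \<times> real) \<times> real) \<Rightarrow> 'a \<times> real \<Rightarrow> real"
  assume A: "A \<in> estimators m"
  let ?k = "DIM('a)"
  let ?G = "grid_index L :: ('a \<Rightarrow> nat) set"
  let ?P = "PiM {1..m} (\<lambda>_. cube_measure :: ('a \<times> real) measure)"
  define N where "N = card ?G"
  have N: "real N = real L ^ ?k" by (simp add: N_def card_grid_index)
  have N1: "N \<ge> 1" unfolding N_def card_grid_index using L by simp
  \<comment> \<open>\<open>U n\<close> is the column over the whole cell, where alone bump
    \<open>n\<close> can change a label; \<open>R n\<close> is the part over the plateau, a fraction
    4^(-k) of it, where it does. The measure of \<open>R n\<close> is \<open>v\<close>.\<close>
  define U where "U n = grid_box L h n 0 1" for n :: "'a \<Rightarrow> nat"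
  define R where "R n = grid_box L h n (3/8) (5/8)" for n :: "'a \<Rightarrow> nat"
  define v where "v = h / (4 ^ ?k * N)"
  have v: "v > 0" unfolding v_def using h N1 by simp
  have Usub: "U n \<subseteq> unit_cube" and Rsub: "R n \<subseteq> unit_cube" if n: "n \<in> ?G" for n
  proof -
    have "0 \<le> fst x \<bullet> b \<and> fst x \<bullet> b \<le> 1"
      if "b \<in> Basis" "real (n b) \<le> L * (fst x \<bullet> b)" "L * (fst x \<bullet> b) \<le> real (n b) + 1" for x :: "'a \<times> real" and b
    proof -
      have "n b + 1 \<le> L" using n that by (auto simp: grid_index_def PiE_def Pi_def Suc_le_eq)
      then have "real (n b) + 1 \<le> L" by linarith
      with that have "0 \<le> L * (fst x \<bullet> b)" "L * (fst x \<bullet> b) \<le> L * 1" by linarith+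
      then show ?thesis using L by (simp add: zero_le_mult_iff mult_le_cancel_left_pos del: mult_1_right)
    qed
    then show "U n \<subseteq> unit_cube" using h L
      by (force simp: U_def mem_grid_box mem_unit_cube_prod mem_unit_cube)
    moreover have "R n \<subseteq> U n" using L unfolding R_def U_def by (force simp: mem_grid_box)
    ultimately show "R n \<subseteq> unit_cube" by blast
  qed
  have Ucube: "U n \<in> sets cube_measure" and Rcube: "R n \<in> sets cube_measure" if "n \<in> ?G" for n
    using Usub[OF that] Rsub[OF that] by (auto intro!: in_sets_cube_measure simp: U_def R_def grid_box_sets)
  have Umeas: "measure cube_measure (U n) \<le> h / real L ^ ?k" if "n \<in> ?G" for n
    using Usub[OF that] measure_grid_box[OF L, of 0 1 h n] h
    by (simp add: measure_def emeasure_cube_measure U_def power_one_over power_divide)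
  have Rmeas: "(LINT x|cube_measure. indicator (R n) x * c) = v * c" if "n \<in> ?G" for n and c :: real
  proof -
    have "measure lborel (R n) = v"
      unfolding R_def v_def using measure_grid_box[OF L, of "3/8" "5/8" h n] h
      by (simp add: N power_divide field_simps)
    then show ?thesis
      using Rsub[OF that] by (subst integral_cube_indicator) (auto simp: R_def grid_box_sets)
  qed
  have bump1: "grid_bump B L n (fst x) = 1" if "x \<in> R n" for n x
  proof (rule grid_bump_eq_1[OF B])
    fix b :: 'a assume "b \<in> Basis"
    with that L have "real (n b) + 3/8 \<le> L * (fst x \<bullet> b)" "L * (fst x \<bullet> b) \<le> real (n b) + 5/8"
      by (auto simp: R_def mem_grid_box)
    then show "\<bar>2 * (real L * (fst x \<bullet> b) - real (n b)) - 1\<bar> \<le> 1/4"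
      unfolding abs_le_iff right_diff_distrib by linarith
  qed
  have Rdisj: "n = n'" if "n \<in> ?G" "n' \<in> ?G" "x \<in> R n" "x \<in> R n'" for n n' x
    using that grid_bump_disjoint[OF B that(1,2), of "fst x"] bump1 by simp
  define hS where "hS S = horizon (bd S)" for S
  have hS_meas: "hS S \<in> borel_measurable cube_measure" and hS_01: "\<And>x. x \<in> unit_cube \<Longrightarrow> hS S x \<in> {0, 1}" 
    and hS_L2: "hS S \<in> L2_functions cube_measure" if "S \<subseteq> ?G" for S
    using horizon_measurable[OF meas[OF that]] horizon_01 L2_functions_01 unfolding hS_def by blast+
  \<comment> \<open>Below height \<open>h\<close> a point outside \<open>U n\<close> is not under
    bump \<open>n\<close>; from height \<open>h\<close> on, every boundary in question has been
    reached.\<close>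
  have hS_same: "hS (insert n S) x = hS S x"
    if S: "S \<subseteq> ?G" "n \<in> ?G" "n \<notin> S" and x: "x \<in> unit_cube" "x \<notin> U n" for S n x
  proof -
    have fx: "fst x \<in> unit_cube" and sx: "0 \<le> snd x" using x by (auto simp: mem_unit_cube_prod)
    have finS: "finite S" by (rule finite_subset[OF S(1)]) simp
    show ?thesis
    proof (cases "snd x < h")
      case True
      have "grid_bump B L n (fst x) = 0"
      proof (rule ccontr)
        assume "grid_bump B L n (fst x) \<noteq> 0"
        from grid_bump_support[OF B this] have "x \<in> U n"
          unfolding U_def using L True sx by (auto simp: mem_grid_box less_imp_le)
        with x show False by simp
      qed
      then show ?thesis using S finS x fx by (simp add: hS_def horizon_def bd_def)
    next
      case False
      have "bd T (fst x) \<le> snd x" if "T \<subseteq> ?G" for T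
      proof -
        have "bd T (fst x) \<le> h * 1"
          unfolding bd_def using fx sum_grid_bump_le_1[OF B that] h by (simp add: mult_left_le)
        with False show ?thesis by simp
      qed
      then show ?thesis using S x by (simp add: hS_def horizon_def)
    qed
  qed
  \<comment> \<open>Over the plateau of cell \<open>n\<close> the other bumps vanish, so the
    boundary is 0 without \<open>n\<close> and \<open>h\<close> with it.\<close>
  have hS_out: "hS S x = 1" and hS_in: "hS (insert n S) x = 0"
    if S: "S \<subseteq> ?G" "n \<in> ?G" "n \<notin> S" and x: "x \<in> R n" for S n x
  proof -
    have xc: "x \<in> unit_cube" using Rsub[OF S(2)] x by blast
    then have fx: "fst x \<in> unit_cube" by (simp add: mem_unit_cube_prod)
    have sx: "0 \<le> snd x" "snd x < h" using x L by (auto simp: R_def mem_grid_box)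
    have finS: "finite S" by (rule finite_subset[OF S(1)]) simp
    have "grid_bump B L n' (fst x) = 0" if "n' \<in> S" for n'
      using grid_bump_disjoint[OF B, of n' L n "fst x"] bump1[OF x] that S by auto
    then have "(\<Sum>n'\<in>S. grid_bump B L n' (fst x)) = 0" by simp
    then show "hS S x = 1" "hS (insert n S) x = 0"
      using S finS fx xc sx bump1[OF x] by (simp_all add: hS_def horizon_def bd_def)
  qed
  define D where "D S X = (L2_norm cube_measure (\<lambda>y. A (labelled_sample m (hS S) X) y - hS S y))\<^sup>2" for S X
  have D_meas: "(\<lambda>X. ennreal (D S X)) \<in> borel_measurable ?P" if "S \<subseteq> ?G" for S
    unfolding D_def using sq_error_measurable[OF A hS_meas[OF that] hS_01[OF that]] by measurable
  have E: "expected_sq_error m A (hS S) = (\<integral>\<^sup>+ X. ennreal (D S X) \<partial>?P)" for S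
    by (simp add: expected_sq_error_def D_def labelled_sample_def)
  have avoid01: "(\<Prod>i\<in>{1..m}. indicator (unit_cube - U n) (X i)) = (if \<forall>i\<in>{1..m}. X i \<in> unit_cube - U n then 1 else 0 :: ennreal)" for n X
  proof (cases "\<forall>i\<in>{1..m}. X i \<in> unit_cube - U n")
    case False
    then obtain i where "i \<in> {1..m}" "indicator (unit_cube - U n) (X i) = (0 :: ennreal)" by (auto simp: indicator_def)
    then have "\<exists>i\<in>{1..m}. indicator (unit_cube - U n) (X i) = (0 :: ennreal)" by blast
    then show ?thesis unfolding if_not_P[OF False] by (intro prod_zero) auto
  qed (auto intro!: prod.neutral)
  \<comment> \<open>For a fixed sample the squared error is localised to the disjoint sets
    \<open>R n\<close>. The two sums are then exchanged, and in each direction \<open>n\<close>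
    whose column the sample misses, 2^(N - 1) pairs contribute v/2 each.\<close>
  have pointwise: "(\<Sum>n\<in>?G. ennreal (2 ^ (N - 1) * (v / 2)) * (\<Prod>i\<in>{1..m}. indicator (unit_cube - U n) (X i))) \<le> (\<Sum>S\<in>Pow ?G. ennreal (D S X))"
    if X: "X \<in> space ?P" for X
  proof -
    define g where "g S = A (labelled_sample m (hS S) X)" for S
    have Xc: "X i \<in> unit_cube" if "i \<in> {1..m}" for i
      using X that by (auto simp: space_PiM)
    have gL2: "g S \<in> L2_functions cube_measure" if "S \<subseteq> ?G" for S
      unfolding g_def using measurable_space[OF labelled_sample_measurable[OF hS_meas[OF that] hS_01[OF that]] X]
      by (intro estimator_in_L2[OF A])
    have dL2: "integrable cube_measure (\<lambda>y. (g S y - hS S y)\<^sup>2)" if "S \<subseteq> ?G" for S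
      using L2_functions_diff[OF gL2[OF that] hS_L2[OF that]] by (simp add: L2_functions_def)
    define I where "I S n = (LINT y|cube_measure. indicator (R n) y * (g S y - hS S y)\<^sup>2)" for S n
    have Iint: "integrable cube_measure (\<lambda>y. indicator (R n) y * (g S y - hS S y)\<^sup>2)" if "S \<subseteq> ?G" "n \<in> ?G" for S n
      using integrable_real_mult_indicator[OF Rcube[OF that(2)] dL2[OF that(1)]] by (simp add: mult.commute)
    have Inn: "0 \<le> I S n" for S n unfolding I_def by simp
    have DI: "(\<Sum>n\<in>?G. I S n) \<le> D S X" if S: "S \<subseteq> ?G" for S
    proof -
      have "(\<Sum>n\<in>?G. I S n) = (LINT y|cube_measure. (\<Sum>n\<in>?G. indicator (R n) y * (g S y - hS S y)\<^sup>2))"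
        unfolding I_def using Iint[OF S] by (subst Bochner_Integration.integral_sum) auto
      also have "\<dots> \<le> (LINT y|cube_measure. (g S y - hS S y)\<^sup>2)"
      proof (rule integral_mono)
        show "integrable cube_measure (\<lambda>y. \<Sum>n\<in>?G. indicator (R n) y * (g S y - hS S y)\<^sup>2)"
          using Iint[OF S] by (intro Bochner_Integration.integrable_sum)
        show "(\<Sum>n\<in>?G. indicator (R n) y * (g S y - hS S y)\<^sup>2) \<le> (g S y - hS S y)\<^sup>2" for y
        proof (cases "\<exists>n\<in>?G. y \<in> R n")
          case True
          then obtain n where n: "n \<in> ?G" "y \<in> R n" by blast
          then have eq: "(\<Sum>n\<in>?G. indicator (R n) y * (g S y - hS S y)\<^sup>2) = (\<Sum>n\<in>{n}. indicator (R n) y * (g S y - hS S y)\<^sup>2)"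
          proof (intro sum.mono_neutral_right ballI)
            fix i assume i: "i \<in> ?G - {n}"
            then have "y \<notin> R i" using Rdisj[of i n y] n by blast
            then show "indicator (R i) y * (g S y - hS S y)\<^sup>2 = 0" by simp
          qed (use n in auto)
          show ?thesis unfolding eq using n by simp
        qed (simp add: sum_nonneg indicator_def sum.neutral)
      qed (rule dL2[OF S])
      also have "\<dots> = D S X"
        by (simp add: D_def g_def L2_norm_def)
      finally show ?thesis .
    qed
    have pair: "v / 2 \<le> I S n + I (insert n S) n"
      if S: "S \<subseteq> ?G" "n \<in> ?G" "n \<notin> S" and av: "\<forall>i\<in>{1..m}. X i \<in> unit_cube - U n" for S n
    proof -
      have S': "insert n S \<subseteq> ?G" using S by simp
      have "labelled_sample m (hS (insert n S)) X = labelled_sample m (hS S) X"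
        unfolding labelled_sample_def using av hS_same[OF S] by (intro restrict_ext) auto
      then have g_eq: "g (insert n S) = g S" by (simp add: g_def)
      have "v / 2 = (LINT y|cube_measure. indicator (R n) y * (1/2))"
        using Rmeas[OF S(2), of "1/2"] by simp
      also have "\<dots> \<le> (LINT y|cube_measure. indicator (R n) y * (g S y - hS S y)\<^sup>2
          + indicator (R n) y * (g (insert n S) y - hS (insert n S) y)\<^sup>2)"
      proof (rule integral_mono)
        show "integrable cube_measure (\<lambda>y. indicator (R n) y * (1/2) :: real)"
          using Rcube[OF S(2)] by (intro integrable_mult_left) (auto simp: cube.emeasure_eq_measure)
        fix y
        show "indicator (R n) y * (1/2) \<le> indicator (R n) y * (g S y - hS S y)\<^sup>2
          + indicator (R n) y * (g (insert n S) y - hS (insert n S) y)\<^sup>2"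
        proof (cases "y \<in> R n")
          case True
          \<comment> \<open>With the two labels 1 and 0 this is (g - 1)^2 + g^2 >= 1/2: no common
            answer is close to both.\<close>
          have "0 \<le> 2 * (g S y - 1/2)\<^sup>2" by simp
          then show ?thesis using True hS_out[OF S True] hS_in[OF S True]
            by (simp add: g_eq power2_eq_square algebra_simps)
        qed simp
      qed (use Iint[OF S(1,2)] Iint[OF S' S(2)] in auto)
      also have "\<dots> = I S n + I (insert n S) n"
        unfolding I_def by (rule Bochner_Integration.integral_add[OF Iint[OF S(1,2)] Iint[OF S' S(2)]])
      finally show ?thesis .
    qed
    have col: "2 ^ (N - 1) * (v / 2) * (if \<forall>i\<in>{1..m}. X i \<in> unit_cube - U n then 1 else 0) \<le> (\<Sum>S\<in>Pow ?G. I S n)"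
      if n: "n \<in> ?G" for n
    proof (cases "\<forall>i\<in>{1..m}. X i \<in> unit_cube - U n")
      case True
      have "(\<Sum>S\<in>Pow (?G - {n}). v / 2) \<le> (\<Sum>S\<in>Pow (?G - {n}). I S n + I (insert n S) n)"
        using pair[OF _ n _ True] by (intro sum_mono) blast
      also have "\<dots> = (\<Sum>S\<in>Pow ?G. I S n)" by (rule sum_Pow_split[symmetric]) (use n in auto)
      also have "(\<Sum>S\<in>Pow (?G - {n}). v / 2) = 2 ^ (N - 1) * (v / 2)"
        using n by (simp add: card_Pow N_def)
      finally show ?thesis using True by simp
    next
      case False
      show ?thesis unfolding if_not_P[OF False] by (simp add: sum_nonneg Inn)
    qed
    have "(\<Sum>n\<in>?G. ennreal (2 ^ (N - 1) * (v / 2)) * (\<Prod>i\<in>{1..m}. indicator (unit_cube - U n) (X i)))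
        = (\<Sum>n\<in>?G. ennreal (2 ^ (N - 1) * (v / 2) * (if \<forall>i\<in>{1..m}. X i \<in> unit_cube - U n then 1 else 0)))"
      unfolding avoid01 by (intro sum.cong) auto
    also have "\<dots> \<le> (\<Sum>n\<in>?G. ennreal (\<Sum>S\<in>Pow ?G. I S n))"
      using col by (intro sum_mono ennreal_leI)
    also have "\<dots> = ennreal (\<Sum>n\<in>?G. \<Sum>S\<in>Pow ?G. I S n)"
      by (rule sum_ennreal) (simp add: sum_nonneg Inn)
    also have "(\<Sum>n\<in>?G. \<Sum>S\<in>Pow ?G. I S n) = (\<Sum>S\<in>Pow ?G. \<Sum>n\<in>?G. I S n)" by (rule sum.swap)
    also have "ennreal \<dots> \<le> ennreal (\<Sum>S\<in>Pow ?G. D S X)"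
      using DI by (intro ennreal_leI sum_mono) auto
    also have "\<dots> = (\<Sum>S\<in>Pow ?G. ennreal (D S X))"
      by (rule sum_ennreal[symmetric]) (simp add: D_def)
    finally show ?thesis .
  qed
  \<comment> \<open>This is N v / 8. The three halves come from the pairing of subsets, from v/2 per
    pair and from the probability of missing the column.\<close>
  define c where "c = h / (8 * 4 ^ ?k)"
  have c: "2 ^ N * c = real N * (2 ^ (N - 1) * (v / 2) * (1/2))"
  proof -
    have "(2::real) ^ N = 2 * 2 ^ (N - 1)" using N1 by (metis Suc_diff_1 less_eq_Suc_le One_nat_def power_Suc)
    then show ?thesis using N1 by (simp add: c_def v_def field_simps)
  qed
  let ?s = "SUP g\<in>horizon_class \<C>. expected_sq_error m A g"
  have "ennreal (2 ^ N) * ennreal c = ennreal (real N * (2 ^ (N - 1) * (v / 2) * (1/2)))"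
    unfolding c[symmetric] using h by (intro ennreal_mult[symmetric]) (auto simp: c_def)
  also have "\<dots> = (\<Sum>n\<in>?G. ennreal (2 ^ (N - 1) * (v / 2)) * ennreal (1/2))"
    unfolding sum_constant N_def[symmetric] ennreal_of_nat_eq_real_of_nat
    using v by (subst ennreal_mult, simp, simp, subst ennreal_mult) auto
  also have "\<dots> \<le> (\<Sum>n\<in>?G. ennreal (2 ^ (N - 1) * (v / 2)) *
      (\<integral>\<^sup>+ X. (\<Prod>i\<in>{1..m}. indicator (unit_cube - U n) (X i)) \<partial>?P))"
  proof (intro sum_mono mult_left_mono nn_integral_avoid)
    have "1 \<le> real L ^ ?k" using L by (intro one_le_power) simp
    then show "h / real L ^ ?k \<le> 1" using h by (simp add: divide_le_eq)
  qed (use Ucube Umeas m in auto)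
  also have "\<dots> = (\<integral>\<^sup>+ X. (\<Sum>n\<in>?G. ennreal (2 ^ (N - 1) * (v / 2)) * (\<Prod>i\<in>{1..m}. indicator (unit_cube - U n) (X i))) \<partial>?P)"
  proof -
    have mm: "(\<lambda>X. \<Prod>i\<in>{1..m}. indicator (unit_cube - U n) (X i) :: ennreal) \<in> borel_measurable ?P" if "n \<in> ?G" for n
    proof -
      have [measurable]: "unit_cube - U n \<in> sets cube_measure"
        using sets.compl_sets[OF Ucube[OF that]] by simp
      show ?thesis by measurable
    qed
    show ?thesis
      using mm by (subst nn_integral_sum) (auto simp: nn_integral_cmult intro!: sum.cong)
  qed
  also have "\<dots> \<le> (\<integral>\<^sup>+ X. (\<Sum>S\<in>Pow ?G. ennreal (D S X)) \<partial>?P)"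
    by (intro nn_integral_mono pointwise)
  also have "\<dots> = (\<Sum>S\<in>Pow ?G. expected_sq_error m A (hS S))"
    unfolding E using D_meas by (intro nn_integral_sum) auto
  also have "\<dots> \<le> (\<Sum>S\<in>Pow ?G. ?s)"
    using cls by (intro sum_mono SUP_upper) (auto simp: hS_def horizon_class_def)
  also have "\<dots> = ennreal (2 ^ N) * ?s"
    by (simp add: card_Pow N_def ennreal_of_nat_eq_real_of_nat)
  finally show "ennreal (h / (8 * 4 ^ ?k)) \<le> ?s"
    unfolding c_def by (subst (asm) ennreal_mult_le_mult_iff) auto
qed

lemma minimax_error_lower:
  fixes C :: real
  assumes "C > 0"
  shows "\<exists>c>0. \<forall>m::nat. m \<ge> 1 \<longrightarrow>
    ennreal (c * real m powr (- ((real DIM('a) + 2) / (3 * real DIM('a) + 2))))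
      \<le> minimax_error (horizon_class (barron_class C :: ('a::euclidean_space \<Rightarrow> real) set)) m"
proof -
  let ?R = "\<lambda>m. minimax_error (horizon_class (barron_class C :: ('a \<Rightarrow> real) set)) m"
  define k where "k = real DIM('a)"
  have k: "k \<ge> 1" using DIM_ge_Suc0[where 'a = 'a] by (simp add: k_def)
  obtain \<kappa> B where \<kappa>: "\<kappa> > 0" and B: "plateau B"
    and bar: "\<And>L S h. L \<ge> 1 \<Longrightarrow> S \<subseteq> grid_index L \<Longrightarrow> 0 \<le> h \<Longrightarrow> h \<le> 1 \<Longrightarrow>
      h * real L * sqrt (real L ^ DIM('a)) \<le> \<kappa> \<Longrightarrow>
      (\<lambda>x \<in> unit_cube. h * (\<Sum>n\<in>S. grid_bump B L n x)) \<in> (barron_class C :: ('a \<Rightarrow> real) set)"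
    using spline_sums_in_barron_class[OF assms, where 'a = 'a] by blast
  define \<tau> where "\<tau> = min \<kappa> 1"
  have \<tau>: "0 < \<tau>" "\<tau> \<le> 1" "\<tau> \<le> \<kappa>" using \<kappa> by (auto simp: \<tau>_def)
  define c where "c = \<tau> * 2 powr (- (k + 2) / 2) * 2 powr (- ((k + 2) / (3 * k + 2))) / (8 * 4 ^ DIM('a))"
  have "ennreal (c * real m powr (- ((k + 2) / (3 * k + 2)))) \<le> ?R m"
    if m: "m \<ge> 1" for m :: nat
  proof -
    \<comment> \<open>Solves z^((3k+2)/2) = 2m, the borderline of the condition m h / L^k <= 1/2
      when h is at most L^(-(k+2)/2).\<close>
    define z where "z = (2 * real m) powr (2 / (3 * k + 2))"
    have z1: "z \<ge> 1" unfolding z_def using m k by (intro ge_one_powr_ge_zero) auto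
    define L where "L = nat \<lceil>z\<rceil>"
    have L: "L \<ge> 1" "z \<le> real L" "real L \<le> 2 * z" using z1 unfolding L_def by linarith+
    \<comment> \<open>With this height h L sqrt(L^k) is exactly \<tau>; capping \<tau> at 1 also
      gives h <= 1.\<close>
    define h where "h = \<tau> * real L powr (- (k + 2) / 2)"
    have hpos: "h > 0" unfolding h_def using \<tau> L by simp
    have "real L powr (- (k + 2) / 2) \<le> real L powr 0" using L k by (intro powr_mono) auto
    then have h1: "h \<le> 1" unfolding h_def using \<tau> L mult_mono[of \<tau> 1 "real L powr (- (k + 2) / 2)" 1] by simp
    have Lk: "real L ^ DIM('a) = real L powr k" using L by (simp add: k_def powr_realpow)
    have hL: "h * real L * sqrt (real L ^ DIM('a)) \<le> \<kappa>"
    proof -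
      have "h * real L * sqrt (real L ^ DIM('a)) = \<tau> * (real L powr (- (k + 2) / 2) * real L powr 1 * real L powr (k / 2))"
        using L unfolding h_def Lk by (simp add: powr_half_sqrt[symmetric] powr_powr)
      also have "real L powr (- (k + 2) / 2) * real L powr 1 * real L powr (k / 2) = real L powr 0"
        unfolding powr_add[symmetric] by (simp add: field_simps)
      finally show ?thesis using \<tau> L by simp
    qed
    have mh: "real m * (h / real L ^ DIM('a)) \<le> 1 / 2"
    proof -
      have "2 * real m = z powr ((3 * k + 2) / 2)"
        unfolding z_def powr_powr using m k by (simp add: field_simps)
      also have "\<dots> \<le> real L powr ((3 * k + 2) / 2)" using L z1 k by (intro powr_mono2) auto
      finally have 1: "2 * real m \<le> real L powr ((3 * k + 2) / 2)" .
      have "h / real L ^ DIM('a) = \<tau> * (real L powr (- (k + 2) / 2) / real L powr k)"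
        unfolding h_def Lk by simp
      also have "real L powr (- (k + 2) / 2) / real L powr k = real L powr (- ((3 * k + 2) / 2))"
      proof -
        have "- (k + 2) / 2 - k = - ((3 * k + 2) / 2)" by (simp add: field_simps)
        then show ?thesis unfolding powr_diff[symmetric] by (simp only:)
      qed
      also have "\<tau> * real L powr (- ((3 * k + 2) / 2)) \<le> 1 * real L powr (- ((3 * k + 2) / 2))"
        using \<tau> by (intro mult_right_mono) auto
      finally have "real m * (h / real L ^ DIM('a)) \<le> real m * real L powr (- ((3 * k + 2) / 2))"
        by (intro mult_left_mono) auto
      also have "\<dots> = real m / real L powr ((3 * k + 2) / 2)" by (simp only: powr_minus divide_inverse)
      also have "\<dots> \<le> 1 / 2" using 1 L by (simp add: divide_le_eq)
      finally show ?thesis .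
    qed
    have "c * real m powr (- ((k + 2) / (3 * k + 2))) = \<tau> * (2 * z) powr (- (k + 2) / 2) / (8 * 4 ^ DIM('a))"
    proof -
      have "z powr (- (k + 2) / 2) = (2 * real m) powr (- ((k + 2) / (3 * k + 2)))"
      proof -
        have "2 / (3 * k + 2) * (- (k + 2) / 2) = - ((k + 2) / (3 * k + 2))" using k by (simp add: divide_simps, simp add: algebra_simps)
        then show ?thesis unfolding z_def powr_powr by (simp only:)
      qed
      then have "(2 * z) powr (- (k + 2) / 2) = 2 powr (- (k + 2) / 2) * (2 powr (- ((k + 2) / (3 * k + 2))) * real m powr (- ((k + 2) / (3 * k + 2))))"
        using z1 by (simp add: powr_mult)
      then show ?thesis unfolding c_def by simp
    qed
    also have "\<dots> \<le> h / (8 * 4 ^ DIM('a))"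
      unfolding h_def using \<tau> L z1 k by (intro divide_right_mono mult_left_mono powr_mono2') auto
    finally have "ennreal (c * real m powr (- ((k + 2) / (3 * k + 2)))) \<le> ennreal (h / (8 * 4 ^ DIM('a)))"
      by (rule ennreal_leI)
    also have "\<dots> \<le> ?R m"
    proof (rule assouad_bound[OF B L(1) hpos h1 _ _ mh])
      show 1: "(\<lambda>x\<in>unit_cube. h * (\<Sum>n\<in>S. grid_bump B L n x)) \<in> (barron_class C :: ('a \<Rightarrow> real) set)"
        if "S \<subseteq> grid_index L" for S
        using bar[OF L(1) that _ h1 hL] hpos by simp
      show "(\<lambda>x\<in>unit_cube. h * (\<Sum>n\<in>S. grid_bump B L n x)) \<in> borel_measurable (restrict_space borel (unit_cube :: 'a set))"
        if "S \<subseteq> grid_index L" for S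
        using 1[OF that] by (rule barron_class_measurable)
    qed
    finally show ?thesis .
  qed
  moreover have "c > 0" unfolding c_def using \<tau> by simp
  ultimately show ?thesis unfolding k_def by blast
qed

section \<open>Partition of the frequency space\<close>

lemma norm_iexp_minus_1: "norm (iexp a - 1) \<le> \<bar>a\<bar>"
  using iexp_approx1[of a 0] by simp

lemma norm_iexp_diff: "norm (iexp a - iexp b) \<le> \<bar>a - b\<bar>"
proof -
  have "iexp a - iexp b = iexp b * (iexp (a - b) - 1)"
    by (simp add: right_diff_distrib exp_diff)
  then show ?thesis using norm_iexp_minus_1[of "a - b"] by (simp add: norm_mult)
qed

lemma norm_iexp_taylor: "norm (iexp a - 1 - \<i> * a) \<le> a\<^sup>2"
proof -
  have "norm (iexp a - (1 + \<i> * a)) \<le> a\<^sup>2 / 2"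
    using iexp_approx1[of a 1] by (simp add: numeral_2_eq_2)
  also have "\<dots> \<le> a\<^sup>2" by simp
  finally show ?thesis by (simp only: diff_diff_eq)
qed

text \<open>With the integrable density |\<xi>| F(\<xi>), a Barron function is a constant plus an
  integral of waves. Unlike the density F, this normalisation keeps everything bounded near the
  origin; at \<xi> = 0 division by zero gives the wave 0.\<close>

definition wave :: "'a::euclidean_space \<Rightarrow> 'a \<Rightarrow> complex" where
  "wave \<xi> x = (iexp (x \<bullet> \<xi>) - 1) / norm \<xi>"

lemma norm_wave_le: "norm (wave \<xi> x) \<le> norm x"
proof (cases "\<xi> = 0")
  case False
  have "norm (iexp (x \<bullet> \<xi>) - 1) \<le> norm x * norm \<xi>"
    using norm_iexp_minus_1[of "x \<bullet> \<xi>"] Cauchy_Schwarz_ineq2[of x \<xi>] by linarith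
  then show ?thesis using False by (simp add: wave_def norm_divide divide_le_eq)
qed (simp add: wave_def)

lemma norm_wave_le_inverse: "norm (wave \<xi> x) \<le> 2 / norm \<xi>"
proof -
  have "norm (iexp (x \<bullet> \<xi>) - 1) \<le> 2"
    using norm_triangle_ineq4[of "iexp (x \<bullet> \<xi>)" 1] by simp
  then show ?thesis by (simp add: wave_def norm_divide divide_right_mono)
qed

text \<open>Changing the exponential and changing the normaliser each cost |x| |\<xi> - \<xi>'| /
  |\<xi>|. Only relative distance counts, which is why the side of a cell is proportional to the
  size of its frequencies.\<close>

lemma wave_lipschitz:
  assumes "\<xi> \<noteq> 0" "\<xi>' \<noteq> 0"
  shows "norm (wave \<xi> x - wave \<xi>' x) \<le> 2 * norm x * norm (\<xi> - \<xi>') / norm \<xi>"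
proof -
  let ?r = "norm \<xi>" and ?r' = "norm \<xi>'"
  have r: "?r > 0" "?r' > 0" using assms by auto
  have eq: "wave \<xi> x - wave \<xi>' x = (iexp (x \<bullet> \<xi>) - iexp (x \<bullet> \<xi>')) / ?r + wave \<xi>' x * of_real ((?r' - ?r) / ?r)"
    using assms by (simp add: wave_def field_simps)
  have "norm (iexp (x \<bullet> \<xi>) - iexp (x \<bullet> \<xi>')) \<le> norm x * norm (\<xi> - \<xi>')"
    using norm_iexp_diff[of "x \<bullet> \<xi>" "x \<bullet> \<xi>'"] Cauchy_Schwarz_ineq2[of x "\<xi> - \<xi>'"]
    by (simp add: inner_diff_right)
  then have 1: "norm ((iexp (x \<bullet> \<xi>) - iexp (x \<bullet> \<xi>')) / ?r) \<le> norm x * norm (\<xi> - \<xi>') / ?r"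
    by (simp add: norm_divide divide_right_mono)
  have "norm (wave \<xi>' x) * (\<bar>?r' - ?r\<bar> / ?r) \<le> norm x * (norm (\<xi> - \<xi>') / ?r)"
    using norm_wave_le[of \<xi>' x] norm_triangle_ineq3[of \<xi>' \<xi>] r
    by (intro mult_mono divide_right_mono) (auto simp: norm_minus_commute)
  then have 2: "norm (wave \<xi>' x * of_real ((?r' - ?r) / ?r)) \<le> norm x * norm (\<xi> - \<xi>') / ?r"
    using r by (simp only: norm_mult norm_of_real abs_divide abs_norm_cancel times_divide_eq_right)
  have "2 * norm x * norm (\<xi> - \<xi>') / ?r = norm x * norm (\<xi> - \<xi>') / ?r + norm x * norm (\<xi> - \<xi>') / ?r"
    using r by (simp add: field_simps)
  then show ?thesis unfolding eq using norm_triangle_mono[OF 1 2] by simp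
qed

text \<open>Near the origin the wave tends to i <x, \<xi>/|\<xi>|>, a function of the direction
  alone; what remains is the second-order Taylor term divided by |\<xi>|.\<close>

lemma wave_small:
  assumes "\<xi> \<noteq> 0"
  shows "norm (wave \<xi> x - \<i> * (x \<bullet> (\<xi> /\<^sub>R norm \<xi>))) \<le> (norm x)\<^sup>2 * norm \<xi>"
proof -
  have "wave \<xi> x - \<i> * (x \<bullet> (\<xi> /\<^sub>R norm \<xi>)) = (iexp (x \<bullet> \<xi>) - 1 - \<i> * (x \<bullet> \<xi>)) / norm \<xi>"
    using assms by (simp add: wave_def field_simps)
  then have "norm (wave \<xi> x - \<i> * (x \<bullet> (\<xi> /\<^sub>R norm \<xi>))) \<le> (x \<bullet> \<xi>)\<^sup>2 / norm \<xi>"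
    using norm_iexp_taylor[of "x \<bullet> \<xi>"] by (simp add: norm_divide divide_right_mono)
  also have "(x \<bullet> \<xi>)\<^sup>2 \<le> (norm x)\<^sup>2 * (norm \<xi>)\<^sup>2"
    using power_mono[OF Cauchy_Schwarz_ineq2[of x \<xi>], of 2] by (simp add: power_mult_distrib)
  then have "(x \<bullet> \<xi>)\<^sup>2 / norm \<xi> \<le> (norm x)\<^sup>2 * (norm \<xi>)\<^sup>2 / norm \<xi>"
    by (rule divide_right_mono) simp
  finally show ?thesis using assms by (simp add: power2_eq_square)
qed

text \<open>Frequencies are grouped by dyadic scale and then by cubes of side \<open>1/M\<close> relative to that
  scale. At very low frequencies only the direction matters, at very high ones nothing does.\<close>

type_synonym 'a freq_index = "int \<times> ('a \<Rightarrow> int)"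

text \<open>The values -J - 1 and J mark the two outer ranges. In between the floor lies in -J..J-1,
  so the index reveals the range.\<close>

definition freq_scale :: "nat \<Rightarrow> 'a::euclidean_space \<Rightarrow> int" where
  "freq_scale J \<xi> = (if norm \<xi> < 2 powr - real J then - int J - 1
     else if norm \<xi> \<ge> 2 powr real J then int J else \<lfloor>log 2 (norm \<xi>)\<rfloor>)"

text \<open>At low frequencies the unit is the norm itself, so the cubes subdivide the directions
  \<xi>/|\<xi>|. Otherwise it is the largest power of two not above the norm.\<close>

definition freq_unit :: "nat \<Rightarrow> 'a::euclidean_space \<Rightarrow> real" where
  "freq_unit J \<xi> = (if norm \<xi> < 2 powr - real J then norm \<xi> else 2 powr real_of_int \<lfloor>log 2 (norm \<xi>)\<rfloor>)"

definition freq_cell :: "nat \<Rightarrow> nat \<Rightarrow> 'a::euclidean_space \<Rightarrow> int \<times> ('a \<Rightarrow> int)" where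
  "freq_cell J M \<xi> = (freq_scale J \<xi>, \<lambda>b\<in>Basis. if norm \<xi> \<ge> 2 powr real J then 0 else \<lfloor>real M * (\<xi> \<bullet> b) / freq_unit J \<xi>\<rfloor>)"

text \<open>Coordinates range over -2M..2M because a frequency is at most twice its unit. The number
  of scales is linear in J and enters the cell count as a single factor.\<close>

definition freq_cells :: "nat \<Rightarrow> nat \<Rightarrow> ('a::euclidean_space freq_index) set" where
  "freq_cells J M = {- int J - 1..int J} \<times> (Basis \<rightarrow>\<^sub>E {- 2 * int M..2 * int M})"

lemma finite_freq_cells [simp]: "finite (freq_cells J M)"
  unfolding freq_cells_def by (intro finite_cartesian_product finite_PiE) auto

lemma card_freq_cells: "card (freq_cells J M :: ('a::euclidean_space freq_index) set) = (2 * J + 2) * (4 * M + 1) ^ DIM('a)"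
proof -
  have "nat (int J - (- int J - 1) + 1) = 2 * J + 2" by simp
  moreover have "nat (2 * int M - (- 2 * int M) + 1) = 4 * M + 1" by simp
  ultimately show ?thesis
    unfolding freq_cells_def card_cartesian_product card_PiE[OF finite_Basis] card_atLeastAtMost_int
    by (simp add: nat_add_distrib)
qed

lemma freq_unit_bounds:
  assumes "\<not> norm \<xi> < 2 powr - real J"
  shows "freq_unit J \<xi> \<le> norm \<xi>" "norm \<xi> < 2 * freq_unit J \<xi>" "freq_unit J \<xi> > 0"
proof -
  have "(0::real) < 2 powr - real J" by simp
  then have r: "norm \<xi> > 0" using assms by linarith
  let ?l = "log 2 (norm \<xi>)"
  have e: "norm \<xi> = 2 powr ?l" using r by simp
  have u: "freq_unit J \<xi> = 2 powr real_of_int \<lfloor>?l\<rfloor>" using assms by (simp add: freq_unit_def)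
  show "freq_unit J \<xi> > 0" unfolding u by simp
  show "freq_unit J \<xi> \<le> norm \<xi>" unfolding u by (subst e, rule powr_mono) auto
  have "2 powr ?l < 2 powr (real_of_int \<lfloor>?l\<rfloor> + 1)" by (intro powr_less_mono) linarith+
  then show "norm \<xi> < 2 * freq_unit J \<xi>" using e u by (simp add: powr_add)
qed

lemma freq_cell_in: "freq_cell J M \<xi> \<in> freq_cells J M"
proof -
  have sc: "- int J - 1 \<le> freq_scale J \<xi> \<and> freq_scale J \<xi> \<le> int J"
  proof (cases "norm \<xi> < 2 powr - real J \<or> norm \<xi> \<ge> 2 powr real J")
    case False
    have "(0::real) < 2 powr - real J" by simp
    then have "norm \<xi> > 0" using False by linarith
    then have "- real J \<le> log 2 (norm \<xi>)" "log 2 (norm \<xi>) < real J"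
      using False by (auto simp: le_log_iff log_less_iff)
    then show ?thesis using False by (simp add: freq_scale_def le_floor_iff floor_le_iff)
  qed (auto simp: freq_scale_def)
  have co: "\<lfloor>real M * (\<xi> \<bullet> b) / freq_unit J \<xi>\<rfloor> \<in> {- 2 * int M..2 * int M}" if b: "b \<in> Basis" for b
  proof -
    have "\<bar>\<xi> \<bullet> b\<bar> \<le> 2 * freq_unit J \<xi>"
    proof (cases "norm \<xi> < 2 powr - real J")
      case True
      then show ?thesis using Basis_le_norm[OF b, of \<xi>] by (simp add: freq_unit_def)
    next
      case False
      then show ?thesis using Basis_le_norm[OF b, of \<xi>] freq_unit_bounds[OF False] by simp
    qed
    moreover have "freq_unit J \<xi> \<ge> 0" by (simp add: freq_unit_def)
    ultimately have "\<bar>(\<xi> \<bullet> b) / freq_unit J \<xi>\<bar> \<le> 2"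
      by (simp add: divide_le_eq)
    then have "\<bar>real M * ((\<xi> \<bullet> b) / freq_unit J \<xi>)\<bar> \<le> real M * 2"
      unfolding abs_mult abs_of_nat by (rule mult_left_mono) simp
    then have "- (2 * real M) \<le> real M * (\<xi> \<bullet> b) / freq_unit J \<xi>" "real M * (\<xi> \<bullet> b) / freq_unit J \<xi> \<le> 2 * real M"
      unfolding times_divide_eq_right abs_le_iff by linarith+
    then show ?thesis by (auto simp: le_floor_iff floor_le_iff)
  qed
  show ?thesis using sc co unfolding freq_cell_def freq_cells_def by auto
qed

lemma freq_cell_measurable: "{\<xi>. freq_cell J M \<xi> = p} \<in> sets borel"
proof -
  let ?c = "\<lambda>\<xi> b. if norm \<xi> \<ge> 2 powr real J then 0 else \<lfloor>real M * (\<xi> \<bullet> b) / freq_unit J \<xi>\<rfloor>"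
  have "{\<xi>. freq_cell J M \<xi> = p} =
    {\<xi>. freq_scale J \<xi> = fst p \<and> (\<forall>b\<in>Basis. ?c \<xi> b = snd p b) \<and> snd p \<in> extensional Basis}"
  proof -
    have "restrict g Basis = z \<longleftrightarrow> (\<forall>b\<in>Basis. g b = z b) \<and> z \<in> extensional Basis" for g z :: "'a \<Rightarrow> int"
      by (metis extensionalityI restrict_apply' restrict_extensional)
    then show ?thesis by (simp add: freq_cell_def prod_eq_iff)
  qed
  also have "\<dots> \<in> sets borel"
    unfolding freq_scale_def freq_unit_def by measurable
  finally show ?thesis .
qed

text \<open>Two separate units are allowed because at low frequencies each vector is divided by its
  own norm.\<close>

lemma norm_diff_le_of_floor_eq:
  fixes \<xi> \<xi>' :: "'a::euclidean_space"
  assumes "s > 0" "s' > 0" "M \<ge> 1"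
    and eq: "\<And>b. b \<in> Basis \<Longrightarrow> \<lfloor>real M * (\<xi> \<bullet> b) / s\<rfloor> = \<lfloor>real M * (\<xi>' \<bullet> b) / s'\<rfloor>"
  shows "norm (\<xi> /\<^sub>R s - \<xi>' /\<^sub>R s') \<le> DIM('a) / M"
proof -
  have "\<bar>(\<xi> /\<^sub>R s - \<xi>' /\<^sub>R s') \<bullet> b\<bar> \<le> 1 / M" if b: "b \<in> Basis" for b
  proof -
    have "\<bar>real M * (\<xi> \<bullet> b) / s - real M * (\<xi>' \<bullet> b) / s'\<bar> \<le> 1"
      using eq[OF b] by linarith
    also have "real M * (\<xi> \<bullet> b) / s - real M * (\<xi>' \<bullet> b) / s' = real M * ((\<xi> /\<^sub>R s - \<xi>' /\<^sub>R s') \<bullet> b)"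
      by (simp add: inner_diff_left divide_inverse algebra_simps)
    finally show ?thesis using assms by (simp add: abs_mult field_simps)
  qed
  then have "(\<Sum>b\<in>Basis. \<bar>(\<xi> /\<^sub>R s - \<xi>' /\<^sub>R s') \<bullet> b\<bar>) \<le> (\<Sum>b\<in>(Basis :: 'a set). 1 / M)" by (rule sum_mono)
  then show ?thesis using norm_le_l1[of "\<xi> /\<^sub>R s - \<xi>' /\<^sub>R s'"] by simp
qed

lemma norm_unit_cube_le: "x \<in> unit_cube \<Longrightarrow> norm (x::'a::euclidean_space) \<le> DIM('a)"
proof -
  assume "x \<in> unit_cube"
  then have "(\<Sum>b\<in>Basis. \<bar>x \<bullet> b\<bar>) \<le> (\<Sum>b\<in>(Basis :: 'a set). 1)"
    by (intro sum_mono) (auto simp: mem_unit_cube)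
  then show ?thesis using norm_le_l1[of x] by simp
qed

text \<open>1/M is the relative side of a cube, 2^(-J) the error made below frequency 2^(-J) and
  above 2^J; the constant covers all ranges. The type argument carries the dimension.\<close>

definition cell_osc :: "'a::euclidean_space itself \<Rightarrow> nat \<Rightarrow> nat \<Rightarrow> real" where
  "cell_osc _ J M = 4 * (real DIM('a))\<^sup>2 * (1 / real M + 2 powr - real J)"

text \<open>At low frequencies both waves are close to their linear limits, whose directions nearly
  agree. At high ones each wave is at most 2/|\<xi>|. In between the units coincide and the
  Lipschitz bound applies.\<close>

lemma wave_cell_osc:
  fixes \<xi> \<xi>' :: "'a::euclidean_space"
  assumes nz: "\<xi> \<noteq> 0" "\<xi>' \<noteq> 0" and M: "M \<ge> 1" and J: "J \<ge> 1"
    and eq: "freq_cell J M \<xi> = freq_cell J M \<xi>'" and x: "x \<in> unit_cube"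
  shows "norm (wave \<xi> x - wave \<xi>' x) \<le> cell_osc TYPE('a) J M"
proof -
  let ?k = "real DIM('a)" and ?e = "2 powr - real J"
  have k: "?k \<ge> 1" using DIM_ge_Suc0[where 'a = 'a] by simp
  have e: "?e > 0" by simp
  have "(2::real) powr - real J < 2 powr real J" using J by (intro powr_less_mono) auto
  note small_not_large = this
  have k2: "?k \<le> ?k\<^sup>2" "1 \<le> ?k\<^sup>2" using k self_le_power[of ?k 2] one_le_power[of ?k 2] by auto
  have nn: "0 \<le> ?k\<^sup>2 * (1 / M)" "0 \<le> ?k\<^sup>2 * ?e" by simp_all
  have nx: "norm x \<le> ?k" by (rule norm_unit_cube_le[OF x])
  have sc: "freq_scale J \<xi> = freq_scale J \<xi>'" using eq by (simp add: freq_cell_def)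
  have co: "\<lfloor>real M * (\<xi> \<bullet> b) / freq_unit J \<xi>\<rfloor> = \<lfloor>real M * (\<xi>' \<bullet> b) / freq_unit J \<xi>'\<rfloor>"
    if "b \<in> Basis" "\<not> norm \<xi> \<ge> 2 powr real J" "\<not> norm \<xi>' \<ge> 2 powr real J" for b
  proof -
    have "snd (freq_cell J M \<xi>) b = snd (freq_cell J M \<xi>') b" by (simp only: eq)
    then show ?thesis using that by (simp add: freq_cell_def)
  qed
  have mid_scale: "- int J \<le> freq_scale J \<zeta> \<and> freq_scale J \<zeta> < int J"
    if "\<not> norm \<zeta> < ?e" "\<not> norm \<zeta> \<ge> 2 powr real J" for \<zeta> :: 'a
  proof -
    have "norm \<zeta> > 0" using that e by linarith
    then have "- real J \<le> log 2 (norm \<zeta>)" "log 2 (norm \<zeta>) < real J"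
      using that by (auto simp: le_log_iff log_less_iff)
    then show ?thesis using that by (simp add: freq_scale_def le_floor_iff floor_less_iff)
  qed
  \<comment> \<open>The scale index alone determines the range, so equal cells leave no mixed
    case.\<close>
  consider (small) "norm \<xi> < ?e" "norm \<xi>' < ?e" | (large) "norm \<xi> \<ge> 2 powr real J" "norm \<xi>' \<ge> 2 powr real J"
    | (mid) "\<not> norm \<xi> < ?e" "\<not> norm \<xi>' < ?e" "\<not> norm \<xi> \<ge> 2 powr real J" "\<not> norm \<xi>' \<ge> 2 powr real J"
  proof -
    have S: "freq_scale J \<zeta> = - int J - 1 \<longleftrightarrow> norm \<zeta> < ?e" for \<zeta> :: 'a
      using mid_scale[of \<zeta>] J by (cases "norm \<zeta> < ?e"; cases "norm \<zeta> \<ge> 2 powr real J") (auto simp: freq_scale_def)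
    have excl: "\<not> (norm \<zeta> < ?e \<and> 2 powr real J \<le> norm \<zeta>)" for \<zeta> :: 'a
      using small_not_large by linarith
    have Lg: "freq_scale J \<zeta> = int J \<longleftrightarrow> norm \<zeta> \<ge> 2 powr real J" for \<zeta> :: 'a
      using mid_scale[of \<zeta>] excl[of \<zeta>] by (cases "norm \<zeta> < ?e"; cases "norm \<zeta> \<ge> 2 powr real J") (auto simp: freq_scale_def)
    show ?thesis using that S[of \<xi>] S[of \<xi>'] Lg[of \<xi>] Lg[of \<xi>'] sc by (metis (full_types))
  qed
  then have "norm (wave \<xi> x - wave \<xi>' x) \<le> 4 * ?k\<^sup>2 * (1 / M) + 4 * ?k\<^sup>2 * ?e"
  proof cases
    case small
    have "norm (\<xi> /\<^sub>R norm \<xi> - \<xi>' /\<^sub>R norm \<xi>') \<le> ?k / M"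
    proof (rule norm_diff_le_of_floor_eq)
      show "\<lfloor>real M * (\<xi> \<bullet> b) / norm \<xi>\<rfloor> = \<lfloor>real M * (\<xi>' \<bullet> b) / norm \<xi>'\<rfloor>" if "b \<in> Basis" for b
        using co[OF that] small small_not_large by (simp add: freq_unit_def)
    qed (use nz M in auto)
    then have "norm x * norm (\<xi> /\<^sub>R norm \<xi> - \<xi>' /\<^sub>R norm \<xi>') \<le> ?k * (?k / M)"
      using nx by (intro mult_mono) auto
    then have d: "\<bar>x \<bullet> (\<xi> /\<^sub>R norm \<xi>) - x \<bullet> (\<xi>' /\<^sub>R norm \<xi>')\<bar> \<le> ?k\<^sup>2 * (1 / M)"
      using Cauchy_Schwarz_ineq2[of x "\<xi> /\<^sub>R norm \<xi> - \<xi>' /\<^sub>R norm \<xi>'"]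
      unfolding inner_diff_right by (simp add: power2_eq_square)
    have w: "norm (wave \<zeta> x - \<i> * (x \<bullet> (\<zeta> /\<^sub>R norm \<zeta>))) \<le> ?k\<^sup>2 * ?e" if "\<zeta> \<noteq> 0" "norm \<zeta> < ?e" for \<zeta>
    proof -
      have "(norm x)\<^sup>2 * norm \<zeta> \<le> ?k\<^sup>2 * ?e"
        using nx that by (intro mult_mono power_mono) auto
      then show ?thesis using wave_small[OF that(1), of x] by linarith
    qed
    let ?a = "wave \<xi> x - \<i> * (x \<bullet> (\<xi> /\<^sub>R norm \<xi>))" and ?b = "wave \<xi>' x - \<i> * (x \<bullet> (\<xi>' /\<^sub>R norm \<xi>'))"
    let ?c = "\<i> * complex_of_real (x \<bullet> (\<xi> /\<^sub>R norm \<xi>) - x \<bullet> (\<xi>' /\<^sub>R norm \<xi>'))"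
    have "wave \<xi> x - wave \<xi>' x = (?a - ?b) + ?c" by (simp add: algebra_simps)
    then have "norm (wave \<xi> x - wave \<xi>' x) \<le> norm ?a + norm ?b + norm ?c"
      using norm_triangle_ineq[of "?a - ?b" ?c] norm_triangle_ineq4[of ?a ?b] by (simp only:)
    also have "norm ?c = \<bar>x \<bullet> (\<xi> /\<^sub>R norm \<xi>) - x \<bullet> (\<xi>' /\<^sub>R norm \<xi>')\<bar>"
      unfolding norm_mult norm_of_real by simp
    also have "norm ?a + norm ?b + \<dots> \<le> ?k\<^sup>2 * ?e + ?k\<^sup>2 * ?e + ?k\<^sup>2 * (1 / M)"
      using w[OF nz(1) small(1)] w[OF nz(2) small(2)] d by (intro add_mono)
    also have "\<dots> \<le> 4 * ?k\<^sup>2 * (1 / M) + 4 * ?k\<^sup>2 * ?e" using nn by linarith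
    finally show ?thesis .
  next
    case large
    have w: "norm (wave \<zeta> x) \<le> 2 * ?e" if "norm \<zeta> \<ge> 2 powr real J" for \<zeta>
    proof -
      have "2 / norm \<zeta> \<le> 2 / 2 powr real J" using that by (intro divide_left_mono mult_pos_pos) (auto intro: less_le_trans[rotated])
      also have "\<dots> = 2 * ?e" by (simp only: powr_minus divide_inverse)
      finally show ?thesis using norm_wave_le_inverse[of \<zeta> x] by linarith
    qed
    have "norm (wave \<xi> x - wave \<xi>' x) \<le> 4 * ?e"
      using norm_triangle_ineq4[of "wave \<xi> x" "wave \<xi>' x"] w[OF large(1)] w[OF large(2)] by linarith
    also have "\<dots> \<le> 4 * ?k\<^sup>2 * ?e" using k2 by simp
    also have "\<dots> \<le> 4 * ?k\<^sup>2 * (1 / M) + 4 * ?k\<^sup>2 * ?e" by simp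
    finally show ?thesis .
  next
    case mid
    have fl: "\<lfloor>log 2 (norm \<xi>)\<rfloor> = \<lfloor>log 2 (norm \<xi>')\<rfloor>"
      using sc mid by (simp add: freq_scale_def)
    define s where "s = freq_unit J \<xi>"
    have s': "freq_unit J \<xi>' = s" using mid fl by (simp add: s_def freq_unit_def)
    have s: "s > 0" "s \<le> norm \<xi>" using freq_unit_bounds[OF mid(1)] by (auto simp: s_def)
    have "norm (\<xi> /\<^sub>R s - \<xi>' /\<^sub>R s) \<le> ?k / M"
    proof (rule norm_diff_le_of_floor_eq)
      show "\<lfloor>real M * (\<xi> \<bullet> b) / s\<rfloor> = \<lfloor>real M * (\<xi>' \<bullet> b) / s\<rfloor>" if "b \<in> Basis" for b
        using co[OF that mid(3,4)] s' by (simp add: s_def)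
    qed (use s M in auto)
    moreover have "\<xi> /\<^sub>R s - \<xi>' /\<^sub>R s = (\<xi> - \<xi>') /\<^sub>R s" by (simp add: algebra_simps)
    ultimately have "norm (\<xi> - \<xi>') / s \<le> ?k / M"
      using s by (simp add: divide_inverse mult.commute)
    moreover have "norm (\<xi> - \<xi>') / norm \<xi> \<le> norm (\<xi> - \<xi>') / s"
      using s by (intro divide_left_mono mult_pos_pos) auto
    ultimately have "norm x * (norm (\<xi> - \<xi>') / norm \<xi>) \<le> ?k * (?k / M)"
      using nx by (intro mult_mono) auto
    then have "norm (wave \<xi> x - wave \<xi>' x) \<le> 2 * (?k * (?k / M))"
      using wave_lipschitz[OF nz, of x] by (simp add: mult.assoc)
    also have "\<dots> = 2 * (?k\<^sup>2 * (1 / M))" by (simp add: power2_eq_square)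
    also have "\<dots> \<le> 4 * ?k\<^sup>2 * (1 / M) + 4 * ?k\<^sup>2 * ?e" using nn by linarith
    finally show ?thesis .
  qed
  then show ?thesis by (simp add: cell_osc_def algebra_simps)
qed

section \<open>Discretisation of Barron functions\<close>

text \<open>One frequency stands for each cell of the finest partition, giving a finite dictionary
  that does not depend on the function to be approximated. The value \<open>One\<close> for cells
  without nonzero frequency keeps all representatives nonzero, as the oscillation estimate
  requires.\<close>

definition fine_rep :: "nat \<Rightarrow> 'a::euclidean_space freq_index \<Rightarrow> 'a" where
  "fine_rep J p = (if \<exists>\<xi>. \<xi> \<noteq> 0 \<and> freq_cell J (2 ^ J) \<xi> = p
     then SOME \<xi>. \<xi> \<noteq> 0 \<and> freq_cell J (2 ^ J) \<xi> = p else One)"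

lemma fine_rep_cell:
  assumes "\<xi> \<noteq> 0"
  shows "freq_cell J (2 ^ J) (fine_rep J (freq_cell J (2 ^ J) \<xi>)) = freq_cell J (2 ^ J) \<xi>"
proof -
  have ex: "\<exists>\<zeta>. \<zeta> \<noteq> 0 \<and> freq_cell J (2 ^ J) \<zeta> = freq_cell J (2 ^ J) \<xi>" using assms by blast
  show ?thesis unfolding fine_rep_def if_P[OF ex] using someI_ex[OF ex] by blast
qed

lemma fine_rep_nonzero: "fine_rep J p \<noteq> (0 :: 'a::euclidean_space)"
proof (cases "\<exists>\<xi>::'a. \<xi> \<noteq> 0 \<and> freq_cell J (2 ^ J) \<xi> = p")
  case True
  show ?thesis unfolding fine_rep_def if_P[OF True] using someI_ex[OF True] by blast
next
  case False
  obtain b :: 'a where b: "b \<in> Basis" using nonempty_Basis by blast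
  have "(One :: 'a) \<bullet> b = 1" using b by (simp add: inner_sum_left_Basis)
  then have "(One :: 'a) \<noteq> 0" by (metis inner_zero_left zero_neq_one)
  then show ?thesis unfolding fine_rep_def if_not_P[OF False] .
qed

definition atoms :: "nat \<Rightarrow> (('a::euclidean_space freq_index) \<times> nat) set" where
  "atoms J = freq_cells J (2 ^ J) \<times> {..<4}"

text \<open>Multiplying by the four powers of \<open>\<i>\<close> produces the real and imaginary part with both
  signs, so that all weights can be taken nonnegative.\<close>

definition atom :: "nat \<Rightarrow> ('a::euclidean_space freq_index) \<times> nat \<Rightarrow> 'a \<Rightarrow> real" where
  "atom J a x = Re (\<i> ^ snd a * wave (fine_rep J (fst a)) x)"

lemma atom_measurable [measurable]: "atom J a \<in> borel_measurable borel"
  unfolding atom_def wave_def by measurable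

lemma abs_atom_le: "\<bar>atom J a x\<bar> \<le> norm x"
proof -
  have "\<bar>atom J a x\<bar> \<le> norm (\<i> ^ snd a * wave (fine_rep J (fst a)) x)"
    unfolding atom_def by (rule abs_Re_le_cmod)
  also have "\<dots> = norm (wave (fine_rep J (fst a)) x)" by (simp add: norm_mult norm_power)
  finally show ?thesis using norm_wave_le[of "fine_rep J (fst a)" x] by linarith
qed

lemma atom_osc:
  fixes x :: "'a::euclidean_space"
  assumes "M \<ge> 1" "J \<ge> 1" "x \<in> unit_cube" and "snd a = snd a'"
    and "freq_cell J M (fine_rep J (fst a)) = freq_cell J M (fine_rep J (fst a'))"
  shows "\<bar>atom J a x - atom J a' x\<bar> \<le> cell_osc TYPE('a) J M"
proof -
  have "atom J a x - atom J a' x = Re (\<i> ^ snd a' * (wave (fine_rep J (fst a)) x - wave (fine_rep J (fst a')) x))"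
    using assms by (simp add: atom_def right_diff_distrib)
  also have "\<bar>\<dots>\<bar> \<le> norm (\<i> ^ snd a' * (wave (fine_rep J (fst a)) x - wave (fine_rep J (fst a')) x))"
    by (rule abs_Re_le_cmod)
  also have "\<dots> = norm (wave (fine_rep J (fst a)) x - wave (fine_rep J (fst a')) x)"
    by (simp add: norm_mult norm_power)
  also have "\<dots> \<le> cell_osc TYPE('a) J M"
    using assms by (intro wave_cell_osc fine_rep_nonzero) auto
  finally show ?thesis .
qed

text \<open>The cells partition the frequency space. Replacing each wave by that of the
  representative of its cell makes the integral a finite sum with complex coefficients
  \<open>W p\<close>, the masses of the cells. Their absolute values sum to at most C, and real and
  imaginary parts at most double this.\<close>

lemma barron_discretize:
  fixes f :: "'a::euclidean_space \<Rightarrow> real"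
  assumes f: "f \<in> barron_class C" and C: "C > 0" and J: "J \<ge> 1"
  shows "\<exists>c w. \<bar>c\<bar> \<le> C \<and> (\<forall>a. 0 \<le> w a) \<and> (\<Sum>a\<in>atoms J. w a) \<le> 2 * C \<and>
    (\<forall>x\<in>unit_cube. \<bar>f x - (c + (\<Sum>a\<in>atoms J. w a * atom J a x))\<bar> \<le> C * cell_osc TYPE('a) J (2 ^ J))"
proof -
  obtain F c where c: "c \<in> {-C..C}" and F [measurable]: "F \<in> borel_measurable borel" and
    rep: "\<And>x. x \<in> unit_cube \<Longrightarrow> complex_of_real (f x) = complex_of_real c +
          (LINT \<xi>|lborel. (exp (\<i> * complex_of_real (x \<bullet> \<xi>)) - 1) * F \<xi>)" and
    Fb: "(\<integral>\<^sup>+ \<xi>. ennreal (norm \<xi> * norm (F \<xi>)) \<partial>lborel) \<le> ennreal C"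
    using f unfolding barron_class_def by blast
  let ?cell = "freq_cell J (2 ^ J) :: 'a \<Rightarrow> _"
  let ?I = "\<lambda>p. indicator {\<xi>. ?cell \<xi> = p}"
  let ?P = "freq_cells J (2 ^ J) :: 'a freq_index set"
  define H where "H \<xi> = of_real (norm \<xi>) * F \<xi>" for \<xi>
  have [measurable]: "H \<in> borel_measurable borel" unfolding H_def by measurable
  have Hb: "(\<integral>\<^sup>+ \<xi>. ennreal (norm (H \<xi>)) \<partial>lborel) \<le> ennreal C"
    using Fb by (simp add: H_def norm_mult)
  have iH: "integrable lborel H"
    by (rule integrableI_bounded) (use Hb in \<open>auto intro: le_less_trans simp: ennreal_less_top\<close>)
  have HC: "(LINT \<xi>|lborel. norm (H \<xi>)) \<le> C"
    using Hb iH C by (simp add: nn_integral_eq_integral integrable_norm)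
  have [measurable]: "{\<xi>. ?cell \<xi> = p} \<in> sets borel" for p by (rule freq_cell_measurable)
  define W where "W p = (LINT \<xi>|lborel. ?I p \<xi> *\<^sub>R H \<xi>)" for p
  have iW: "integrable lborel (\<lambda>\<xi>. ?I p \<xi> *\<^sub>R H \<xi>)" for p
    by (rule integrable_mult_indicator[OF _ iH]) simp
  have one: "(\<Sum>p\<in>?P. ?I p \<xi> *\<^sub>R g p) = (g (?cell \<xi>) :: 'b::real_vector)" for \<xi> g
  proof -
    have "(\<Sum>p\<in>?P. ?I p \<xi> *\<^sub>R g p) = (\<Sum>p\<in>{?cell \<xi>}. ?I p \<xi> *\<^sub>R g p)"
      using freq_cell_in[of J "2 ^ J" \<xi>] by (intro sum.mono_neutral_right) auto
    then show ?thesis by simp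
  qed
  \<comment> \<open>The real part of wave times \<open>W p\<close> is Re wave Re W - Im wave Im W.
    The four phases provide Re, -Im, -Re and Im of the wave, and each receives the matching positive
    or negative part of \<open>W p\<close>.\<close>
  define w where "w a = (case snd a of 0 \<Rightarrow> max (Re (W (fst a))) 0 | Suc 0 \<Rightarrow> max (Im (W (fst a))) 0
     | Suc (Suc 0) \<Rightarrow> max (- Re (W (fst a))) 0 | _ \<Rightarrow> max (- Im (W (fst a))) 0)" for a :: "'a freq_index \<times> nat"
  have w0: "0 \<le> w a" for a unfolding w_def by (auto split: nat.split)
  have l4: "{..<4::nat} = {0, 1, 2, 3}" by auto
  have w4: "(\<Sum>\<sigma>\<in>{..<4}. w (p, \<sigma>)) = \<bar>Re (W p)\<bar> + \<bar>Im (W p)\<bar>" for p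
    unfolding l4 by (simp add: w_def numeral_2_eq_2 numeral_3_eq_3 max_def)
  have wW: "(\<Sum>\<sigma>\<in>{..<4}. w (p, \<sigma>) * atom J (p, \<sigma>) x) = Re (wave (fine_rep J p) x * W p)" for p x
    unfolding l4 by (simp add: w_def atom_def numeral_2_eq_2 numeral_3_eq_3 max_def algebra_simps)
  have sumw: "(\<Sum>a\<in>atoms J. w a) \<le> 2 * C"
  proof -
    have "(\<Sum>a\<in>atoms J. w a) = (\<Sum>p\<in>?P. \<Sum>\<sigma>\<in>{..<4}. w (p, \<sigma>))"
      unfolding atoms_def by (simp add: sum.cartesian_product)
    also have "\<dots> \<le> (\<Sum>p\<in>?P. 2 * norm (W p))"
      unfolding w4 using abs_Re_le_cmod abs_Im_le_cmod by (intro sum_mono) (smt (verit))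
    also have "\<dots> \<le> (\<Sum>p\<in>?P. 2 * (LINT \<xi>|lborel. ?I p \<xi> *\<^sub>R norm (H \<xi>)))"
    proof (intro sum_mono mult_left_mono)
      fix p
      have "norm (W p) \<le> (LINT \<xi>|lborel. norm (?I p \<xi> *\<^sub>R H \<xi>))"
        unfolding W_def by (rule integral_norm_bound)
      then show "norm (W p) \<le> (LINT \<xi>|lborel. ?I p \<xi> *\<^sub>R norm (H \<xi>))" by simp
    qed simp
    also have "\<dots> = 2 * (LINT \<xi>|lborel. (\<Sum>p\<in>?P. ?I p \<xi> *\<^sub>R norm (H \<xi>)))"
      unfolding sum_distrib_left[symmetric]
      by (subst Bochner_Integration.integral_sum) (auto intro!: integrable_real_mult_indicator[of _ _ "\<lambda>\<xi>. norm (H \<xi>)", unfolded mult.commute[of "norm _"]] integrable_norm iH)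
    also have "\<dots> = 2 * (LINT \<xi>|lborel. norm (H \<xi>))"
      unfolding one[of "\<xi> :: 'a" "\<lambda>_. norm (H \<xi>)" for \<xi>] ..
    finally show ?thesis using HC by simp
  qed
  have approx: "\<bar>f x - (c + (\<Sum>a\<in>atoms J. w a * atom J a x))\<bar> \<le> C * cell_osc TYPE('a) J (2 ^ J)"
    if x: "x \<in> unit_cube" for x
  proof -
    let ?r = "\<lambda>\<xi>. fine_rep J (?cell \<xi>)"
    have eq1: "(exp (\<i> * complex_of_real (x \<bullet> \<xi>)) - 1) * F \<xi> = wave \<xi> x * H \<xi>" for \<xi>
      by (cases "\<xi> = 0") (simp_all add: wave_def H_def)
    have i1: "integrable lborel (\<lambda>\<xi>. wave \<xi> x * H \<xi>)"
    proof (rule Bochner_Integration.integrable_bound)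
      show "integrable lborel (\<lambda>\<xi>. norm x * norm (H \<xi>))" using iH by (intro integrable_mult_right integrable_norm)
      show "AE \<xi> in lborel. norm (wave \<xi> x * H \<xi>) \<le> norm (norm x * norm (H \<xi>))"
        by (intro always_eventually allI) (auto simp: norm_mult intro!: mult_right_mono norm_wave_le)
    qed (unfold wave_def, measurable)
    \<comment> \<open>The replaced wave is constant on each cell in \<xi>, so its integral collapses
      to the cell masses.\<close>
    have eq2: "(\<lambda>\<xi>. wave (?r \<xi>) x * H \<xi>) = (\<lambda>\<xi>. \<Sum>p\<in>?P. wave (fine_rep J p) x * (?I p \<xi> *\<^sub>R H \<xi>))"
    proof
      fix \<xi>
      have "(\<Sum>p\<in>?P. wave (fine_rep J p) x * (?I p \<xi> *\<^sub>R H \<xi>))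
          = (\<Sum>p\<in>?P. ?I p \<xi> *\<^sub>R (wave (fine_rep J p) x * H \<xi>))"
        by simp
      then show "wave (?r \<xi>) x * H \<xi> = (\<Sum>p\<in>?P. wave (fine_rep J p) x * (?I p \<xi> *\<^sub>R H \<xi>))"
        unfolding one by simp
    qed
    have i2: "integrable lborel (\<lambda>\<xi>. wave (?r \<xi>) x * H \<xi>)"
      unfolding eq2 by (intro Bochner_Integration.integrable_sum integrable_mult_right iW)
    have int2: "(LINT \<xi>|lborel. wave (?r \<xi>) x * H \<xi>) = (\<Sum>p\<in>?P. wave (fine_rep J p) x * W p)"
      unfolding eq2 W_def
      by (subst Bochner_Integration.integral_sum, intro integrable_mult_right iW, simp only: integral_mult_right_zero)
    have "(\<Sum>a\<in>atoms J. w a * atom J a x) = (\<Sum>p\<in>?P. \<Sum>\<sigma>\<in>{..<4}. w (p, \<sigma>) * atom J (p, \<sigma>) x)"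
      unfolding atoms_def by (simp add: sum.cartesian_product case_prod_unfold)
    also have "\<dots> = Re (LINT \<xi>|lborel. wave (?r \<xi>) x * H \<xi>)"
      unfolding wW int2 by simp
    finally have s: "(\<Sum>a\<in>atoms J. w a * atom J a x) = Re (LINT \<xi>|lborel. wave (?r \<xi>) x * H \<xi>)" .
    have "f x = Re (complex_of_real (f x))" by simp
    also have "\<dots> = c + Re (LINT \<xi>|lborel. wave \<xi> x * H \<xi>)" unfolding rep[OF x] eq1 by simp
    finally have "f x - (c + (\<Sum>a\<in>atoms J. w a * atom J a x))
        = Re ((LINT \<xi>|lborel. wave \<xi> x * H \<xi>) - (LINT \<xi>|lborel. wave (?r \<xi>) x * H \<xi>))"
      unfolding s by simp
    also have "(LINT \<xi>|lborel. wave \<xi> x * H \<xi>) - (LINT \<xi>|lborel. wave (?r \<xi>) x * H \<xi>)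
        = (LINT \<xi>|lborel. wave \<xi> x * H \<xi> - wave (?r \<xi>) x * H \<xi>)"
      by (rule Bochner_Integration.integral_diff[OF i1 i2, symmetric])
    finally have eq: "f x - (c + (\<Sum>a\<in>atoms J. w a * atom J a x)) = Re (LINT \<xi>|lborel. wave \<xi> x * H \<xi> - wave (?r \<xi>) x * H \<xi>)" .
    have "\<bar>f x - (c + (\<Sum>a\<in>atoms J. w a * atom J a x))\<bar> \<le> norm (LINT \<xi>|lborel. wave \<xi> x * H \<xi> - wave (?r \<xi>) x * H \<xi>)"
      unfolding eq by (rule abs_Re_le_cmod)
    also have "\<dots> \<le> (LINT \<xi>|lborel. norm (wave \<xi> x * H \<xi> - wave (?r \<xi>) x * H \<xi>))"
      by (rule integral_norm_bound)
    also have "\<dots> \<le> (LINT \<xi>|lborel. cell_osc TYPE('a) J (2 ^ J) * norm (H \<xi>))"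
    proof (rule integral_mono)
      show "integrable lborel (\<lambda>\<xi>. norm (wave \<xi> x * H \<xi> - wave (?r \<xi>) x * H \<xi>))"
        using i1 i2 by (intro integrable_norm Bochner_Integration.integrable_diff)
      show "norm (wave \<xi> x * H \<xi> - wave (?r \<xi>) x * H \<xi>) \<le> cell_osc TYPE('a) J (2 ^ J) * norm (H \<xi>)" for \<xi>
      proof (cases "\<xi> = 0")
        case False
        have "norm (wave \<xi> x - wave (?r \<xi>) x) \<le> cell_osc TYPE('a) J (2 ^ J)"
          using False x J by (intro wave_cell_osc fine_rep_nonzero fine_rep_cell[symmetric]) auto
        then show ?thesis by (simp add: left_diff_distrib[symmetric] norm_mult mult_right_mono)
      qed (simp add: H_def)
    qed (use iH in \<open>intro integrable_mult_right integrable_norm\<close>)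
    also have "\<dots> = cell_osc TYPE('a) J (2 ^ J) * (LINT \<xi>|lborel. norm (H \<xi>))" by simp
    also have "\<dots> \<le> cell_osc TYPE('a) J (2 ^ J) * C"
      using HC by (rule mult_left_mono) (simp add: cell_osc_def)
    finally show ?thesis by (simp add: mult.commute)
  qed
  show ?thesis
    using c w0 sumw approx by (intro exI[of _ c] exI[of _ w]) (auto simp: abs_le_iff)
qed

section \<open>Stratified sampling\<close>

lemma weighted_mean_witness:
  fixes p I :: "'i \<Rightarrow> real"
  assumes "finite A" "\<And>a. a \<in> A \<Longrightarrow> 0 \<le> p a" "(\<Sum>a\<in>A. p a) = 1" "(\<Sum>a\<in>A. p a * I a) \<le> R"
  shows "\<exists>a\<in>A. I a \<le> R"
proof (rule ccontr)
  assume "\<not> ?thesis"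
  then have gt: "R < I a" if "a \<in> A" for a using that by (meson not_le)
  have "(\<Sum>a\<in>A. p a * (I a - R)) = (\<Sum>a\<in>A. p a * I a) - (\<Sum>a\<in>A. p a) * R"
    by (simp add: right_diff_distrib sum_subtractf sum_distrib_right)
  then have le: "(\<Sum>a\<in>A. p a * (I a - R)) \<le> 0" using assms by simp
  have nn: "0 \<le> p a * (I a - R)" if "a \<in> A" for a
    using gt[OF that] assms(2)[OF that] by simp
  have "p a = 0" if "a \<in> A" for a
  proof -
    have "0 \<le> (\<Sum>a\<in>A. p a * (I a - R))" by (rule sum_nonneg) (rule nn)
    then have "(\<Sum>a\<in>A. p a * (I a - R)) = 0" using le by linarith
    then have "\<forall>a\<in>A. p a * (I a - R) = 0" by (subst (asm) sum_nonneg_eq_0_iff) (use assms(1) nn in auto)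
    then have "p a * (I a - R) = 0" using that by blast
    then show ?thesis using gt[OF that] by simp
  qed
  then show False using assms(3) by simp
qed

text \<open>The draws are made one at a time and never at random: averaged over the atoms of a class,
  the squared \<open>L\<^sup>2\<close> norm of the accumulated error grows by at most \<open>t\<^sup>2 \<delta>\<^sup>2\<close>, so some atom
  does no worse than that.\<close>

locale stratified_atoms = prob_space M for M :: "'x measure" +
  fixes A :: "'i set" and w :: "'i \<Rightarrow> real" and key :: "'i \<Rightarrow> 'k" and u :: "'i \<Rightarrow> 'x \<Rightarrow> real" and \<delta> \<beta> :: real
  assumes finite_A: "finite A" and w_nonneg: "\<And>a. a \<in> A \<Longrightarrow> 0 \<le> w a"
    and u_meas [measurable]: "\<And>a. u a \<in> borel_measurable M"
    and u_bound: "\<And>a x. x \<in> space M \<Longrightarrow> \<bar>u a x\<bar> \<le> \<beta>"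
    and u_osc: "\<And>a a' x. a \<in> A \<Longrightarrow> a' \<in> A \<Longrightarrow> key a = key a' \<Longrightarrow> x \<in> space M \<Longrightarrow> \<bar>u a x - u a' x\<bar> \<le> \<delta>"
begin

definition class_weight :: "'k \<Rightarrow> real" where
  "class_weight \<kappa> = (\<Sum>a\<in>{a\<in>A. key a = \<kappa>}. w a)"

text \<open>The mean under the weights normalised within the class. A class of weight zero gets 0 by
  division by zero; draws are made from classes of positive weight.\<close>

definition class_mean :: "'k \<Rightarrow> 'x \<Rightarrow> real" where
  "class_mean \<kappa> x = (\<Sum>a\<in>{a\<in>A. key a = \<kappa>}. w a / class_weight \<kappa> * u a x)"

text \<open>A draw (t, a) stands for the portion t of the weight of its class and errs by the
  deviation of \<open>a\<close> from the class mean. Once the portions in each class add up to its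
  weight, this is the error of the whole approximation up to sign.\<close>

definition sampling_error :: "(real \<times> 'i) list \<Rightarrow> 'x \<Rightarrow> real" where
  "sampling_error l x = (\<Sum>(t, a)\<leftarrow>l. t * (u a x - class_mean (key a) x))"

lemma sampling_error_simps:
  "sampling_error [] x = 0"
  "sampling_error ((t, a) # l) x = t * (u a x - class_mean (key a) x) + sampling_error l x"
  by (simp_all add: sampling_error_def)

lemma class_mean_meas [measurable]: "class_mean \<kappa> \<in> borel_measurable M"
  unfolding class_mean_def by measurable

lemma sampling_error_meas [measurable]: "sampling_error l \<in> borel_measurable M"
proof (induction l)
  case (Cons p l)
  have "sampling_error (p # l) = (\<lambda>x. fst p * (u (snd p) x - class_mean (key (snd p)) x) + sampling_error l x)"
    by (cases p) (simp add: fun_eq_iff sampling_error_simps)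
  then show ?case using Cons by simp
qed (simp add: sampling_error_simps[abs_def] sampling_error_def)

lemma class_mean_bound: "\<exists>b. \<forall>x\<in>space M. \<bar>class_mean \<kappa> x\<bar> \<le> b"
proof -
  have "\<bar>class_mean \<kappa> x\<bar> \<le> (\<Sum>a\<in>{a\<in>A. key a = \<kappa>}. \<bar>w a / class_weight \<kappa>\<bar> * \<beta>)" if "x \<in> space M" for x
    unfolding class_mean_def
  proof (intro order_trans[OF sum_abs] sum_mono)
    fix a
    show "\<bar>w a / class_weight \<kappa> * u a x\<bar> \<le> \<bar>w a / class_weight \<kappa>\<bar> * \<beta>"
      unfolding abs_mult[of "w a / class_weight \<kappa>"] by (rule mult_left_mono[OF u_bound[OF that]]) simp
  qed
  then show ?thesis by blast
qed

lemma sampling_error_bound: "\<exists>b. \<forall>x\<in>space M. \<bar>sampling_error l x\<bar> \<le> b"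
proof (induction l)
  case (Cons p l)
  obtain t a where p: "p = (t, a)" by (cases p)
  obtain b where b: "\<forall>x\<in>space M. \<bar>sampling_error l x\<bar> \<le> b" using Cons by blast
  obtain c where c: "\<forall>x\<in>space M. \<bar>class_mean (key a) x\<bar> \<le> c" using class_mean_bound by blast
  have "\<bar>sampling_error (p # l) x\<bar> \<le> \<bar>t\<bar> * (\<beta> + c) + b" if "x \<in> space M" for x
  proof -
    have "\<bar>u a x - class_mean (key a) x\<bar> \<le> \<beta> + c" using u_bound[OF that, of a] c that by fastforce
    then have "\<bar>t * (u a x - class_mean (key a) x)\<bar> \<le> \<bar>t\<bar> * (\<beta> + c)"
      unfolding abs_mult by (rule mult_left_mono) simp
    then show ?thesis using b that unfolding p sampling_error_simps by fastforce
  qed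
  then show ?case by blast
qed (auto simp: sampling_error_simps)

lemma integrable_sampling_error_sq: "integrable M (\<lambda>x. (sampling_error l x)\<^sup>2)"
proof -
  obtain b where b: "\<forall>x\<in>space M. \<bar>sampling_error l x\<bar> \<le> b" using sampling_error_bound by blast
  have "AE x in M. norm ((sampling_error l x)\<^sup>2) \<le> b\<^sup>2"
  proof (rule AE_I2)
    fix x assume "x \<in> space M"
    then have "\<bar>sampling_error l x\<bar>\<^sup>2 \<le> b\<^sup>2" using b by (intro power_mono) auto
    then show "norm ((sampling_error l x)\<^sup>2) \<le> b\<^sup>2" by simp
  qed
  then show ?thesis by (rule integrable_const_bound) measurable
qed

text \<open>Averaged over the class, the mixed term of the square vanishes because the deviations
  from the class mean cancel; the remaining term is bounded by the oscillation within the
  class.\<close>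

lemma greedy_step:
  assumes "class_weight \<kappa> > 0"
  shows "\<exists>a\<in>A. key a = \<kappa> \<and> (LINT x|M. (sampling_error ((t, a) # l) x)\<^sup>2) \<le> (LINT x|M. (sampling_error l x)\<^sup>2) + t\<^sup>2 * \<delta>\<^sup>2"
proof -
  define K where "K = {a\<in>A. key a = \<kappa>}"
  have finK: "finite K" using finite_A by (simp add: K_def)
  define p where "p a = w a / class_weight \<kappa>" for a
  have p0: "0 \<le> p a" if "a \<in> K" for a using that w_nonneg assms by (simp add: p_def K_def)
  have p1: "(\<Sum>a\<in>K. p a) = 1"
    using assms by (simp add: p_def sum_divide_distrib[symmetric] class_weight_def K_def)
  define m where "m = class_mean \<kappa>"
  have mp: "m x = (\<Sum>a\<in>K. p a * u a x)" for x by (simp add: m_def class_mean_def K_def p_def)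
  let ?S = "sampling_error l"
  have se: "sampling_error ((t, a) # l) x = t * (u a x - m x) + ?S x" if "a \<in> K" for a x
    using that by (simp add: sampling_error_simps m_def K_def)
  have osc: "\<bar>u a x - m x\<bar> \<le> \<delta>" if a: "a \<in> K" and x: "x \<in> space M" for a x
  proof -
    have "u a x - m x = (\<Sum>a'\<in>K. p a' * (u a x - u a' x))"
      by (simp add: mp right_diff_distrib sum_subtractf sum_distrib_right[symmetric] p1)
    also have "\<bar>\<dots>\<bar> \<le> (\<Sum>a'\<in>K. p a' * \<delta>)"
    proof (intro order_trans[OF sum_abs] sum_mono)
      fix a' assume "a' \<in> K"
      then show "\<bar>p a' * (u a x - u a' x)\<bar> \<le> p a' * \<delta>"
        using p0[of a'] u_osc[of a a' x] a x by (simp add: abs_mult mult_left_mono K_def)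
    qed
    finally show ?thesis by (simp add: sum_distrib_right[symmetric] p1)
  qed
  have pw: "(\<Sum>a\<in>K. p a * (sampling_error ((t, a) # l) x)\<^sup>2) \<le> (?S x)\<^sup>2 + t\<^sup>2 * \<delta>\<^sup>2" if x: "x \<in> space M" for x
  proof -
    have "(\<Sum>a\<in>K. p a * (sampling_error ((t, a) # l) x)\<^sup>2)
        = (\<Sum>a\<in>K. p a * (?S x)\<^sup>2 + 2 * t * ?S x * (p a * u a x - p a * m x) + t\<^sup>2 * (p a * (u a x - m x)\<^sup>2))"
      by (intro sum.cong refl) (simp add: se power2_eq_square algebra_simps)
    also have "\<dots> = (\<Sum>a\<in>K. p a) * (?S x)\<^sup>2 + 2 * t * ?S x * ((\<Sum>a\<in>K. p a * u a x) - (\<Sum>a\<in>K. p a) * m x)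
        + t\<^sup>2 * (\<Sum>a\<in>K. p a * (u a x - m x)\<^sup>2)"
      by (simp add: sum.distrib sum_distrib_left[symmetric] sum_distrib_right[symmetric] sum_subtractf)
    also have "\<dots> = (?S x)\<^sup>2 + t\<^sup>2 * (\<Sum>a\<in>K. p a * (u a x - m x)\<^sup>2)"
      by (simp add: p1 mp[symmetric])
    also have "(\<Sum>a\<in>K. p a * (u a x - m x)\<^sup>2) \<le> (\<Sum>a\<in>K. p a * \<delta>\<^sup>2)"
    proof (intro sum_mono mult_left_mono p0)
      show "(u a x - m x)\<^sup>2 \<le> \<delta>\<^sup>2" if "a \<in> K" for a
        using power_mono[OF osc[OF that x] abs_ge_zero, of 2] by simp
    qed
    also have "(\<Sum>a\<in>K. p a * \<delta>\<^sup>2) = \<delta>\<^sup>2" by (simp add: sum_distrib_right[symmetric] p1)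
    finally show ?thesis by (simp add: mult_left_mono)
  qed
  have "(\<Sum>a\<in>K. p a * (LINT x|M. (sampling_error ((t, a) # l) x)\<^sup>2))
      = (LINT x|M. (\<Sum>a\<in>K. p a * (sampling_error ((t, a) # l) x)\<^sup>2))"
    by (subst Bochner_Integration.integral_sum) (auto intro!: integrable_mult_right integrable_sampling_error_sq)
  also have "\<dots> \<le> (LINT x|M. (?S x)\<^sup>2 + t\<^sup>2 * \<delta>\<^sup>2)"
    using pw by (intro integral_mono) (auto intro!: Bochner_Integration.integrable_sum integrable_mult_right integrable_sampling_error_sq)
  also have "\<dots> = (LINT x|M. (?S x)\<^sup>2) + t\<^sup>2 * \<delta>\<^sup>2"
    by (subst Bochner_Integration.integral_add) (auto intro!: integrable_sampling_error_sq simp: prob_space)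
  finally have "\<exists>a\<in>K. (LINT x|M. (sampling_error ((t, a) # l) x)\<^sup>2) \<le> (LINT x|M. (?S x)\<^sup>2) + t\<^sup>2 * \<delta>\<^sup>2"
    by (rule weighted_mean_witness[of K p, OF finK p0 p1, rotated])
  then show ?thesis unfolding K_def by blast
qed

lemma greedy_steps:
  assumes "\<And>\<kappa> t. (\<kappa>, t) \<in> set ks \<Longrightarrow> class_weight \<kappa> > 0"
  shows "\<exists>l. map (\<lambda>(t, a). (key a, t)) l = ks \<and> set l \<subseteq> UNIV \<times> A \<and>
    (LINT x|M. (sampling_error l x)\<^sup>2) \<le> (\<Sum>(\<kappa>, t)\<leftarrow>ks. t\<^sup>2) * \<delta>\<^sup>2"
  using assms
proof (induction ks)
  case Nil
  then show ?case by (intro exI[of _ "[]"]) (simp add: sampling_error_simps)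
next
  case (Cons q ks)
  obtain \<kappa> t where q: "q = (\<kappa>, t)" by (cases q)
  obtain l where l: "map (\<lambda>(t, a). (key a, t)) l = ks" "set l \<subseteq> UNIV \<times> A"
    "(LINT x|M. (sampling_error l x)\<^sup>2) \<le> (\<Sum>(\<kappa>, t)\<leftarrow>ks. t\<^sup>2) * \<delta>\<^sup>2"
    using Cons by force
  have "class_weight \<kappa> > 0" using Cons(2) q by auto
  from greedy_step[OF this, of t l] obtain a where a: "a \<in> A" "key a = \<kappa>"
    "(LINT x|M. (sampling_error ((t, a) # l) x)\<^sup>2) \<le> (LINT x|M. (sampling_error l x)\<^sup>2) + t\<^sup>2 * \<delta>\<^sup>2" by blast
  show ?case
  proof (intro exI[of _ "(t, a) # l"] conjI)
    show "(LINT x|M. (sampling_error ((t, a) # l) x)\<^sup>2) \<le> (\<Sum>(\<kappa>, t)\<leftarrow>q # ks. t\<^sup>2) * \<delta>\<^sup>2"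
      using a(3) l(3) by (simp add: q distrib_right)
  qed (use a l q in auto)
qed

text \<open>A class of weight w gets about D w / W draws of equal portion. Each portion is then at
  most W / D and their squares sum to at most W * W / D, while rounding up adds at most one draw per
  class, hence 2D draws in all.\<close>

lemma stratified_sampling:
  assumes W: "W > 0" "(\<Sum>a\<in>A. w a) \<le> W" and D: "card (key ` A) \<le> D" "D \<ge> 1"
  shows "\<exists>l. length l \<le> 2 * D \<and> set l \<subseteq> {0..W} \<times> A \<and>
    (LINT x|M. ((\<Sum>a\<in>A. w a * u a x) - (\<Sum>(t, a)\<leftarrow>l. t * u a x))\<^sup>2) \<le> W\<^sup>2 * \<delta>\<^sup>2 / D"
proof -
  let ?w = class_weight
  define K where "K = {\<kappa> \<in> key ` A. ?w \<kappa> > 0}"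
  have finK: "finite K" using finite_A by (simp add: K_def)
  have cardK: "card K \<le> D"
    using card_mono[of "key ` A" K] finite_A D by (auto simp: K_def)
  obtain \<kappa>s where \<kappa>s: "set \<kappa>s = K" "distinct \<kappa>s" using finite_distinct_list[OF finK] by blast
  have w0: "0 \<le> ?w \<kappa>" for \<kappa> unfolding class_weight_def using w_nonneg by (intro sum_nonneg) auto
  have group: "(\<Sum>\<kappa>\<in>key ` A. \<Sum>a\<in>{a\<in>A. key a = \<kappa>}. h a) = (\<Sum>a\<in>A. h a)" for h :: "'i \<Rightarrow> real"
    using finite_A by (intro sum.group) auto
  have sumw: "(\<Sum>\<kappa>\<in>K. ?w \<kappa>) \<le> W"
  proof -
    have "(\<Sum>\<kappa>\<in>K. ?w \<kappa>) \<le> (\<Sum>\<kappa>\<in>key ` A. ?w \<kappa>)"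
      using w0 finite_A by (intro sum_mono2) (auto simp: K_def)
    then show ?thesis using W by (simp add: class_weight_def group)
  qed
  \<comment> \<open>Rounding up gives every class of positive weight at least one draw and keeps its
    portion below W / D.\<close>
  define n where "n \<kappa> = nat \<lceil>D * ?w \<kappa> / W\<rceil>" for \<kappa>
  have n: "n \<kappa> \<ge> 1" "real (n \<kappa>) \<ge> D * ?w \<kappa> / W" "real (n \<kappa>) \<le> D * ?w \<kappa> / W + 1" if "\<kappa> \<in> K" for \<kappa>
  proof -
    have "D * ?w \<kappa> / W > 0" using that D W by (simp add: K_def)
    then show "n \<kappa> \<ge> 1" "real (n \<kappa>) \<ge> D * ?w \<kappa> / W" "real (n \<kappa>) \<le> D * ?w \<kappa> / W + 1"
      unfolding n_def by linarith+
  qed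
  define \<tau> where "\<tau> \<kappa> = ?w \<kappa> / n \<kappa>" for \<kappa>
  define ks where "ks = concat (map (\<lambda>\<kappa>. replicate (n \<kappa>) (\<kappa>, \<tau> \<kappa>)) \<kappa>s)"
  have ks_sum: "(\<Sum>(\<kappa>, t)\<leftarrow>ks. h \<kappa> t) = (\<Sum>\<kappa>\<in>K. n \<kappa> * h \<kappa> (\<tau> \<kappa>))" for h :: "'k \<Rightarrow> real \<Rightarrow> real"
  proof -
    have "(\<Sum>(\<kappa>, t)\<leftarrow>ks. h \<kappa> t) = (\<Sum>\<kappa>\<leftarrow>\<kappa>s. n \<kappa> * h \<kappa> (\<tau> \<kappa>))"
      unfolding ks_def by (induction \<kappa>s) (simp_all add: sum_list_replicate)
    also have "\<dots> = (\<Sum>\<kappa>\<in>K. n \<kappa> * h \<kappa> (\<tau> \<kappa>))"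
      using \<kappa>s sum_list_distinct_conv_sum_set by metis
    finally show ?thesis .
  qed
  have set_ks: "set ks \<subseteq> (\<lambda>\<kappa>. (\<kappa>, \<tau> \<kappa>)) ` K" unfolding ks_def using \<kappa>s by auto
  then have pos: "?w \<kappa> > 0" if "(\<kappa>, t) \<in> set ks" for \<kappa> t using that by (auto simp: K_def)
  have tau: "0 \<le> \<tau> \<kappa>" "\<tau> \<kappa> \<le> W / D" "n \<kappa> * \<tau> \<kappa> = ?w \<kappa>" if "\<kappa> \<in> K" for \<kappa>
    using n[OF that] w0[of \<kappa>] W D unfolding \<tau>_def by (auto simp: field_simps)
  from greedy_steps[of ks] pos obtain l where l: "map (\<lambda>(t, a). (key a, t)) l = ks" "set l \<subseteq> UNIV \<times> A"
    "(LINT x|M. (sampling_error l x)\<^sup>2) \<le> (\<Sum>(\<kappa>, t)\<leftarrow>ks. t\<^sup>2) * \<delta>\<^sup>2" by blast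
  have len: "length l \<le> 2 * D"
  proof -
    have "real (length l) = (\<Sum>(\<kappa>, t)\<leftarrow>ks. 1)" unfolding l(1)[symmetric] by (simp add: sum_list_triv case_prod_unfold)
    also have "\<dots> = (\<Sum>\<kappa>\<in>K. real (n \<kappa>))" by (subst ks_sum) simp
    also have "\<dots> \<le> (\<Sum>\<kappa>\<in>K. D * ?w \<kappa> / W + 1)" by (intro sum_mono n(3))
    also have "\<dots> = D * (\<Sum>\<kappa>\<in>K. ?w \<kappa>) / W + card K"
      by (simp add: sum.distrib sum_distrib_left sum_divide_distrib)
    also have "D * (\<Sum>\<kappa>\<in>K. ?w \<kappa>) / W \<le> D" using sumw W by (simp add: divide_le_eq mult_left_mono)
    also have "D + real (card K) \<le> D + real D" using cardK by simp
    finally show ?thesis by linarith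
  qed
  have setl: "set l \<subseteq> {0..W} \<times> A"
  proof
    fix p assume p: "p \<in> set l"
    obtain t a where ta: "p = (t, a)" by (cases p)
    have "(key a, t) \<in> set ks" unfolding l(1)[symmetric] using p ta by force
    then have "key a \<in> K" "t = \<tau> (key a)" using set_ks by auto
    then have "0 \<le> t" "t \<le> W / D" using tau by auto
    moreover have "W / D \<le> W" using W D by (simp add: divide_le_eq)
    ultimately show "p \<in> {0..W} \<times> A" using ta l(2) p by auto
  qed
  have mean: "(\<Sum>(t, a)\<leftarrow>l. t * class_mean (key a) x) = (\<Sum>a\<in>A. w a * u a x)" for x
  proof -
    have "(\<Sum>(t, a)\<leftarrow>l. t * class_mean (key a) x) = (\<Sum>(\<kappa>, t)\<leftarrow>ks. t * class_mean \<kappa> x)"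
      unfolding l(1)[symmetric] by (simp add: comp_def case_prod_unfold)
    also have "\<dots> = (\<Sum>\<kappa>\<in>K. ?w \<kappa> * class_mean \<kappa> x)"
      unfolding ks_sum by (intro sum.cong refl) (simp add: tau(3)[symmetric] mult.assoc)
    also have "\<dots> = (\<Sum>\<kappa>\<in>key ` A. \<Sum>a\<in>{a\<in>A. key a = \<kappa>}. w a * u a x)"
    proof (rule sum.mono_neutral_cong_left)
      show "\<forall>\<kappa>\<in>key ` A - K. (\<Sum>a\<in>{a\<in>A. key a = \<kappa>}. w a * u a x) = 0"
      proof
        fix \<kappa> assume "\<kappa> \<in> key ` A - K"
        \<comment> \<open>The weights are nonnegative, so a class of total weight zero contributes
          nothing and may be left out of the draws.\<close>
        then have "?w \<kappa> = 0" using w0[of \<kappa>] by (auto simp: K_def)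
        then have "\<forall>a\<in>{a\<in>A. key a = \<kappa>}. w a = 0"
          unfolding class_weight_def using finite_A w_nonneg by (subst (asm) sum_nonneg_eq_0_iff) auto
        then show "(\<Sum>a\<in>{a\<in>A. key a = \<kappa>}. w a * u a x) = 0" by (intro sum.neutral) auto
      qed
      show "?w \<kappa> * class_mean \<kappa> x = (\<Sum>a\<in>{a\<in>A. key a = \<kappa>}. w a * u a x)" if "\<kappa> \<in> K" for \<kappa>
        using that unfolding class_mean_def sum_distrib_left by (intro sum.cong) (auto simp: K_def)
    qed (use finite_A in \<open>auto simp: K_def\<close>)
    finally show ?thesis by (simp only: group)
  qed
  have err: "((\<Sum>a\<in>A. w a * u a x) - (\<Sum>(t, a)\<leftarrow>l. t * u a x))\<^sup>2 = (sampling_error l x)\<^sup>2" for x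
  proof -
    have "sampling_error l x = (\<Sum>(t, a)\<leftarrow>l. t * u a x) - (\<Sum>(t, a)\<leftarrow>l. t * class_mean (key a) x)"
      unfolding sampling_error_def by (induction l) (auto simp: algebra_simps)
    then show ?thesis by (simp add: mean power2_commute)
  qed
  have "(\<Sum>(\<kappa>, t)\<leftarrow>ks. t\<^sup>2) = (\<Sum>\<kappa>\<in>K. ?w \<kappa> * \<tau> \<kappa>)"
    unfolding ks_sum by (intro sum.cong refl) (simp add: power2_eq_square tau(3)[symmetric] mult.assoc)
  also have "\<dots> \<le> (\<Sum>\<kappa>\<in>K. ?w \<kappa> * (W / D))"
    using tau(2) w0 by (intro sum_mono mult_left_mono) auto
  also have "\<dots> = (\<Sum>\<kappa>\<in>K. ?w \<kappa>) * (W / D)" by (rule sum_distrib_right[symmetric])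
  also have "\<dots> \<le> W * (W / D)" using sumw W by (intro mult_right_mono) auto
  finally have "(\<Sum>(\<kappa>, t)\<leftarrow>ks. t\<^sup>2) * \<delta>\<^sup>2 \<le> W * (W / D) * \<delta>\<^sup>2" by (rule mult_right_mono) simp
  then have "(LINT x|M. (sampling_error l x)\<^sup>2) \<le> W\<^sup>2 * \<delta>\<^sup>2 / D"
    using l(3) by (simp add: power2_eq_square)
  then show ?thesis using len setl by (intro exI[of _ l]) (simp add: err)
qed

end

section \<open>A finite net for the Barron class\<close>

text \<open>Meshes C/Q and 2C/Q because constants range over [-C, C] and weights over [0, 2C];
  integers of size at most Q then suffice.\<close>

definition net_fun :: "real \<Rightarrow> nat \<Rightarrow> nat \<Rightarrow> int \<times> (nat \<times> (('a::euclidean_space freq_index) \<times> nat)) list \<Rightarrow> 'a \<Rightarrow> real" where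
  "net_fun C J Q p x = real_of_int (fst p) * (C / Q) + (\<Sum>(q, a)\<leftarrow>snd p. real q * (2 * C / Q) * atom J a x)"

definition net :: "real \<Rightarrow> nat \<Rightarrow> nat \<Rightarrow> nat \<Rightarrow> ('a::euclidean_space \<Rightarrow> real) set" where
  "net C J Q D = net_fun C J Q ` ({- int Q..int Q} \<times> {l. set l \<subseteq> {..Q} \<times> atoms J \<and> length l = 2 * D})"

lemma finite_atoms [simp]: "finite (atoms J)"
  by (simp add: atoms_def)

lemma finite_net: "finite (net C J Q D)"
  unfolding net_def by (intro finite_imageI finite_cartesian_product finite_lists_length_eq) auto

lemma card_net: "card (net C J Q D :: ('a::euclidean_space \<Rightarrow> real) set)
    \<le> (2 * Q + 1) * ((Q + 1) * card (atoms J :: ('a freq_index \<times> nat) set)) ^ (2 * D)"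
proof -
  have "card (net C J Q D :: ('a \<Rightarrow> real) set) \<le> card ({- int Q..int Q} \<times>
      {l :: (nat \<times> ('a freq_index \<times> nat)) list. set l \<subseteq> {..Q} \<times> atoms J \<and> length l = 2 * D})"
    unfolding net_def by (intro card_image_le finite_cartesian_product finite_lists_length_eq) auto
  also have "\<dots> = (2 * Q + 1) * ((Q + 1) * card (atoms J :: ('a freq_index \<times> nat) set)) ^ (2 * D)"
    unfolding card_cartesian_product by (subst card_lists_length_eq) (auto simp: nat_add_distrib card_cartesian_product)
  finally show ?thesis .
qed

lemma net_fun_measurable: "net_fun C J Q p \<in> borel_measurable borel"
proof -
  have "(\<lambda>x. \<Sum>(q, a)\<leftarrow>l. real q * (2 * C / Q) * atom J a x) \<in> borel_measurable borel" for l
    by (induction l) (auto simp: case_prod_unfold)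
  then show ?thesis unfolding net_fun_def[abs_def] by measurable
qed

lemma net_measurable: "g \<in> net C J Q D \<Longrightarrow> g \<in> borel_measurable borel"
  by (auto simp: net_def net_fun_measurable)

lemma net_nonempty: "net C J Q D \<noteq> ({} :: ('a::euclidean_space \<Rightarrow> real) set)"
proof -
  have "(freq_cell J (2 ^ J) (0 :: 'a), 0) \<in> atoms J" by (simp add: atoms_def freq_cell_in)
  then have "(0, replicate (2 * D) (0, freq_cell J (2 ^ J) (0 :: 'a), 0))
      \<in> {- int Q..int Q} \<times> {l. set l \<subseteq> {..Q} \<times> atoms J \<and> length l = 2 * D}"
    by (auto simp: in_set_replicate)
  then show ?thesis unfolding net_def by blast
qed

text \<open>The number of pairs of a coarse cell and a phase, hence a bound on the number of
  classes. It serves as the parameter \<open>D\<close> of the sampling.\<close>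

definition coarse_count :: "'a::euclidean_space itself \<Rightarrow> nat \<Rightarrow> nat \<Rightarrow> nat" where
  "coarse_count _ J M = 4 * ((2 * J + 2) * (4 * M + 1) ^ DIM('a))"

lemma coarse_count_ge: "coarse_count TYPE('a::euclidean_space) J M \<ge> M ^ DIM('a)" "coarse_count TYPE('a) J M \<ge> 1"
proof -
  have "1 * (4 * M + 1) ^ DIM('a) \<le> (4 * (2 * J + 2)) * (4 * M + 1) ^ DIM('a)" by (intro mult_right_mono) auto
  then have le: "(4 * M + 1) ^ DIM('a) \<le> coarse_count TYPE('a) J M" by (simp only: coarse_count_def mult.assoc mult_1)
  have "M ^ DIM('a) \<le> (4 * M + 1) ^ DIM('a)" by (intro power_mono) auto
  then show "coarse_count TYPE('a) J M \<ge> M ^ DIM('a)" using le by (rule order_trans)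
  have "1 \<le> (4 * M + 1) ^ DIM('a)" by simp
  then show "coarse_count TYPE('a) J M \<ge> 1" using le by (rule order_trans)
qed

lemma coarse_count_le:
  assumes "M \<ge> 1" "J \<ge> 1"
  shows "real (coarse_count TYPE('a::euclidean_space) J M) \<le> 16 * 5 ^ DIM('a) * real J * real M ^ DIM('a)"
proof -
  have "coarse_count TYPE('a) J M \<le> 4 * ((4 * J) * (5 * M) ^ DIM('a))"
    unfolding coarse_count_def using assms by (intro mult_le_mono power_mono) auto
  then have "real (coarse_count TYPE('a) J M) \<le> real (4 * ((4 * J) * (5 * M) ^ DIM('a)))" by (simp only: of_nat_le_iff)
  then show ?thesis by (simp add: power_mult_distrib mult_ac)
qed

text \<open>An element is given by a constant and 2D pairs of a rounded weight and an atom.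
  \<open>D\<close> is of order J M^k, and the number of choices for a pair is exponential in J, so
  log-size is of order M^k J^2.\<close>

lemma ln_card_net:
  "\<exists>K>0. \<forall>J M. 1 \<le> J \<longrightarrow> 1 \<le> M \<longrightarrow> M \<le> 2 ^ J \<longrightarrow>
    (let D = coarse_count TYPE('a::euclidean_space) J M in
      real (card (net C J (D * 2 ^ J) D :: ('a \<Rightarrow> real) set)) \<le> exp (K * real M ^ DIM('a) * (real J)\<^sup>2))"
proof -
  let ?k = "DIM('a)"
  define E where "E = ln (48 * 5 ^ ?k :: real)"
  have E0: "E \<ge> 0" unfolding E_def using one_le_power[of "5::real" ?k] by (intro ln_ge_zero) linarith
  \<comment> \<open>A common exponent for both counts: for pairs there are two constants
    \<open>exp E\<close> and (k + 2) + (k + 1) = 2k + 3 factors 2^J.\<close>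
  define E2 where "E2 = 2 * E + 2 * ?k + 3"
  have E2: "E2 > 0" using E0 by (simp add: E2_def)
  define K where "K = 48 * 5 ^ ?k * E2"
  have main: "real (card (net C J (D * 2 ^ J) D :: ('a \<Rightarrow> real) set)) \<le> exp (K * real M ^ ?k * (real J)\<^sup>2)"
    if J: "1 \<le> J" and M: "1 \<le> M" "M \<le> 2 ^ J" and D: "D = coarse_count TYPE('a) J M" for J M D
  proof -
    define Q where "Q = D * 2 ^ J"
    define T where "T = card (atoms J :: ('a freq_index \<times> nat) set)"
    have D1: "D \<ge> 1" unfolding D by (rule coarse_count_ge)
    have Q1: "Q \<ge> 1" unfolding Q_def using D1 by simp
    have T: "T = coarse_count TYPE('a) J (2 ^ J)"
      unfolding T_def atoms_def coarse_count_def card_cartesian_product card_freq_cells by simp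
    have J2: "real J \<le> 2 ^ J" using of_nat_less_two_power[of J, where 'a = real] by simp
    have cc: "real (coarse_count TYPE('a) J M') \<le> 16 * 5 ^ ?k * 2 ^ ((?k + 1) * J)" if "1 \<le> M'" "M' \<le> 2 ^ J" for M'
    proof -
      have "real M' \<le> 2 ^ J" using that by (metis of_nat_le_iff of_nat_numeral of_nat_power)
      then have "real M' ^ ?k \<le> (2 ^ J) ^ ?k" by (intro power_mono) auto
      then have "16 * 5 ^ ?k * real J * real M' ^ ?k \<le> 16 * 5 ^ ?k * 2 ^ J * (2 ^ J) ^ ?k"
        using J2 by (intro mult_mono) auto
      also have "\<dots> = 16 * 5 ^ ?k * 2 ^ ((?k + 1) * J)"
        by (simp add: power_mult[symmetric] power_add mult.commute)
      finally show ?thesis using coarse_count_le[OF that(1) J, where 'a = 'a] by linarith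
    qed
    have Db: "real D \<le> 16 * 5 ^ ?k * 2 ^ ((?k + 1) * J)" and Tb: "real T \<le> 16 * 5 ^ ?k * 2 ^ ((?k + 1) * J)"
      unfolding D T using cc M by auto
    have Qb: "real Q \<le> 16 * 5 ^ ?k * 2 ^ ((?k + 2) * J)"
    proof -
      have "real Q \<le> 16 * 5 ^ ?k * 2 ^ ((?k + 1) * J) * 2 ^ J"
        unfolding Q_def using Db by (simp add: mult_right_mono)
      also have "\<dots> = 16 * 5 ^ ?k * 2 ^ ((?k + 2) * J)" by (simp add: power_add algebra_simps)
      finally show ?thesis .
    qed
    have two: "2 ^ n \<le> exp (real n)" for n :: nat
    proof -
      have "2 \<le> exp (1::real)" using exp_ge_add_one_self[of 1] by simp
      then have "2 ^ n \<le> exp (1::real) ^ n" by (intro power_mono) auto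
      then show ?thesis by (simp add: exp_of_nat_mult[symmetric])
    qed
    have expE: "48 * 5 ^ ?k = exp E" unfolding E_def by simp
    have b1: "real (2 * Q + 1) \<le> exp (E2 * J)"
    proof -
      have "real (2 * Q + 1) \<le> 3 * real Q" using Q1 by simp
      also have "\<dots> \<le> 48 * 5 ^ ?k * 2 ^ ((?k + 2) * J)" using Qb by simp
      also have "\<dots> \<le> exp E * exp (real ((?k + 2) * J))"
        unfolding expE by (intro mult_left_mono two) auto
      also have "\<dots> = exp (E + real ((?k + 2) * J))" by (simp add: exp_add)
      also have "\<dots> \<le> exp (E2 * J)"
      proof (subst exp_le_cancel_iff)
        have "E \<le> E * J" using J E0 mult_left_mono[of 1 "real J" E] by simp
        moreover have "0 \<le> E * J" using E0 by simp
        moreover have "E2 * J = 2 * (E * J) + 2 * (real ?k * J) + 3 * J" by (simp add: E2_def algebra_simps)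
        moreover have "real ((?k + 2) * J) = real ?k * J + 2 * J" by (simp add: algebra_simps)
        moreover have "0 \<le> real ?k * J" by simp
        ultimately show "E + real ((?k + 2) * J) \<le> E2 * J" by linarith
      qed
      finally show ?thesis .
    qed
    have b2: "real ((Q + 1) * T) \<le> exp (E2 * J)"
    proof -
      have "real (Q + 1) \<le> 48 * 5 ^ ?k * 2 ^ ((?k + 2) * J)" using Q1 Qb by simp
      moreover have "real T \<le> 48 * 5 ^ ?k * 2 ^ ((?k + 1) * J)" using Tb by (smt (verit) mult_right_mono zero_le_power)
      ultimately have "real (Q + 1) * real T \<le> (exp E * 2 ^ ((?k + 2) * J)) * (exp E * 2 ^ ((?k + 1) * J))"
        unfolding expE by (intro mult_mono) auto
      also have "\<dots> \<le> (exp E * exp (real ((?k + 2) * J))) * (exp E * exp (real ((?k + 1) * J)))"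
        by (intro mult_mono mult_left_mono two) auto
      also have "\<dots> = exp (2 * E + real ((?k + 2) * J) + real ((?k + 1) * J))" by (simp add: exp_add[symmetric])
      also have "\<dots> \<le> exp (E2 * J)"
      proof (subst exp_le_cancel_iff)
        have "E \<le> E * J" using J E0 mult_left_mono[of 1 "real J" E] by simp
        then show "2 * E + real ((?k + 2) * J) + real ((?k + 1) * J) \<le> E2 * J" unfolding E2_def by (simp add: algebra_simps)
      qed
      finally show ?thesis by (simp only: of_nat_mult)
    qed
    have "real (card (net C J Q D :: ('a \<Rightarrow> real) set)) \<le> real ((2 * Q + 1) * ((Q + 1) * T) ^ (2 * D))"
      unfolding of_nat_le_iff T_def by (rule card_net)
    also have "\<dots> = real (2 * Q + 1) * real ((Q + 1) * T) ^ (2 * D)" by (simp only: of_nat_mult of_nat_power)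
    also have "\<dots> \<le> exp (E2 * J) * exp (E2 * J) ^ (2 * D)"
      using b1 b2 by (intro mult_mono power_mono) auto
    also have "\<dots> = exp (E2 * J * (1 + 2 * real D))"
      by (simp add: exp_of_nat_mult[symmetric] exp_add[symmetric] algebra_simps)
    also have "\<dots> \<le> exp (K * real M ^ ?k * (real J)\<^sup>2)"
    proof (subst exp_le_cancel_iff)
      have "E2 * J * (1 + 2 * real D) \<le> E2 * J * (3 * (16 * 5 ^ ?k * real J * real M ^ ?k))"
        using D1 coarse_count_le[OF M(1) J, where 'a = 'a] E2 unfolding D[symmetric]
        by (intro mult_left_mono) auto
      also have "\<dots> = K * real M ^ ?k * (real J)\<^sup>2" by (simp add: K_def power2_eq_square)
      finally show "E2 * J * (1 + 2 * real D) \<le> K * real M ^ ?k * (real J)\<^sup>2" .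
    qed
    finally show ?thesis unfolding Q_def .
  qed
  have "K > 0" unfolding K_def using E2 by simp
  then show ?thesis using main unfolding Let_def by blast
qed

text \<open>Passing to the dictionary and rounding cost order 2^(-J) uniformly; sampling costs order
  \<delta> / sqrt D in L^2. Here \<delta> is of order 1/M and D >= M^k, so the latter is M^(-1 -
  k/2). The factor J contained in \<open>D\<close> is paid only in the size of the net.\<close>

lemma net_approx:
  fixes f :: "'a::euclidean_space \<Rightarrow> real"
  assumes f: "f \<in> barron_class C" and C: "C > 0" and J: "J \<ge> 1" and M: "M \<ge> 1" "M \<le> 2 ^ J"
    and D: "D = coarse_count TYPE('a) J M"
  shows "\<exists>g\<in>net C J (D * 2 ^ J) D. integrable cube_measure (\<lambda>x. \<bar>f x - g x\<bar>) \<and>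
    (LINT x|cube_measure. \<bar>f x - g x\<bar>)
      \<le> 16 * C * (real DIM('a))\<^sup>2 * (real M powr (- (real DIM('a) + 2) / 2) + 2 powr - real J)"
proof -
  let ?k = "real DIM('a)" and ?e = "2 powr - real J"
  have k: "?k \<ge> 1" using DIM_ge_Suc0[where 'a = 'a] by simp
  \<comment> \<open>Rounding 2D weights with mesh 2C/Q, against atoms bounded by k, costs 4 C k D/Q,
    which this choice makes 4 C k 2^(-J).\<close>
  define Q where "Q = D * 2 ^ J"
  have D1: "D \<ge> 1" "real M ^ DIM('a) \<le> D"
    unfolding D using coarse_count_ge(1)[of M J, where 'a = 'a] coarse_count_ge(2)[of J M, where 'a = 'a]
    by (simp_all only: of_nat_le_iff[symmetric, where 'a = real] of_nat_power)
  have e: "?e = 1 / 2 ^ J" by (simp add: powr_minus powr_realpow inverse_eq_divide)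
  have Q: "real Q > 0" "1 / real Q \<le> ?e" "1 / real Q = ?e / D"
    using D1 unfolding Q_def e by (auto simp: field_simps)
  define A where "A = (atoms J :: ('a freq_index \<times> nat) set)"
  define \<delta> where "\<delta> = cell_osc TYPE('a) J M"
  define key :: "'a freq_index \<times> nat \<Rightarrow> 'a freq_index \<times> nat"
    where "key a = (freq_cell J M (fine_rep J (fst a)), snd a)" for a
  obtain c w where c: "\<bar>c\<bar> \<le> C" and w: "\<And>a. 0 \<le> w a" "(\<Sum>a\<in>A. w a) \<le> 2 * C"
    and disc: "\<And>x. x \<in> unit_cube \<Longrightarrow> \<bar>f x - (c + (\<Sum>a\<in>A. w a * atom J a x))\<bar> \<le> C * cell_osc TYPE('a) J (2 ^ J)"
    using barron_discretize[OF f C J] unfolding A_def by blast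
  interpret S: stratified_atoms "cube_measure :: 'a measure" A w key "atom J" \<delta> ?k
  proof
    show "finite A" by (simp add: A_def)
    show "atom J a \<in> borel_measurable cube_measure" for a :: "'a freq_index \<times> nat"
      unfolding cube_measure_def by (rule measurable_restrict_space1) simp
    show "\<bar>atom J a x\<bar> \<le> ?k" if "x \<in> space cube_measure" for a and x :: 'a
      using that abs_atom_le[of J a x] norm_unit_cube_le[of x] by simp
    show "\<bar>atom J a x - atom J a' x\<bar> \<le> \<delta>"
      if "a \<in> A" "a' \<in> A" "key a = key a'" "x \<in> space cube_measure" for a a' and x :: 'a
      unfolding \<delta>_def using that M J by (intro atom_osc) (auto simp: key_def)
  qed (use w in auto)
  have "card (key ` A) \<le> card ((freq_cells J M :: 'a freq_index set) \<times> {..<4::nat})"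
    by (intro card_mono) (auto simp: key_def A_def atoms_def freq_cell_in)
  also have "\<dots> = D" unfolding card_cartesian_product card_freq_cells D coarse_count_def by simp
  finally have cardK: "card (key ` A) \<le> D" .
  obtain l where l: "length l \<le> 2 * D" "set l \<subseteq> {0..2 * C} \<times> A"
    and lerr: "(LINT x|cube_measure. ((\<Sum>a\<in>A. w a * atom J a x) - (\<Sum>(t, a)\<leftarrow>l. t * atom J a x))\<^sup>2) \<le> (2 * C)\<^sup>2 * \<delta>\<^sup>2 / D"
    using S.stratified_sampling[OF _ w(2) cardK D1(1)] C by auto
  define \<tau> where "\<tau> = 2 * C / Q"
  have \<tau>: "\<tau> > 0" using C Q by (simp add: \<tau>_def)
  define quant where "quant = (\<lambda>(t, a :: 'a freq_index \<times> nat). (nat \<lfloor>t / \<tau>\<rfloor>, a))"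
  define a0 where "a0 = (freq_cell J (2 ^ J) (0::'a), 0::nat)"
  have a0: "a0 \<in> atoms J" by (simp add: a0_def atoms_def freq_cell_in)
  \<comment> \<open>Net lists have the exact length 2D; the missing entries are an arbitrary atom
    with weight 0.\<close>
  define l' where "l' = map quant l @ replicate (2 * D - length l) (0, a0)"
  define z where "z = \<lfloor>c * Q / C\<rfloor>"
  define g where "g = net_fun C J Q (z, l')"
  have zc: "\<bar>c - z * (C / Q)\<bar> \<le> C / Q"
  proof -
    have "\<bar>c * Q / C - z\<bar> \<le> 1" unfolding z_def by linarith
    then have "\<bar>c * Q / C - z\<bar> * (C / Q) \<le> 1 * (C / Q)" using C Q by (intro mult_right_mono) auto
    also have "\<bar>c * Q / C - z\<bar> * (C / Q) = \<bar>(c * Q / C - z) * (C / Q)\<bar>" using C Q by (simp add: abs_mult)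
    also have "(c * Q / C - z) * (C / Q) = c - z * (C / Q)" using C Q by (simp add: left_diff_distrib diff_divide_distrib)
    finally show ?thesis by simp
  qed
  have "g \<in> net C J Q D"
  proof -
    have "- C \<le> c" "c \<le> C" using c by auto
    then have "- real Q \<le> c * Q / C" "c * Q / C \<le> real Q"
      using C Q by (simp_all add: pos_le_divide_eq pos_divide_le_eq mult.commute mult_left_mono)
        (metis minus_mult_left mult.commute mult_right_mono of_nat_0_le_iff)
    then have "z \<in> {- int Q..int Q}" unfolding z_def by (auto simp: le_floor_iff floor_le_iff)
    moreover have "set (map quant l) \<subseteq> {..Q} \<times> atoms J"
    proof
      fix p assume "p \<in> set (map quant l)"
      then obtain t a where ta: "(t, a) \<in> set l" "p = (nat \<lfloor>t / \<tau>\<rfloor>, a)" by (auto simp: quant_def)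
      have "t \<le> 2 * C" "a \<in> A" using ta l(2) by auto
      then have "t / \<tau> \<le> 2 * C / \<tau>" using \<tau> by (intro divide_right_mono) auto
      also have "\<dots> = real Q" using C Q by (simp add: \<tau>_def)
      finally have "nat \<lfloor>t / \<tau>\<rfloor> \<le> Q" by (simp add: nat_le_iff floor_le_iff)
      then show "p \<in> {..Q} \<times> atoms J" using ta \<open>a \<in> A\<close> by (simp add: A_def)
    qed
    then have "set l' \<subseteq> {..Q} \<times> atoms J" unfolding l'_def using a0 by auto
    moreover have "length l' = 2 * D" unfolding l'_def using l(1) by simp
    ultimately show ?thesis unfolding net_def g_def by auto
  qed
  have round: "\<bar>(\<Sum>(t, a)\<leftarrow>l. t * atom J a x) - (\<Sum>(q, a)\<leftarrow>l'. real q * \<tau> * atom J a x)\<bar> \<le> 2 * D * \<tau> * ?k"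
    if x: "x \<in> unit_cube" for x
  proof -
    have "\<bar>(\<Sum>(t, a)\<leftarrow>l. t * atom J a x) - (\<Sum>(q, a)\<leftarrow>map quant l. real q * \<tau> * atom J a x)\<bar> \<le> length l * (\<tau> * ?k)"
      using l(2)
    proof (induction l)
      case (Cons p l)
      obtain t a where p: "p = (t, a)" by (cases p)
      have t: "0 \<le> t" using Cons(2) p by auto
      define y where "y = t - real (nat \<lfloor>t / \<tau>\<rfloor>) * \<tau>"
      have "\<lfloor>t / \<tau>\<rfloor> * \<tau> \<le> t" "t \<le> (\<lfloor>t / \<tau>\<rfloor> + 1) * \<tau>"
        using \<tau> by (simp_all add: pos_le_divide_eq[symmetric] pos_divide_le_eq[symmetric])
      then have "\<bar>y\<bar> \<le> \<tau>" unfolding y_def using t \<tau> by (simp add: algebra_simps)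
      moreover have "\<bar>atom J a x\<bar> \<le> ?k" using abs_atom_le[of J a x] norm_unit_cube_le[OF x] by linarith
      ultimately have "\<bar>y * atom J a x\<bar> \<le> \<tau> * ?k" unfolding abs_mult by (intro mult_mono) auto
      moreover have "\<bar>(\<Sum>(t, a)\<leftarrow>l. t * atom J a x) - (\<Sum>(q, a)\<leftarrow>map quant l. real q * \<tau> * atom J a x)\<bar> \<le> length l * (\<tau> * ?k)"
        using Cons by auto
      ultimately show ?case
        unfolding p by (simp add: quant_def y_def algebra_simps abs_le_iff)
    qed simp
    also have "(\<Sum>(q, a)\<leftarrow>map quant l. real q * \<tau> * atom J a x) = (\<Sum>(q, a)\<leftarrow>l'. real q * \<tau> * atom J a x)"
      unfolding l'_def by (simp add: sum_list_replicate)
    also have "length l * (\<tau> * ?k) \<le> real (2 * D) * (\<tau> * ?k)"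
      using l(1) \<tau> k by (intro mult_right_mono) auto
    finally show ?thesis by (simp add: mult.assoc)
  qed
  define err where "err x = (\<Sum>a\<in>A. w a * atom J a x) - (\<Sum>(t, a)\<leftarrow>l. t * atom J a x)" for x
  define s where "s = 2 * C * \<delta> / sqrt D"
  have \<delta>: "\<delta> > 0" "\<delta> \<le> 8 * ?k\<^sup>2 / M"
  proof -
    have M0: "real M > 0" using M by simp
    show "\<delta> > 0" unfolding \<delta>_def cell_osc_def using k M0 by (intro mult_pos_pos add_pos_pos) auto
    have "real M \<le> 2 ^ J" using M by (metis of_nat_le_iff of_nat_numeral of_nat_power)
    then have "?e \<le> 1 / M" unfolding e using M0 by (intro divide_left_mono) auto
    then have "4 * ?k\<^sup>2 * (1 / M + ?e) \<le> 4 * ?k\<^sup>2 * (1 / M + 1 / M)" by (intro mult_left_mono) auto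
    then show "\<delta> \<le> 8 * ?k\<^sup>2 / M" unfolding \<delta>_def cell_osc_def by simp
  qed
  have s: "s > 0" unfolding s_def using C \<delta> D1 by simp
  have s_le: "s \<le> 16 * C * ?k\<^sup>2 * real M powr (- (?k + 2) / 2)"
  proof -
    have M0: "real M > 0" using M by simp
    have "sqrt (real M ^ DIM('a)) \<le> sqrt D" using D1 by simp
    then have "2 * C * \<delta> / sqrt D \<le> 2 * C * (8 * ?k\<^sup>2 / M) / sqrt (real M ^ DIM('a))"
      using C \<delta> M0 D1 by (intro frac_le mult_left_mono) auto
    also have "\<dots> = 16 * C * ?k\<^sup>2 * (1 / (real M * sqrt (real M ^ DIM('a))))" by simp
    also have "real M * sqrt (real M ^ DIM('a)) = real M powr ((?k + 2) / 2)"
    proof -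
      have "sqrt (real M ^ DIM('a)) = real M powr (?k / 2)"
        using M0 by (simp add: powr_realpow[symmetric] powr_half_sqrt[symmetric] powr_powr)
      moreover have "real M powr ((?k + 2) / 2) = real M powr 1 * real M powr (?k / 2)"
        unfolding powr_add[symmetric] by (rule arg_cong[where f = "(powr) (real M)"]) (simp add: field_simps)
      ultimately show ?thesis using M0 by simp
    qed
    also have "1 / real M powr ((?k + 2) / 2) = real M powr (- (?k + 2) / 2)"
      by (simp only: powr_minus_divide[symmetric] minus_divide_left)
    finally show ?thesis unfolding s_def .
  qed
  have [measurable]: "err \<in> borel_measurable cube_measure"
  proof -
    have "(\<lambda>x. \<Sum>(t, a)\<leftarrow>l. t * atom J a x) \<in> borel_measurable cube_measure"
      by (induction l) (auto simp: case_prod_unfold)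
    then show ?thesis unfolding err_def[abs_def] by measurable
  qed
  have errb: "\<bar>err x\<bar> \<le> (\<Sum>a\<in>A. w a * ?k) + (\<Sum>(t, a)\<leftarrow>l. \<bar>t\<bar> * ?k)" if x: "x \<in> unit_cube" for x
  proof -
    have ab: "\<bar>atom J a x\<bar> \<le> ?k" for a using abs_atom_le[of J a x] norm_unit_cube_le[OF x] by linarith
    have "\<bar>\<Sum>a\<in>A. w a * atom J a x\<bar> \<le> (\<Sum>a\<in>A. w a * ?k)"
      using w ab by (intro order_trans[OF sum_abs] sum_mono) (simp add: abs_mult mult_left_mono)
    moreover have "\<bar>\<Sum>(t, a)\<leftarrow>l. t * atom J a x\<bar> \<le> (\<Sum>(t, a)\<leftarrow>l. \<bar>t\<bar> * ?k)"
    proof (induction l)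
      case (Cons p l)
      have "\<bar>fst p * atom J (snd p) x\<bar> \<le> \<bar>fst p\<bar> * ?k" unfolding abs_mult by (rule mult_left_mono[OF ab]) simp
      then show ?case using Cons by (simp add: case_prod_unfold)
    qed simp
    ultimately show ?thesis unfolding err_def by linarith
  qed
  have ierr: "integrable cube_measure (\<lambda>x. \<bar>err x\<bar>)" "integrable cube_measure (\<lambda>x. (err x)\<^sup>2)"
  proof -
    show "integrable cube_measure (\<lambda>x. \<bar>err x\<bar>)"
      by (rule cube.integrable_const_bound[OF AE_I2]) (use errb in auto)
    have "(err x)\<^sup>2 \<le> ((\<Sum>a\<in>A. w a * ?k) + (\<Sum>(t, a)\<leftarrow>l. \<bar>t\<bar> * ?k))\<^sup>2" if "x \<in> unit_cube" for x
      using power_mono[OF errb[OF that] abs_ge_zero, of 2] by simp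
    then show "integrable cube_measure (\<lambda>x. (err x)\<^sup>2)"
      by (intro cube.integrable_const_bound[OF AE_I2]) auto
  qed
  have L1: "(LINT x|cube_measure. \<bar>err x\<bar>) \<le> s"
  proof -
    \<comment> \<open>Passage from L^2 to L^1 through |err| <= err^2/(2s) + s/2, which is optimal
      for L^2 norm \<open>s\<close>.\<close>
    have "(LINT x|cube_measure. \<bar>err x\<bar>) \<le> (LINT x|cube_measure. (1 / (2 * s)) * (err x)\<^sup>2 + s / 2)"
    proof (rule integral_mono[OF ierr(1)])
      fix x
      have "0 \<le> (\<bar>err x\<bar> - s)\<^sup>2 / (2 * s)" using s by simp
      also have "\<dots> = (1 / (2 * s)) * (err x)\<^sup>2 + s / 2 - \<bar>err x\<bar>" using s by (simp add: power2_diff field_simps power2_eq_square)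
      finally show "\<bar>err x\<bar> \<le> (1 / (2 * s)) * (err x)\<^sup>2 + s / 2" by simp
    qed (use ierr in auto)
    also have "\<dots> = (1 / (2 * s)) * (LINT x|cube_measure. (err x)\<^sup>2) + s / 2"
      using ierr by (subst Bochner_Integration.integral_add) (auto simp: cube.prob_space[simplified])
    also have "\<dots> \<le> (1 / (2 * s)) * s\<^sup>2 + s / 2"
    proof -
      have "(LINT x|cube_measure. (err x)\<^sup>2) \<le> s\<^sup>2"
        using lerr unfolding err_def s_def by (simp add: power_mult_distrib power_divide)
      then show ?thesis using s by (intro add_right_mono mult_left_mono) auto
    qed
    also have "\<dots> = s" using s by (simp add: power2_eq_square)
    finally show ?thesis .
  qed
  define r where "r = C * cell_osc TYPE('a) J (2 ^ J) + C / Q + 2 * D * \<tau> * ?k"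
  have r_le: "r \<le> 16 * C * ?k\<^sup>2 * ?e"
  proof -
    have "C * cell_osc TYPE('a) J (2 ^ J) = 8 * C * ?k\<^sup>2 * ?e" by (simp add: cell_osc_def e)
    moreover have "C / Q \<le> C * ?k\<^sup>2 * ?e"
    proof -
      have "C / Q = C * (1 / Q)" by simp
      also have "\<dots> \<le> C * (?k\<^sup>2 * ?e)" using Q(2) k C one_le_power[of ?k 2] 
        by (intro mult_left_mono) (auto intro: order_trans[OF _ mult_right_mono[of 1 "?k\<^sup>2" ?e]])
      finally show ?thesis by simp
    qed
    moreover have "2 * D * \<tau> * ?k \<le> 4 * C * ?k\<^sup>2 * ?e"
    proof -
      have "2 * D * \<tau> * ?k = 4 * C * ?k * (D * (1 / Q))" by (simp add: \<tau>_def)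
      also have "D * (1 / real Q) = ?e" using D1 unfolding Q(3) by simp
      also have "4 * C * ?k * ?e \<le> 4 * C * ?k\<^sup>2 * ?e"
        using C k self_le_power[of ?k 2] by (intro mult_right_mono mult_left_mono) auto
      finally show ?thesis .
    qed
    moreover have "0 \<le> C * ?k\<^sup>2 * ?e" using C by simp
    ultimately show ?thesis unfolding r_def by linarith
  qed
  have pw: "\<bar>f x - g x\<bar> \<le> r + \<bar>err x\<bar>" if x: "x \<in> unit_cube" for x
  proof -
    have gx: "g x = z * (C / Q) + (\<Sum>(q, a)\<leftarrow>l'. real q * \<tau> * atom J a x)"
      unfolding g_def net_fun_def \<tau>_def by simp
    show ?thesis
      unfolding gx r_def err_def using disc[OF x] zc round[OF x] by linarith
  qed
  have [measurable]: "f \<in> borel_measurable cube_measure"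
    using barron_class_measurable[OF f] by (simp add: sets_cube_measure cong: measurable_cong_sets)
  have [measurable]: "g \<in> borel_measurable cube_measure"
    unfolding cube_measure_def g_def by (rule measurable_restrict_space1) (simp add: net_fun_measurable)
  have ir: "integrable cube_measure (\<lambda>x. r + \<bar>err x\<bar>)" using ierr by auto
  have ifg: "integrable cube_measure (\<lambda>x. \<bar>f x - g x\<bar>)"
  proof (rule Bochner_Integration.integrable_bound[OF ir])
    show "AE x in cube_measure. norm \<bar>f x - g x\<bar> \<le> norm (r + \<bar>err x\<bar>)"
    proof (rule AE_I2)
      fix x assume "x \<in> space (cube_measure :: 'a measure)"
      then show "norm \<bar>f x - g x\<bar> \<le> norm (r + \<bar>err x\<bar>)" using pw[of x] by simp
    qed
  qed measurable
  have "(LINT x|cube_measure. \<bar>f x - g x\<bar>) \<le> (LINT x|cube_measure. r + \<bar>err x\<bar>)"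
    using pw by (intro integral_mono[OF ifg ir]) simp
  also have "\<dots> = r + (LINT x|cube_measure. \<bar>err x\<bar>)"
    using ierr by (subst Bochner_Integration.integral_add) (auto simp: cube.prob_space[simplified])
  also have "\<dots> \<le> 16 * C * ?k\<^sup>2 * ?e + 16 * C * ?k\<^sup>2 * real M powr (- (?k + 2) / 2)"
    using r_le L1 s_le by linarith
  also have "\<dots> = 16 * C * ?k\<^sup>2 * (real M powr (- (?k + 2) / 2) + ?e)" by (simp add: distrib_left)
  finally show ?thesis using \<open>g \<in> net C J Q D\<close> ifg unfolding Q_def by blast
qed

section \<open>Empirical risk minimisation\<close>

definition disagreement :: "('a::euclidean_space \<Rightarrow> real) \<Rightarrow> ('a \<Rightarrow> real) \<Rightarrow> real" where
  "disagreement f g = measure cube_measure {x \<in> unit_cube. horizon g x \<noteq> horizon f x}"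

lemma disagreement_sets:
  assumes f: "f \<in> borel_measurable (restrict_space borel unit_cube)"
    and g: "g \<in> borel_measurable (restrict_space borel unit_cube)"
  shows "{x \<in> unit_cube. horizon g x \<noteq> horizon f x} \<in> sets cube_measure"
proof -
  note [measurable] = horizon_measurable[OF f] horizon_measurable[OF g]
  have "{x \<in> space cube_measure. horizon g x \<noteq> horizon f x} \<in> sets cube_measure" by measurable
  then show ?thesis by simp
qed

lemma disagreement_Int: "{x \<in> unit_cube. horizon g x \<noteq> horizon f x} \<inter> unit_cube = {x \<in> unit_cube. horizon g x \<noteq> horizon f x}"
  by blast

lemma L2_norm_horizon_diff:
  assumes f: "f \<in> borel_measurable (restrict_space borel unit_cube)"
    and g: "g \<in> borel_measurable (restrict_space borel unit_cube)"
  shows "(L2_norm cube_measure (\<lambda>y. horizon g y - horizon f y))\<^sup>2 = disagreement f g"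
proof -
  have "(LINT y|cube_measure. (horizon g y - horizon f y)\<^sup>2)
      = (LINT y|cube_measure. indicator {x \<in> unit_cube. horizon g x \<noteq> horizon f x} y)"
  proof (rule Bochner_Integration.integral_cong[OF refl])
    fix y :: "'a \<times> real" assume "y \<in> space cube_measure"
    then have "y \<in> unit_cube" by simp
    with horizon_01[OF this, of f] horizon_01[OF this, of g]
    show "(horizon g y - horizon f y)\<^sup>2 = indicator {x \<in> unit_cube. horizon g x \<noteq> horizon f x} y"
      by (auto simp: indicator_def)
  qed
  also have "\<dots> = disagreement f g"
    using disagreement_sets[OF f g] disagreement_Int[of g f] by (simp add: disagreement_def cube.emeasure_eq_measure)
  finally show ?thesis by (simp add: L2_norm_def disagreement_def)
qed

text \<open>Over each x the labels differ only at heights between f(x) and g(x), an interval of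
  length |f(x) - g(x)|; Fubini does the rest. Functions with values outside [0, 1], which occur in
  the net, are covered.\<close>

lemma disagreement_le_L1:
  fixes f g :: "'a::euclidean_space \<Rightarrow> real"
  assumes f: "f \<in> borel_measurable (restrict_space borel unit_cube)"
    and g: "g \<in> borel_measurable (restrict_space borel unit_cube)"
    and i: "integrable cube_measure (\<lambda>x. \<bar>f x - g x\<bar>)"
  shows "disagreement f g \<le> (LINT x|cube_measure. \<bar>f x - g x\<bar>)"
proof -
  let ?D = "{x \<in> unit_cube. horizon g x \<noteq> horizon f x}"
  have "?D \<in> sets borel"
    using disagreement_sets[OF f g] unfolding sets_cube_measure by (subst (asm) sets_restrict_space_iff) auto
  then have Dm: "?D \<in> sets (lborel \<Otimes>\<^sub>M lborel)" unfolding lborel_prod by simp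
  have "emeasure cube_measure ?D = emeasure lborel ?D" by (rule emeasure_cube_measure) auto
  also have "\<dots> = emeasure (lborel \<Otimes>\<^sub>M lborel) ?D" by (simp add: lborel_prod)
  also have "\<dots> = (\<integral>\<^sup>+ x. emeasure lborel (Pair x -` ?D) \<partial>lborel)"
    by (rule lborel.emeasure_pair_measure_alt[OF Dm])
  also have "\<dots> \<le> (\<integral>\<^sup>+ x. ennreal \<bar>f x - g x\<bar> * indicator unit_cube x \<partial>lborel)"
  proof (rule nn_integral_mono)
    fix x :: 'a
    show "emeasure lborel (Pair x -` ?D) \<le> ennreal \<bar>f x - g x\<bar> * indicator unit_cube x"
    proof (cases "x \<in> unit_cube")
      case True
      have "Pair x -` ?D \<subseteq> {min (f x) (g x)..max (f x) (g x)}"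
        by (auto simp: horizon_def split: if_splits)
      then have "emeasure lborel (Pair x -` ?D) \<le> emeasure lborel {min (f x) (g x)..max (f x) (g x)}"
        by (rule emeasure_mono) simp
      also have "\<dots> = ennreal \<bar>f x - g x\<bar>" by (simp add: abs_if max_def min_def)
      finally show ?thesis using True by simp
    next
      case False
      then have "Pair x -` ?D = {}" by (auto simp: mem_unit_cube_prod)
      then show ?thesis by (simp only: emeasure_empty zero_le)
    qed
  qed
  also have "\<dots> = (\<integral>\<^sup>+ x. ennreal \<bar>f x - g x\<bar> \<partial>cube_measure)"
    unfolding cube_measure_def by (rule nn_integral_restrict_space[symmetric]) simp
  also have "\<dots> = ennreal (LINT x|cube_measure. \<bar>f x - g x\<bar>)"
    by (rule nn_integral_eq_integral[OF i]) simp
  finally show ?thesis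
    by (simp add: disagreement_def cube.emeasure_eq_measure)
qed

text \<open>The constants 2 and 1/2 come from e <= 3 and 1/e <= 1/2. The last step 1 + t <= exp t
  prepares for the m-th power.\<close>

lemma exp_moment_bound:
  fixes f g g' :: "'a::euclidean_space \<Rightarrow> real"
  assumes f: "f \<in> borel_measurable (restrict_space borel unit_cube)"
    and g: "g \<in> borel_measurable (restrict_space borel unit_cube)"
    and g': "g' \<in> borel_measurable (restrict_space borel unit_cube)"
  shows "(\<integral>\<^sup>+ x. ennreal (exp (of_bool (horizon g' x \<noteq> horizon f x) - of_bool (horizon g x \<noteq> horizon f x))) \<partial>cube_measure)
    \<le> ennreal (exp (2 * disagreement f g' - disagreement f g / 2))"
proof -
  let ?D = "\<lambda>g. {x \<in> unit_cube. horizon g x \<noteq> horizon f x}"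
  have D: "?D g \<in> sets cube_measure" "?D g' \<in> sets cube_measure" using disagreement_sets f g g' by blast+
  let ?r = "\<lambda>x. 1 + 2 * indicator (?D g') x - indicator (?D g) x / 2 :: real"
  have i: "integrable cube_measure ?r" using D by (auto simp: cube.emeasure_eq_measure)
  have em1: "exp (- 1) \<le> (1/2 :: real)" using exp_ge_add_one_self[of 1] by (simp add: exp_minus field_simps)
  have e1: "exp 1 \<le> (3 :: real)" by (rule exp_le)
  have "(\<integral>\<^sup>+ x. ennreal (exp (of_bool (horizon g' x \<noteq> horizon f x) - of_bool (horizon g x \<noteq> horizon f x))) \<partial>cube_measure)
      \<le> (\<integral>\<^sup>+ x. ennreal (?r x) \<partial>cube_measure)"
  proof (intro nn_integral_mono ennreal_leI)
    fix x :: "'a \<times> real" assume "x \<in> space cube_measure"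
    then show "exp (of_bool (horizon g' x \<noteq> horizon f x) - of_bool (horizon g x \<noteq> horizon f x)) \<le> ?r x"
      using em1 e1 by (auto simp: indicator_def)
  qed
  also have "\<dots> = ennreal (LINT x|cube_measure. ?r x)"
    by (rule nn_integral_eq_integral[OF i]) (auto simp: indicator_def)
  also have "(LINT x|cube_measure. ?r x) = 1 + (2 * disagreement f g' - disagreement f g / 2)"
    using D disagreement_Int[of g f] disagreement_Int[of g' f]
    by (simp add: disagreement_def cube.emeasure_eq_measure cube.prob_space[simplified])
  also have "ennreal \<dots> \<le> ennreal (exp (2 * disagreement f g' - disagreement f g / 2))"
    by (intro ennreal_leI exp_ge_add_one_self)
  finally show ?thesis .
qed

definition mistakes :: "nat \<Rightarrow> ('a::euclidean_space \<Rightarrow> real) \<Rightarrow> (nat \<Rightarrow> ('a \<times> real) \<times> real) \<Rightarrow> real" where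
  "mistakes m g Z = (\<Sum>i\<in>{1..m}. of_bool (horizon g (fst (Z i)) \<noteq> snd (Z i)))"

lemma mistakes_measurable:
  assumes g: "g \<in> borel_measurable (restrict_space borel unit_cube)"
  shows "mistakes m g \<in> borel_measurable (PiM {1..m} (\<lambda>_. labelled_space))"
proof -
  have fst_m: "fst \<in> measurable (borel :: (('a \<times> real) \<times> real) measure) borel"
    and snd_m: "snd \<in> borel_measurable (borel :: (('a \<times> real) \<times> real) measure)"
    by (rule borel_measurable_continuous_onI, intro continuous_intros)+
  have f: "fst \<in> measurable labelled_space (cube_measure :: ('a \<times> real) measure)"
    unfolding labelled_space_def measurable_cong_sets[OF refl sets_cube_measure]
    by (rule measurable_restrict_space2) (auto simp: space_restrict_space intro: measurable_restrict_space1 fst_m)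
  have s [measurable]: "snd \<in> borel_measurable (labelled_space :: (('a \<times> real) \<times> real) measure)"
    unfolding labelled_space_def by (rule measurable_restrict_space1[OF snd_m])
  have h [measurable]: "(\<lambda>z. horizon g (fst z)) \<in> borel_measurable (labelled_space :: (('a \<times> real) \<times> real) measure)"
    by (rule measurable_compose[OF f horizon_measurable[OF g]])
  have "(\<lambda>z. of_bool (horizon g (fst z) \<noteq> snd z) :: real) \<in> borel_measurable (labelled_space :: (('a \<times> real) \<times> real) measure)"
    unfolding of_bool_def by measurable
  then have "(\<lambda>Z. of_bool (horizon g (fst (Z i)) \<noteq> snd (Z i)) :: real)
      \<in> borel_measurable (PiM {1..m} (\<lambda>_. labelled_space :: (('a \<times> real) \<times> real) measure))" if "i \<in> {1..m}" for i
    by (rule measurable_compose[OF measurable_component_singleton[OF that]])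
  then show ?thesis unfolding mistakes_def[abs_def] by (intro borel_measurable_sum)
qed

text \<open>\<delta> is a free threshold: the first term is the risk of an acceptable choice, the
  second bounds the contribution of net elements with risk above \<delta> that do at least as well
  on the sample as the good approximant \<open>g'\<close>. The condition 8 \<epsilon> <= \<delta>
  lets their excess risk outweigh that of \<open>g'\<close>.\<close>

lemma erm_bound:
  fixes \<C> :: "('a::euclidean_space \<Rightarrow> real) set"
  assumes C: "\<And>f. f \<in> \<C> \<Longrightarrow> f \<in> borel_measurable (restrict_space borel unit_cube)"
    and S: "finite S" "S \<noteq> {}" "\<And>g. g \<in> S \<Longrightarrow> g \<in> borel_measurable (restrict_space borel unit_cube)"
    and approx: "\<And>f. f \<in> \<C> \<Longrightarrow> \<exists>g\<in>S. disagreement f g \<le> \<epsilon>" and \<delta>: "8 * \<epsilon> \<le> \<delta>" "0 \<le> \<delta>"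
  shows "minimax_error (horizon_class \<C>) m \<le> ennreal (\<delta> + card S * exp (- (real m * \<delta> / 4)))"
proof -
  let ?L = "PiM {1..m} (\<lambda>_. labelled_space :: (('a \<times> real) \<times> real) measure)"
  let ?P = "PiM {1..m} (\<lambda>_. cube_measure :: ('a \<times> real) measure)"
  interpret product_sigma_finite "\<lambda>_::nat. cube_measure :: ('a \<times> real) measure" ..
  \<comment> \<open>The whole set of minimisers is recorded first: it takes finitely many values,
    each determined by inequalities between mistake counts. Choosing one element is then a map on a
    discrete space and measurable for free.\<close>
  define winners where "winners Z = {g \<in> S. \<forall>g'\<in>S. mistakes m g Z \<le> mistakes m g' Z}" for Z
  obtain g0 where g0: "g0 \<in> S" using S by blast
  \<comment> \<open>\<open>g0\<close> is the default on the empty set, so that the choice always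
    lies in \<open>S\<close>.\<close>
  define pick where "pick T = (if T = {} then g0 else SOME g. g \<in> T)" for T :: "('a \<Rightarrow> real) set"
  have pick: "pick T \<in> S" if "T \<subseteq> S" for T
    using that g0 someI_ex[of "\<lambda>g. g \<in> T"] by (auto simp: pick_def)
  define A where "A Z = horizon (pick (winners Z))" for Z
  have hL2: "horizon g \<in> L2_functions cube_measure" if "g \<in> S" for g
    using horizon_measurable[OF S(3)[OF that]] horizon_01 by (rule L2_functions_01)
  have "winners \<in> measurable ?L (count_space (Pow S))"
  proof (subst measurable_count_space_eq2, simp add: S, intro conjI ballI)
    show "winners \<in> space ?L \<rightarrow> Pow S" by (auto simp: winners_def)
    fix T assume T: "T \<in> Pow S"
    have [measurable]: "mistakes m g \<in> borel_measurable ?L" if "g \<in> S" for g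
      by (rule mistakes_measurable[OF S(3)[OF that]])
    have "winners -` {T} \<inter> space ?L = {Z \<in> space ?L. \<forall>g\<in>S. (g \<in> T) = (\<forall>g'\<in>S. mistakes m g Z \<le> mistakes m g' Z)}"
    proof (rule set_eqI)
      fix Z
      have "winners Z = T \<longleftrightarrow> (\<forall>g\<in>S. (g \<in> T) = (\<forall>g'\<in>S. mistakes m g Z \<le> mistakes m g' Z))"
        unfolding winners_def using T by blast
      then show "Z \<in> winners -` {T} \<inter> space ?L \<longleftrightarrow>
          Z \<in> {Z \<in> space ?L. \<forall>g\<in>S. (g \<in> T) = (\<forall>g'\<in>S. mistakes m g Z \<le> mistakes m g' Z)}"
        by (simp only: vimage_singleton_eq Int_iff mem_Collect_eq conj_commute)
    qed
    also have "\<dots> \<in> sets ?L"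
    proof (intro sets.sets_Collect_finite_All S(1))
      fix g assume g: "g \<in> S"
      have "{Z \<in> space ?L. \<forall>g'\<in>S. mistakes m g Z \<le> mistakes m g' Z} \<in> sets ?L"
        using g by (intro sets.sets_Collect_finite_All S(1) borel_measurable_le mistakes_measurable S(3))
      then show "{Z \<in> space ?L. (g \<in> T) = (\<forall>g'\<in>S. mistakes m g Z \<le> mistakes m g' Z)} \<in> sets ?L"
        using sets.sets_Collect_neg[of ?L "\<lambda>Z. \<forall>g'\<in>S. mistakes m g Z \<le> mistakes m g' Z"]
        by (cases "g \<in> T") simp_all
    qed
    finally show "winners -` {T} \<inter> space ?L \<in> sets ?L" .
  qed
  moreover have "(\<lambda>T. horizon (pick T)) \<in> measurable (count_space (Pow S)) (L2_borel cube_measure)"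
    using hL2 pick by (auto simp: measurable_count_space_eq1)
  ultimately have "(\<lambda>Z. horizon (pick (winners Z))) \<in> measurable ?L (L2_borel cube_measure)"
    by (rule measurable_compose)
  then have A: "A \<in> estimators m" unfolding A_def[abs_def] estimators_def .
  have "expected_sq_error m A (horizon f) \<le> ennreal (\<delta> + card S * exp (- (real m * \<delta> / 4)))" if f: "f \<in> \<C>" for f
  proof -
    let ?Z = "labelled_sample m (horizon f)"
    let ?p = "disagreement f"
    obtain g' where g': "g' \<in> S" "?p g' \<le> \<epsilon>" using approx[OF f] by blast
    define Bad where "Bad = {g \<in> S. \<delta> < ?p g}"
    have finB: "finite Bad" using S by (simp add: Bad_def)
    define \<phi> where "\<phi> g x = ennreal (exp (of_bool (horizon g' x \<noteq> horizon f x) - of_bool (horizon g x \<noteq> horizon f x)))" for g and x :: "'a \<times> real"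
    have \<phi>m: "\<phi> g \<in> borel_measurable cube_measure" if "g \<in> S" for g
    proof -
      note [measurable] = horizon_measurable[OF C[OF f]] horizon_measurable[OF S(3)[OF that]] horizon_measurable[OF S(3)[OF g'(1)]]
      show ?thesis unfolding \<phi>_def of_bool_def by measurable
    qed
    have pw: "ennreal ((L2_norm cube_measure (\<lambda>y. A (?Z X) y - horizon f y))\<^sup>2) \<le> ennreal \<delta> + (\<Sum>g\<in>Bad. \<Prod>i\<in>{1..m}. \<phi> g (X i))" for X
    proof -
      have mi: "mistakes m g (?Z X) = (\<Sum>i\<in>{1..m}. of_bool (horizon g (X i) \<noteq> horizon f (X i)))" for g
        unfolding mistakes_def labelled_sample_def by (intro sum.cong) auto
      have "winners (?Z X) \<noteq> {}"
      proof -
        define g where "g = arg_min_on (\<lambda>g. mistakes m g (?Z X)) S"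
        have "g \<in> S" unfolding g_def by (rule arg_min_if_finite(1)[OF S(1,2)])
        moreover have "mistakes m g (?Z X) \<le> mistakes m h (?Z X)" if "h \<in> S" for h
          unfolding g_def by (rule arg_min_least[OF S(1,2) that])
        ultimately have "g \<in> winners (?Z X)" by (simp add: winners_def)
        then show ?thesis by blast
      qed
      then have "pick (winners (?Z X)) \<in> winners (?Z X)" unfolding pick_def by (simp add: some_in_eq)
      then obtain g where g: "g = pick (winners (?Z X))" "g \<in> S" "mistakes m g (?Z X) \<le> mistakes m g' (?Z X)"
        using g' by (auto simp: winners_def)
      have err: "(L2_norm cube_measure (\<lambda>y. A (?Z X) y - horizon f y))\<^sup>2 = ?p g"
        unfolding A_def g(1)[symmetric] by (rule L2_norm_horizon_diff[OF C[OF f] S(3)[OF g(2)]])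
      show ?thesis
      proof (cases "?p g \<le> \<delta>")
        case True
        then show ?thesis unfolding err by (intro add_increasing2) (auto intro: ennreal_leI)
      next
        case False
        then have gB: "g \<in> Bad" using g by (simp add: Bad_def)
        \<comment> \<open>A risk is at most 1, and the exponential is at least 1 because the chosen
          \<open>g\<close> makes no more mistakes than \<open>g'\<close>. The exponential of the
          difference is a product over the sample points.\<close>
        have "?p g \<le> 1" by (simp add: disagreement_def)
        also have "1 \<le> exp (mistakes m g' (?Z X) - mistakes m g (?Z X))" using g by simp
        also have "\<dots> = (\<Prod>i\<in>{1..m}. exp (of_bool (horizon g' (X i) \<noteq> horizon f (X i)) - of_bool (horizon g (X i) \<noteq> horizon f (X i))))"
          unfolding mi sum_subtractf[symmetric] by (rule exp_sum) simp
        finally have "ennreal (?p g) \<le> (\<Prod>i\<in>{1..m}. \<phi> g (X i))"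
          unfolding \<phi>_def by (subst prod_ennreal) (auto intro: ennreal_leI)
        also have "\<dots> \<le> (\<Sum>g\<in>Bad. \<Prod>i\<in>{1..m}. \<phi> g (X i))"
          using finB gB by (intro sum_nonneg_leq_bound[OF finB _ refl gB]) auto
        finally show ?thesis unfolding err by (intro add_increasing) auto
      qed
    qed
    have bad: "(\<integral>\<^sup>+ X. (\<Prod>i\<in>{1..m}. \<phi> g (X i)) \<partial>?P) \<le> ennreal (exp (- (real m * \<delta> / 4)))" if g: "g \<in> Bad" for g
    proof -
      have gS: "g \<in> S" "\<delta> < ?p g" using g by (auto simp: Bad_def)
      have "(\<integral>\<^sup>+ X. (\<Prod>i\<in>{1..m}. \<phi> g (X i)) \<partial>?P) = (\<Prod>i\<in>{1..m}. \<integral>\<^sup>+ x. \<phi> g x \<partial>cube_measure)"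
        using \<phi>m[OF gS(1)] by (intro product_nn_integral_prod) auto
      also have "\<dots> = (\<integral>\<^sup>+ x. \<phi> g x \<partial>cube_measure) ^ m" by simp
      also have "\<dots> \<le> ennreal (exp (2 * ?p g' - ?p g / 2)) ^ m"
        unfolding \<phi>_def by (intro power_mono exp_moment_bound C f S gS g') simp
      \<comment> \<open>The exponent is at most 2 \<epsilon> - \<delta>/2 <= \<delta>/4 -
        \<delta>/2.\<close>
      also have "\<dots> \<le> ennreal (exp (- \<delta> / 4)) ^ m"
        using g' \<delta> gS by (intro power_mono ennreal_leI) auto
      also have "\<dots> = ennreal (exp (- (real m * \<delta> / 4)))"
        by (simp add: ennreal_power exp_of_nat_mult[symmetric])
      finally show ?thesis .
    qed
    have "expected_sq_error m A (horizon f) = (\<integral>\<^sup>+ X. ennreal ((L2_norm cube_measure (\<lambda>y. A (?Z X) y - horizon f y))\<^sup>2) \<partial>?P)"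
      by (simp add: expected_sq_error_def labelled_sample_def)
    also have "\<dots> \<le> (\<integral>\<^sup>+ X. ennreal \<delta> + (\<Sum>g\<in>Bad. \<Prod>i\<in>{1..m}. \<phi> g (X i)) \<partial>?P)"
      by (intro nn_integral_mono pw)
    also have "\<dots> = ennreal \<delta> + (\<Sum>g\<in>Bad. \<integral>\<^sup>+ X. (\<Prod>i\<in>{1..m}. \<phi> g (X i)) \<partial>?P)"
    proof -
      interpret PP: prob_space ?P by (rule prob_space_PiM) (rule cube.prob_space_axioms)
      have mm: "(\<lambda>X. \<Prod>i\<in>{1..m}. \<phi> g (X i)) \<in> borel_measurable ?P" if "g \<in> Bad" for g
      proof -
        have [measurable]: "\<phi> g \<in> borel_measurable cube_measure" using that \<phi>m by (simp add: Bad_def)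
        show ?thesis by measurable
      qed
      have "(\<integral>\<^sup>+ X. ennreal \<delta> \<partial>?P) = ennreal \<delta>"
        by (simp only: nn_integral_const PP.emeasure_space_1 mult_1_right)
      moreover have "(\<integral>\<^sup>+ X. (\<Sum>g\<in>Bad. \<Prod>i\<in>{1..m}. \<phi> g (X i)) \<partial>?P) = (\<Sum>g\<in>Bad. \<integral>\<^sup>+ X. (\<Prod>i\<in>{1..m}. \<phi> g (X i)) \<partial>?P)"
        by (rule nn_integral_sum[OF mm])
      moreover have "(\<integral>\<^sup>+ X. ennreal \<delta> + (\<Sum>g\<in>Bad. \<Prod>i\<in>{1..m}. \<phi> g (X i)) \<partial>?P)
          = (\<integral>\<^sup>+ X. ennreal \<delta> \<partial>?P) + (\<integral>\<^sup>+ X. (\<Sum>g\<in>Bad. \<Prod>i\<in>{1..m}. \<phi> g (X i)) \<partial>?P)"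
        by (rule nn_integral_add[OF _ borel_measurable_sum[OF mm]]) simp
      ultimately show ?thesis by simp
    qed
    also have "\<dots> \<le> ennreal \<delta> + (\<Sum>g\<in>Bad. ennreal (exp (- (real m * \<delta> / 4))))"
      using bad by (intro add_left_mono sum_mono)
    also have "\<dots> = ennreal (\<delta> + card Bad * exp (- (real m * \<delta> / 4)))"
      using \<delta> by (simp add: ennreal_mult ennreal_of_nat_eq_real_of_nat)
    also have "\<dots> \<le> ennreal (\<delta> + card S * exp (- (real m * \<delta> / 4)))"
      using card_mono[of S Bad] S by (intro ennreal_leI add_left_mono mult_right_mono) (auto simp: Bad_def)
    finally show ?thesis .
  qed
  then have "(SUP h\<in>horizon_class \<C>. expected_sq_error m A h) \<le> ennreal (\<delta> + card S * exp (- (real m * \<delta> / 4)))"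
    by (intro SUP_least) (auto simp: horizon_class_def)
  then show ?thesis unfolding minimax_error_def by (rule INF_lower2[OF A])
qed

section \<open>The rates\<close>

lemma minimax_error_upper:
  fixes C :: real
  assumes C: "C > 0"
  shows "\<exists>c>0. \<forall>m::nat. m \<ge> 1 \<longrightarrow>
    minimax_error (horizon_class (barron_class C :: ('a::euclidean_space \<Rightarrow> real) set)) m
      \<le> ennreal (c * (real m powr (- ((real DIM('a) + 2) / (3 * real DIM('a) + 2))) *
          ln (2 * real m) powr ((5 * real DIM('a) + 2) / (3 * real DIM('a) + 2))))"
proof -
  let ?R = "\<lambda>m. minimax_error (horizon_class (barron_class C :: ('a \<Rightarrow> real) set)) m"
  define k where "k = real DIM('a)"
  have k: "k \<ge> 1" using DIM_ge_Suc0[where 'a = 'a] by (simp add: k_def)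
  obtain K where K: "K > 0" and card_le: "\<And>J M D. 1 \<le> J \<Longrightarrow> 1 \<le> M \<Longrightarrow> M \<le> 2 ^ J \<Longrightarrow>
      D = coarse_count TYPE('a) J M \<Longrightarrow>
      real (card (net C J (D * 2 ^ J) D :: ('a \<Rightarrow> real) set)) \<le> exp (K * real M ^ DIM('a) * (real J)\<^sup>2)"
    using ln_card_net[of C, where 'a = 'a] unfolding Let_def by blast
  \<comment> \<open>\<open>a\<close> is the exponent of the rate and \<open>e\<close> that of the
    stated logarithm. The error terms carry the powers 0, 1 and 2a of the logarithm, all at most
    \<open>e\<close>.\<close>
  define a where "a = (k + 2) / (3 * k + 2)"
  define e where "e = (5 * k + 2) / (3 * k + 2)"
  have a: "0 < a" "a \<le> 1" "1 \<le> e" "e \<le> 2"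
    using k by (simp_all add: a_def e_def field_simps)
  have a2: "2 * a \<le> e"
  proof -
    have "(2 * (k + 2)) / (3 * k + 2) \<le> e" unfolding e_def using k by (intro divide_right_mono) auto
    then show ?thesis by (simp add: a_def)
  qed
  \<comment> \<open>196 = 14^2 and 9^k come from J <= 14 T and M <= 9 z.\<close>
  define K' where "K' = K * 196 * 9 ^ DIM('a)"
  have K': "K' > 0" using K by (simp add: K'_def)
  define G where "G = 256 * C * k\<^sup>2 + 4 * K'"
  have G: "G > 0" using C K' by (simp add: G_def add_nonneg_pos)
  define c where "c = 3 * G + 15"
  have "?R m
      \<le> ennreal (c * (real m powr (- a) * ln (2 * real m) powr e))" if m: "m \<ge> 1" for m :: nat
  proof -
    define T where "T = ln (2 * real m)"
    have m1: "real m \<ge> 1" using m by simp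
    have T23: "T \<ge> 2/3"
    proof -
      have "ln 2 \<le> T" unfolding T_def using m1 by (subst ln_le_cancel_iff) auto
      then show ?thesis using ln2_ge_two_thirds by linarith
    qed
    then have T0: "T > 0" by linarith
    define V where "V = real m powr (- a) * T powr e"
    have V0: "V > 0" using m1 T0 by (simp add: V_def)
    \<comment> \<open>T may lie below 1, where a smaller exponent gives a larger power. Since T >=
      2/3 and the exponents differ by at most 2, the loss is at most (3/2)^2 <= 3.\<close>
    have Tpow: "T powr b \<le> 3 * T powr e" if "0 \<le> b" "b \<le> e" for b
    proof -
      have "T powr (b - e) \<le> (2/3) powr (b - e)" using T23 that by (intro powr_mono2') auto
      also have "\<dots> = (3/2) powr (e - b)"
        by (subst powr_minus[of _ "e - b", simplified minus_diff_eq]) (simp add: powr_divide field_simps)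
      also have "\<dots> \<le> (3/2) powr 2" using that a by (intro powr_mono) auto
      also have "\<dots> \<le> 3" by (simp add: powr_numeral power2_eq_square)
      finally have "T powr (b - e) * T powr e \<le> 3 * T powr e" by (intro mult_right_mono) auto
      then show ?thesis unfolding powr_add[symmetric] by simp
    qed
    have mVpow: "real m powr (- a) * T powr b \<le> 3 * V" if "0 \<le> b" "b \<le> e" for b
      using mult_left_mono[OF Tpow[OF that], of "real m powr (- a)"] by (simp add: V_def mult_ac)
    have inv_m: "1 / real m \<le> real m powr (- a)"
    proof -
      have "real m powr (- 1) \<le> real m powr (- a)" using m1 a by (intro powr_mono) auto
      then show ?thesis using m1 by (simp add: powr_minus_divide)
    qed
    \<comment> \<open>The effective sample size: J is of order T, and J^2 is the logarithmic factor
      in the log-size of the net.\<close>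
    define y where "y = real m / T\<^sup>2"
    have y0: "y > 0" using m1 T0 by (simp add: y_def)
    have y_lower: "y \<ge> 1 / 8"
    proof -
      have "ln (sqrt (2 * real m)) \<le> sqrt (2 * real m)" using m1 ln_le_minus_one[of "sqrt (2 * real m)"] by simp
      then have "T \<le> 2 * sqrt (2 * real m)" unfolding T_def using m1 by (simp add: ln_sqrt)
      then have "T\<^sup>2 \<le> (2 * sqrt (2 * real m))\<^sup>2" using T0 by (intro power_mono) auto
      also have "\<dots> = 8 * real m" by (simp add: power_mult_distrib)
      finally show ?thesis using T0 by (simp add: y_def field_simps)
    qed
    have y_upper: "y \<le> 3 * real m"
    proof -
      have "(2/3)\<^sup>2 \<le> T\<^sup>2" using T23 by (intro power_mono) auto
      then have "1 \<le> 3 * T\<^sup>2" by (simp add: power2_eq_square)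
      then have "real m * 1 \<le> real m * (3 * T\<^sup>2)" by (intro mult_left_mono) auto
      then show ?thesis using T0 by (simp add: y_def divide_le_eq mult_ac)
    qed
    define z where "z = y powr (2 / (3 * k + 2))"
    have ex: "0 \<le> 2 / (3 * k + 2)" "2 / (3 * k + 2) \<le> 1" using k by simp_all
    have z0: "z > 0" using y0 by (simp add: z_def)
    have z_lower: "z \<ge> 1 / 8"
    proof -
      have "(1/8) powr 1 \<le> (1/8 :: real) powr (2 / (3 * k + 2))" using ex by (intro powr_mono') auto
      also have "\<dots> \<le> z" unfolding z_def using y_lower ex by (intro powr_mono2) auto
      finally show ?thesis by simp
    qed
    have z_upper: "z \<le> 3 * real m"
    proof -
      have "z \<le> (3 * real m) powr (2 / (3 * k + 2))" unfolding z_def using y_upper y0 ex by (intro powr_mono2) auto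
      also have "\<dots> \<le> (3 * real m) powr 1" using m1 ex by (intro powr_mono) auto
      finally show ?thesis using m1 by simp
    qed
    define M where "M = nat \<lceil>z\<rceil>"
    have M: "M \<ge> 1" "z \<le> real M" "real M \<le> z + 1" using z0 unfolding M_def by linarith+
    have M9: "real M \<le> 9 * z" using M z_lower by linarith
    \<comment> \<open>2^J >= 32 m is large enough both for M, which is at most 3m + 1, and for
      2^(-J) to be below \<open>Y\<close>.\<close>
    define J where "J = nat \<lceil>log 2 (32 * real m)\<rceil>"
    have lg: "log 2 (32 * real m) = 5 + log 2 (real m)"
    proof -
      have "log 2 (32 :: real) = 5" using log_pow_cancel[of "2::real" 5] by simp
      then show ?thesis using m1 by (simp add: log_mult)
    qed
    have lg0: "0 \<le> log 2 (real m)" using m1 by simp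
    have J: "J \<ge> 1" "log 2 (32 * real m) \<le> real J" "real J \<le> log 2 (32 * real m) + 1"
      using lg lg0 unfolding J_def by linarith+
    have J14: "real J \<le> 14 * T"
    proof -
      have "ln (real m) \<le> T" unfolding T_def using m1 by (subst ln_le_cancel_iff) auto
      then have "ln (real m) / ln 2 \<le> T / (2/3)"
        using ln2_ge_two_thirds T0 m1 by (intro frac_le) auto
      also have "\<dots> \<le> 2 * T" using T0 by simp
      finally have "log 2 (real m) \<le> 2 * T" unfolding log_def .
      then show ?thesis using J(3) lg T23 by linarith
    qed
    have J2: "32 * real m \<le> 2 ^ J"
    proof -
      have "32 * real m = 2 powr log 2 (32 * real m)" using m1 by simp
      also have "\<dots> \<le> 2 powr real J" using J by (intro powr_mono) auto
      finally show ?thesis by (simp add: powr_realpow)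
    qed
    have MJ: "M \<le> 2 ^ J"
    proof -
      have "real M \<le> 2 ^ J" using M(3) z_upper J2 m1 by linarith
      then show ?thesis by (metis of_nat_le_iff of_nat_numeral of_nat_power)
    qed
    define Y where "Y = y powr (- a)"
    have Y: "Y = real m powr (- a) * T powr (2 * a)"
    proof -
      have "Y = real m powr (- a) / (T\<^sup>2) powr (- a)" unfolding Y_def y_def using m1 T0 by (simp add: powr_divide)
      also have "(T\<^sup>2) powr (- a) = T powr (- (2 * a))"
      proof -
        have "T\<^sup>2 = T powr 2" using T0 by simp
        then show ?thesis by (simp only: powr_powr mult_minus_right)
      qed
      finally show ?thesis by (simp only: powr_minus divide_inverse inverse_inverse_eq)
    qed
    have Y0: "Y > 0" unfolding Y_def using y0 by simp
    have YV: "Y \<le> 3 * V" unfolding Y using mVpow[of "2 * a"] a a2 by simp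
    have MY: "real M powr (- (k + 2) / 2) \<le> Y"
    proof -
      have "real M powr (- (k + 2) / 2) \<le> z powr (- (k + 2) / 2)"
        using M z0 k by (intro powr_mono2') auto
      also have "\<dots> = Y"
      proof -
        have "2 / (3 * k + 2) * (- (k + 2) / 2) = - a" using k by (simp add: a_def divide_simps, simp add: algebra_simps)
        then show ?thesis unfolding z_def Y_def powr_powr by (simp only:)
      qed
      finally show ?thesis .
    qed
    have eY: "2 powr - real J \<le> Y"
    proof -
      have "2 powr - real J = 1 / 2 ^ J" by (simp add: powr_minus_divide powr_realpow)
      also have "\<dots> \<le> 1 / (32 * real m)" using J2 m1 by (intro divide_left_mono) auto
      also have "\<dots> \<le> (1 / real m) * (4 / 9)" using m1 by (simp add: field_simps)
      also have "\<dots> \<le> real m powr (- a) * T powr (2 * a)"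
      proof (rule mult_mono[OF inv_m])
        have "4/9 = (2/3 :: real) powr 2" by (simp add: powr_numeral power2_eq_square)
        also have "\<dots> \<le> (2/3) powr (2 * a)" using a by (intro powr_mono') auto
        also have "\<dots> \<le> T powr (2 * a)" using T23 a by (intro powr_mono2) auto
        finally show "4/9 \<le> T powr (2 * a)" .
      qed auto
      finally show ?thesis unfolding Y .
    qed
    define D where "D = coarse_count TYPE('a) J M"
    define S where "S = (net C J (D * 2 ^ J) D :: ('a \<Rightarrow> real) set)"
    define \<epsilon> where "\<epsilon> = 32 * C * k\<^sup>2 * Y"
    \<comment> \<open>In G Y one part is 8 \<epsilon>, the other, after multiplication by m/4,
      cancels the log-size of the net. The extra 4T/m leaves the factor exp(-T) = 1/(2m).\<close>
    define \<delta> where "\<delta> = G * Y + 4 * T / real m"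
    have \<delta>: "8 * \<epsilon> \<le> \<delta>" "0 \<le> \<delta>"
    proof -
      have "\<delta> = 8 * \<epsilon> + 4 * K' * Y + 4 * T / real m" by (simp add: \<delta>_def \<epsilon>_def G_def algebra_simps)
      then show "8 * \<epsilon> \<le> \<delta>" using K' Y0 T0 by simp
      show "0 \<le> \<delta>" using G Y0 T0 by (simp add: \<delta>_def)
    qed
    have Smeas: "g \<in> borel_measurable (restrict_space borel unit_cube)" if "g \<in> S" for g
      using net_measurable that unfolding S_def by (intro measurable_restrict_space1)
    have approx: "\<exists>g\<in>S. disagreement f g \<le> \<epsilon>" if f: "f \<in> barron_class C" for f :: "'a \<Rightarrow> real"
    proof -
      obtain g where g: "g \<in> S" "integrable cube_measure (\<lambda>x. \<bar>f x - g x\<bar>)"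
        "(LINT x|cube_measure. \<bar>f x - g x\<bar>) \<le> 16 * C * k\<^sup>2 * (real M powr (- (k + 2) / 2) + 2 powr - real J)"
        using net_approx[OF f C J(1) M(1) MJ D_def] unfolding S_def k_def by blast
      have "disagreement f g \<le> (LINT x|cube_measure. \<bar>f x - g x\<bar>)"
        by (rule disagreement_le_L1[OF barron_class_measurable[OF f] Smeas[OF g(1)] g(2)])
      also note g(3)
      also have "16 * C * k\<^sup>2 * (real M powr (- (k + 2) / 2) + 2 powr - real J) \<le> 16 * C * k\<^sup>2 * (Y + Y)"
        using C MY eY by (intro mult_left_mono add_mono) auto
      also have "\<dots> = \<epsilon>" by (simp add: \<epsilon>_def)
      finally show ?thesis using g(1) by blast
    qed
    have "?R m
        \<le> ennreal (\<delta> + card S * exp (- (real m * \<delta> / 4)))"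
      by (rule erm_bound[OF barron_class_measurable _ _ Smeas approx \<delta>])
        (auto simp: S_def finite_net net_nonempty)
    also have "\<dots> \<le> ennreal (c * V)"
    proof (rule ennreal_leI)
      have card: "real (card S) \<le> exp (K' * (real m * Y))"
      proof -
        have "real (card S) \<le> exp (K * real M ^ DIM('a) * (real J)\<^sup>2)"
          unfolding S_def by (rule card_le[OF J(1) M(1) MJ D_def])
        also have "\<dots> \<le> exp (K' * (real m * Y))"
        proof (subst exp_le_cancel_iff)
          have "K * real M ^ DIM('a) * (real J)\<^sup>2 \<le> K * (9 * z) ^ DIM('a) * (14 * T)\<^sup>2"
            using K M9 J14 z0 by (intro mult_mono power_mono mult_left_mono) auto
          also have "\<dots> = K' * (z ^ DIM('a) * T\<^sup>2)" by (simp add: K'_def power_mult_distrib)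
          also have "z ^ DIM('a) = y powr (2 * k / (3 * k + 2))"
            using y0 by (simp add: z_def powr_realpow[symmetric] powr_powr k_def mult.commute)
          \<comment> \<open>The balance: since 2k/(3k+2) = 1 - a and y T^2 = m, the log-size over m
            is of the same order as the approximation error \<open>Y\<close>.\<close>
          also have "y powr (2 * k / (3 * k + 2)) * T\<^sup>2 = real m * Y"
          proof -
            have "2 * k / (3 * k + 2) = 1 + - a" using k by (simp add: a_def field_simps)
            then have "y powr (2 * k / (3 * k + 2)) = y powr 1 * Y" unfolding Y_def powr_add[symmetric] by (simp only:)
            then show ?thesis using y0 T0 by (simp add: y_def)
          qed
          finally show "K * real M ^ DIM('a) * (real J)\<^sup>2 \<le> K' * (real m * Y)" .
        qed
        finally show ?thesis .
      qed
      have "real m * \<delta> / 4 = 64 * C * k\<^sup>2 * (real m * Y) + K' * (real m * Y) + T"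
        using m1 by (simp add: \<delta>_def G_def field_simps)
      moreover have "0 \<le> 64 * C * k\<^sup>2 * (real m * Y)" using C Y0 by simp
      ultimately have "K' * (real m * Y) + - (real m * \<delta> / 4) \<le> - T" by linarith
      have "card S * exp (- (real m * \<delta> / 4)) \<le> exp (K' * (real m * Y)) * exp (- (real m * \<delta> / 4))"
        using card by (intro mult_right_mono) auto
      also have "\<dots> \<le> exp (- T)"
        unfolding exp_add[symmetric] by (subst exp_le_cancel_iff) fact
      also have "exp T = 2 * real m" unfolding T_def using m1 by simp
      then have "exp (- T) = 1 / (2 * real m)" by (simp only: exp_minus inverse_eq_divide)
      also have "\<dots> \<le> 1 / real m" using m1 by (simp add: field_simps)
      also have "\<dots> \<le> 3 * V" using inv_m mVpow[of 0] a T0 by simp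
      finally have 1: "card S * exp (- (real m * \<delta> / 4)) \<le> 3 * V" .
      have "T / real m \<le> 3 * V"
      proof -
        have "T / real m = 1 / real m * T" by simp
        also have "\<dots> \<le> real m powr (- a) * T powr 1" using inv_m T0 by (intro mult_mono) auto
        also have "\<dots> \<le> 3 * V" using mVpow[of 1] a by simp
        finally show ?thesis .
      qed
      moreover have "G * Y \<le> G * (3 * V)" using YV G by (intro mult_left_mono) auto
      \<comment> \<open>3G pays for G Y, 12 for 4T/m and 3 for the union bound.\<close>
      moreover have "c * V = G * (3 * V) + 4 * (3 * V) + 3 * V" by (simp add: c_def algebra_simps)
      ultimately show "\<delta> + card S * exp (- (real m * \<delta> / 4)) \<le> c * V"
        using 1 unfolding \<delta>_def by simp
    qed
    finally show ?thesis unfolding V_def T_def .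
  qed
  moreover have "c > 0" using G by (simp add: c_def)
  ultimately show ?thesis unfolding a_def e_def k_def by blast
qed

theorem corollary4p7:
  fixes d :: nat and C :: real
  assumes "d \<ge> 2" and "CARD('n::finite) = d - 1" and "C > 0"
  shows "\<exists>c\<^sub>1>0. \<exists>c\<^sub>2>0. \<forall>m::nat. m \<ge> 1 \<longrightarrow>
    ennreal (c\<^sub>1 * (real m powr (- ((real d + 1) / (3 * real d - 1))) *
        ln (2 * real m) powr
          (- ((real d + 1) * (5 * real d - 3) / ((3 * real d - 1) * (2 * real d - 2))))))
      \<le> minimax_error (horizon_class (barron_class C :: (real ^ 'n \<Rightarrow> real) set)) m \<and>
    minimax_error (horizon_class (barron_class C :: (real ^ 'n \<Rightarrow> real) set)) m
      \<le> ennreal (c\<^sub>2 * (real m powr (- ((real d + 1) / (3 * real d - 1))) *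
        ln (2 * real m) powr ((5 * real d - 3) / (3 * real d - 1))))"
proof -
  have dim: "real DIM(real ^ 'n) = real d - 1" using assms by simp
  \<comment> \<open>With k = d - 1: k + 2 = d + 1, 3k + 2 = 3d - 1 and 5k + 2 = 5d - 3.\<close>
  have ex: "(real DIM(real ^ 'n) + 2) / (3 * real DIM(real ^ 'n) + 2) = (real d + 1) / (3 * real d - 1)"
    "(5 * real DIM(real ^ 'n) + 2) / (3 * real DIM(real ^ 'n) + 2) = (5 * real d - 3) / (3 * real d - 1)"
    unfolding dim by (simp_all add: algebra_simps)
  define q where "q = (real d + 1) * (5 * real d - 3) / ((3 * real d - 1) * (2 * real d - 2))"
  have q: "q \<ge> 0" using assms unfolding q_def by (intro divide_nonneg_nonneg mult_nonneg_nonneg) auto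
  obtain c where c: "c > 0" "\<And>m. m \<ge> 1 \<Longrightarrow> ennreal (c * real m powr (- ((real d + 1) / (3 * real d - 1))))
      \<le> minimax_error (horizon_class (barron_class C :: (real ^ 'n \<Rightarrow> real) set)) m"
    using minimax_error_lower[OF \<open>C > 0\<close>, where 'a = "real ^ 'n"] unfolding ex by blast
  obtain c' where c': "c' > 0" "\<And>m. m \<ge> 1 \<Longrightarrow> minimax_error (horizon_class (barron_class C :: (real ^ 'n \<Rightarrow> real) set)) m
      \<le> ennreal (c' * (real m powr (- ((real d + 1) / (3 * real d - 1))) * ln (2 * real m) powr ((5 * real d - 3) / (3 * real d - 1))))"
    using minimax_error_upper[OF \<open>C > 0\<close>, where 'a = "real ^ 'n"] unfolding ex by blast
  \<comment> \<open>The lower rate comes without a logarithm. As ln(2m) >= ln 2 and q >= 0, the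
    product of \<open>ln 2 powr q\<close> and \<open>ln (2 * real m) powr (- q)\<close> is at most
    1, which brings it into the stated form.\<close>
  define c1 where "c1 = c * ln 2 powr q"
  have "ennreal (c1 * (real m powr (- ((real d + 1) / (3 * real d - 1))) * ln (2 * real m) powr (- q)))
      \<le> minimax_error (horizon_class (barron_class C :: (real ^ 'n \<Rightarrow> real) set)) m" if m: "m \<ge> 1" for m :: nat
  proof -
    have "ln 2 \<le> ln (2 * real m)" using m by (subst ln_le_cancel_iff) auto
    then have "ln (2 * real m) powr (- q) \<le> ln 2 powr (- q)" using q by (intro powr_mono2') auto
    then have "ln 2 powr q * ln (2 * real m) powr (- q) \<le> ln 2 powr q * ln 2 powr (- q)"
      by (intro mult_left_mono) auto
    also have "\<dots> = 1" unfolding powr_add[symmetric] by simp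
    finally have "(c * real m powr (- ((real d + 1) / (3 * real d - 1)))) * (ln 2 powr q * ln (2 * real m) powr (- q))
        \<le> (c * real m powr (- ((real d + 1) / (3 * real d - 1)))) * 1"
      using c by (intro mult_left_mono) auto
    then have "ennreal (c1 * (real m powr (- ((real d + 1) / (3 * real d - 1))) * ln (2 * real m) powr (- q)))
        \<le> ennreal (c * real m powr (- ((real d + 1) / (3 * real d - 1))))"
      unfolding c1_def by (intro ennreal_leI) (simp add: mult_ac)
    also note c(2)[OF m]
    finally show ?thesis .
  qed
  moreover have "c1 > 0" using c by (simp add: c1_def)
  ultimately show ?thesis using c' unfolding q_def by blast
qed

end
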